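(* Let $B\subset A$ be an inclusion of simple unital $C^*$-algebras admitting a conditional expectation $A\to B$ of finite index, with tower of $C^*$-basic constructions $B\subset A\subset A_1\subset A_2\subset\cdots$, $A_0=A$. For each $k\geq0$, let $\mathcal{F}_k:B'\cap A_k\to A'\cap A_{k+1}$ and $\mathcal{F}_k^{-1}:A'\cap A_{k+1}\to B'\cap A_k$ be the maps $$\mathcal{F}_k(x)=\tau^{-\frac{k+2}{2}}E^{B'\cap A_{k+1}}_{A'\cap A_{k+1}}(xe_{k+1}e_k\cdots e_2e_1),\qquad \mathcal{F}_k^{-1}(x)=\tau^{-\frac{k+2}{2}}E_{k+1}(xe_1e_2\cdots e_ke_{k+1}).$$ Then $$\mathcal{F}_k\circ\mathcal{F}_k^{-1}=\mathrm{Id}_{A'\cap A_{k+1}}\quad\text{and}\quad \mathcal{F}_k^{-1}\circ\mathcal{F}_k=\mathrm{Id}_{B'\cap A_k}\qquad\text{for all }k\geq0.$$ In particular, if $B\subset A$ is irreducible (i.e. $B'\cap A=\mathbb{C}$), then so is $A\subset A_1$.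
   Context: Inclusions of unital $C^*$-algebras have common identity. A conditional expectation $E:A\to B$ is a positive norm-one projection onto $B$ with $E(axb)=aE(x)b$ for $a,b\in B$, $x\in A$. It has finite index if there is a finite set $\{\lambda_i\}\subset A$ (a quasi-basis) with $x=\sum_i\lambda_iE(\lambda_i^*x)=\sum_iE(x\lambda_i)\lambda_i^*$ for all $x\in A$; then $\mathrm{Ind}(E)=\sum_i\lambda_i\lambda_i^*$, independent of the quasi-basis. If $A,B$ are simple unital and a finite-index conditional expectation exists, all finite-index ones have scalar index and there is a unique one $E_0=E^A_B$ of minimal index; $[A:B]_0:=\mathrm{Ind}(E^A_B)$ and $\tau:=[A:B]_0^{-1}$. Basic construction: $A$ is a Hilbert $B$-module with $\langle x,y\rangle_B=E_0(x^*y)$; $A$ acts by left multiplication; $e_1$ is the projection $x\mapsto E_0(x)$; $A_1$ is the $C^*$-algebra of adjointable $B$-linear maps on $A$ generated by $A$ and $e_1$. It is simple and unital, with minimal (dual) conditional expectation $E_1:A_1\to A$, $E_1(xe_1y)=\tau xy$ for $x,y\in A$, and $[A_1:A]_0=[A:B]_0$. Iterating, with $A_{-1}=B$, $A_0=A$, one gets the tower with minimal conditional expectations $E_k:A_k\to A_{k-1}$ and Jones projections $e_k\in A_k$ implementing $E_{k-1}$. The relative commutants $B'\cap A_k$ are finite dimensional, and $\mathrm{tr}=(E_0\circ E_1\circ\cdots\circ E_k)|_{B'\cap A_k}$ are consistent faithful tracial states on them. $E^{B'\cap A_k}_{A'\cap A_k}$ is the $\mathrm{tr}$-preserving conditional expectation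 from $B'\cap A_k$ onto $A'\cap A_k$. *)

theory Defs
  imports "HOL-Analysis.Analysis"
begin

section \<open>C*-algebras and their unital subalgebras\<close>

text \<open>
  Nonzero unital complex C*-algebras. The type plays the role of one ambient C*-algebra that
  contains the whole tower under consideration (for instance the C*-inductive limit of the tower);
  the algebras themselves are norm-closed unital *-subalgebras, so inclusions of algebras are
  inclusions of sets and have a common identity.
\<close>

class cstar_algebra = real_normed_algebra_1 + complete_space +
  fixes scaleC :: "complex \<Rightarrow> 'a \<Rightarrow> 'a"  (infixr "*\<^sub>C" 75)
    and adj :: "'a \<Rightarrow> 'a"  ("_\<^sup>\<star>" [1000] 1000)
  assumes scaleC_add_right: "c *\<^sub>C (x + y) = c *\<^sub>C x + c *\<^sub>C y"
    and scaleC_add_left: "(c + d) *\<^sub>C x = c *\<^sub>C x + d *\<^sub>C x"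
    and scaleC_scaleC: "c *\<^sub>C (d *\<^sub>C x) = (c * d) *\<^sub>C x"
    and scaleR_scaleC: "r *\<^sub>R x = complex_of_real r *\<^sub>C x"
    and mult_scaleC_left: "(c *\<^sub>C x) * y = c *\<^sub>C (x * y)"
    and mult_scaleC_right: "x * (c *\<^sub>C y) = c *\<^sub>C (x * y)"
    and norm_scaleC: "norm (c *\<^sub>C x) = cmod c * norm x"
    and adj_adj: "(x\<^sup>\<star>)\<^sup>\<star> = x"
    and adj_add: "(x + y)\<^sup>\<star> = x\<^sup>\<star> + y\<^sup>\<star>"
    and adj_scaleC: "(c *\<^sub>C x)\<^sup>\<star> = cnj c *\<^sub>C x\<^sup>\<star>"
    and adj_mult: "(x * y)\<^sup>\<star> = y\<^sup>\<star> * x\<^sup>\<star>"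
    and norm_adj_mult: "norm (x\<^sup>\<star> * x) = (norm x)\<^sup>2"

definition cstar_subalgebra :: "'a::cstar_algebra set \<Rightarrow> bool" where
  "cstar_subalgebra A \<longleftrightarrow>
     1 \<in> A \<and> closed A \<and>
     (\<forall>x\<in>A. \<forall>y\<in>A. x + y \<in> A \<and> x * y \<in> A) \<and>
     (\<forall>x\<in>A. x\<^sup>\<star> \<in> A \<and> (\<forall>c. c *\<^sub>C x \<in> A))"

definition closed_ideal :: "'a::cstar_algebra set \<Rightarrow> 'a set \<Rightarrow> bool" where
  "closed_ideal A J \<longleftrightarrow>
     J \<subseteq> A \<and> 0 \<in> J \<and> closed J \<and>
     (\<forall>x\<in>J. \<forall>y\<in>J. x + y \<in> J) \<and> (\<forall>x\<in>J. \<forall>c. c *\<^sub>C x \<in> J) \<and>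
     (\<forall>x\<in>J. \<forall>a\<in>A. a * x \<in> J \<and> x * a \<in> J)"

definition simple_cstar_subalgebra :: "'a::cstar_algebra set \<Rightarrow> bool" where
  "simple_cstar_subalgebra A \<longleftrightarrow>
     cstar_subalgebra A \<and> (\<forall>J. closed_ideal A J \<longrightarrow> J = {0} \<or> J = A)"

definition rel_commutant :: "'a::cstar_algebra set \<Rightarrow> 'a set \<Rightarrow> 'a set" where
  "rel_commutant B A = {x \<in> A. \<forall>b\<in>B. b * x = x * b}"

definition irreducible_inclusion :: "'a::cstar_algebra set \<Rightarrow> 'a set \<Rightarrow> bool" where
  "irreducible_inclusion B A \<longleftrightarrow> rel_commutant B A = range (\<lambda>c. c *\<^sub>C 1)"

definition positive_in :: "'a::cstar_algebra set \<Rightarrow> 'a \<Rightarrow> bool" where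
  "positive_in A x \<longleftrightarrow> (\<exists>z\<in>A. x = z\<^sup>\<star> * z)"


section \<open>Conditional expectations and index\<close>

text \<open>
  Only the values on \<open>A\<close> of a map \<open>E\<close> matter. Since \<open>E 1 = 1\<close>,
  contractivity says that \<open>E\<close> has norm one.
\<close>

definition cond_expectation :: "'a::cstar_algebra set \<Rightarrow> 'a set \<Rightarrow> ('a \<Rightarrow> 'a) \<Rightarrow> bool" where
  "cond_expectation A B E \<longleftrightarrow>
     (\<forall>x\<in>A. E x \<in> B) \<and> (\<forall>b\<in>B. E b = b) \<and>
     (\<forall>x\<in>A. \<forall>y\<in>A. E (x + y) = E x + E y) \<and> (\<forall>x\<in>A. \<forall>c. E (c *\<^sub>C x) = c *\<^sub>C E x) \<and>
     (\<forall>x\<in>A. positive_in A x \<longrightarrow> positive_in B (E x)) \<and>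
     (\<forall>x\<in>A. norm (E x) \<le> norm x) \<and>
     (\<forall>a\<in>B. \<forall>b\<in>B. \<forall>x\<in>A. E (a * x * b) = a * E x * b)"

definition quasi_basis ::
    "'a::cstar_algebra set \<Rightarrow> ('a \<Rightarrow> 'a) \<Rightarrow> nat \<Rightarrow> (nat \<Rightarrow> 'a) \<Rightarrow> bool" where
  "quasi_basis A E n l \<longleftrightarrow>
     (\<forall>i<n. l i \<in> A) \<and>
     (\<forall>x\<in>A. x = (\<Sum>i<n. l i * E ((l i)\<^sup>\<star> * x)) \<and>
            x = (\<Sum>i<n. E (x * l i) * (l i)\<^sup>\<star>))"

definition finite_index_expectation ::
    "'a::cstar_algebra set \<Rightarrow> 'a set \<Rightarrow> ('a \<Rightarrow> 'a) \<Rightarrow> bool" where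
  "finite_index_expectation A B E \<longleftrightarrow>
     cond_expectation A B E \<and> (\<exists>n l. quasi_basis A E n l)"

definition Ind :: "'a::cstar_algebra set \<Rightarrow> ('a \<Rightarrow> 'a) \<Rightarrow> 'a" where
  "Ind A E = (THE y. \<exists>n l. quasi_basis A E n l \<and> y = (\<Sum>i<n. l i * (l i)\<^sup>\<star>))"

text \<open>For simple \<open>A\<close> the element \<open>Ind A E\<close> is a scalar; this is its value as a real number.\<close>

definition scalar_index :: "'a::cstar_algebra set \<Rightarrow> ('a \<Rightarrow> 'a) \<Rightarrow> real" where
  "scalar_index A E = (THE c. Ind A E = of_real c)"

definition minimal_expectation ::
    "'a::cstar_algebra set \<Rightarrow> 'a set \<Rightarrow> ('a \<Rightarrow> 'a) \<Rightarrow> bool" where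
  "minimal_expectation A B E \<longleftrightarrow>
     finite_index_expectation A B E \<and>
     (\<forall>F. finite_index_expectation A B F \<longrightarrow> scalar_index A E \<le> scalar_index A F)"


section \<open>The basic construction\<close>

text \<open>
  In this section \<open>A\<close> is the Hilbert \<open>B\<close>-module with inner product \<open>E (x\<^sup>\<star> * y)\<close>. Operators on
  it are functions in \<open>A \<rightarrow>\<^sub>E A\<close>, i.e. they are undefined outside \<open>A\<close>, so that equality of
  functions is equality of operators.
\<close>

definition module_norm :: "('a::cstar_algebra \<Rightarrow> 'a) \<Rightarrow> 'a \<Rightarrow> real" where
  "module_norm E x = sqrt (norm (E (x\<^sup>\<star> * x)))"

definition module_adjoint ::
    "'a::cstar_algebra set \<Rightarrow> ('a \<Rightarrow> 'a) \<Rightarrow> ('a \<Rightarrow> 'a) \<Rightarrow> ('a \<Rightarrow> 'a) \<Rightarrow> bool" where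
  "module_adjoint A E T S \<longleftrightarrow> (\<forall>x\<in>A. \<forall>y\<in>A. E ((T x)\<^sup>\<star> * y) = E (x\<^sup>\<star> * S y))"

definition module_operators ::
    "'a::cstar_algebra set \<Rightarrow> 'a set \<Rightarrow> ('a \<Rightarrow> 'a) \<Rightarrow> ('a \<Rightarrow> 'a) set" where
  "module_operators A B E =
     {T \<in> A \<rightarrow>\<^sub>E A.
        (\<forall>x\<in>A. \<forall>y\<in>A. T (x + y) = T x + T y) \<and> (\<forall>x\<in>A. \<forall>c. T (c *\<^sub>C x) = c *\<^sub>C T x) \<and>
        (\<forall>x\<in>A. \<forall>b\<in>B. T (x * b) = T x * b) \<and>
        (\<exists>S \<in> A \<rightarrow>\<^sub>E A. module_adjoint A E T S)}"

text \<open>The last clause is closedness under limits in the operator norm.\<close>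

definition operator_cstar_algebra ::
    "'a::cstar_algebra set \<Rightarrow> 'a set \<Rightarrow> ('a \<Rightarrow> 'a) \<Rightarrow> ('a \<Rightarrow> 'a) set \<Rightarrow> bool" where
  "operator_cstar_algebra A B E M \<longleftrightarrow>
     M \<subseteq> module_operators A B E \<and>
     (\<forall>T\<in>M. \<forall>S\<in>M. (\<lambda>x\<in>A. T x + S x) \<in> M \<and> compose A T S \<in> M) \<and>
     (\<forall>T\<in>M. \<forall>c. (\<lambda>x\<in>A. c *\<^sub>C T x) \<in> M) \<and>
     (\<forall>T\<in>M. \<forall>S \<in> module_operators A B E. module_adjoint A E T S \<longrightarrow> S \<in> M) \<and>
     (\<forall>T \<in> module_operators A B E.
        (\<forall>\<epsilon>>0. \<exists>S\<in>M. \<forall>x\<in>A. module_norm E (T x - S x) \<le> \<epsilon> * module_norm E x) \<longrightarrow> T \<in> M)"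

definition left_mult :: "'a::cstar_algebra set \<Rightarrow> 'a \<Rightarrow> 'a \<Rightarrow> 'a" where
  "left_mult A a = (\<lambda>x\<in>A. a * x)"

definition operator_basic_construction ::
    "'a::cstar_algebra set \<Rightarrow> 'a set \<Rightarrow> ('a \<Rightarrow> 'a) \<Rightarrow> ('a \<Rightarrow> 'a) set" where
  "operator_basic_construction A B E =
     {T \<in> module_operators A B E.
        \<forall>M. operator_cstar_algebra A B E M \<and> left_mult A ` A \<subseteq> M \<and> restrict E A \<in> M \<longrightarrow> T \<in> M}"

text \<open>
  \<open>A1\<close>, together with \<open>e\<close>, is (identified with) the C*-basic construction of \<open>B \<subseteq> A\<close> with respect
  to \<open>E\<close>: there is a *-isomorphism \<open>\<pi>\<close> from \<open>A1\<close> onto the C*-algebra of operators on the Hilbert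
  module \<open>A\<close> generated by left multiplications and the Jones projection. It sends each
  \<open>a \<in> A \<subseteq> A1\<close> to left multiplication by \<open>a\<close>, and \<open>e\<close> to the Jones projection.
\<close>

definition basic_construction ::
    "'a::cstar_algebra set \<Rightarrow> 'a set \<Rightarrow> ('a \<Rightarrow> 'a) \<Rightarrow> 'a set \<Rightarrow> 'a \<Rightarrow> bool" where
  "basic_construction A B E A1 e \<longleftrightarrow>
     cstar_subalgebra A1 \<and> A \<subseteq> A1 \<and> e \<in> A1 \<and>
     (\<exists>\<pi>. bij_betw \<pi> A1 (operator_basic_construction A B E) \<and>
        (\<forall>x\<in>A1. \<forall>y\<in>A1. \<pi> (x + y) = (\<lambda>a\<in>A. \<pi> x a + \<pi> y a)) \<and>
        (\<forall>x\<in>A1. \<forall>c. \<pi> (c *\<^sub>C x) = (\<lambda>a\<in>A. c *\<^sub>C \<pi> x a)) \<and>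
        (\<forall>x\<in>A1. \<forall>y\<in>A1. \<pi> (x * y) = compose A (\<pi> x) (\<pi> y)) \<and>
        (\<forall>x\<in>A1. module_adjoint A E (\<pi> x) (\<pi> (x\<^sup>\<star>))) \<and>
        (\<forall>a\<in>A. \<pi> a = left_mult A a) \<and>
        \<pi> e = restrict E A)"


section \<open>The tower\<close>

text \<open>\<open>below B A k\<close> is $A_{k-1}$, where $A_{-1} = B$.\<close>

definition below :: "'a set \<Rightarrow> (nat \<Rightarrow> 'a set) \<Rightarrow> nat \<Rightarrow> 'a set" where
  "below B A k = (case k of 0 \<Rightarrow> B | Suc j \<Rightarrow> A j)"

text \<open>The value \<open>e 0\<close> is irrelevant: the Jones projections are \<open>e 1, e 2, \<dots>\<close>.\<close>

definition basic_construction_tower ::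
    "'a::cstar_algebra set \<Rightarrow> (nat \<Rightarrow> 'a set) \<Rightarrow> (nat \<Rightarrow> 'a \<Rightarrow> 'a) \<Rightarrow> (nat \<Rightarrow> 'a) \<Rightarrow> bool" where
  "basic_construction_tower B A E e \<longleftrightarrow>
     (\<forall>k. minimal_expectation (A k) (below B A k) (E k) \<and>
          basic_construction (A k) (below B A k) (E k) (A (Suc k)) (e (Suc k)))"

text \<open>The trace \<open>E 0 \<circ> E 1 \<circ> \<dots> \<circ> E k\<close>; on \<open>rel_commutant B (A k)\<close> its values are multiples of 1.\<close>

fun tower_trace :: "(nat \<Rightarrow> 'a \<Rightarrow> 'a) \<Rightarrow> nat \<Rightarrow> 'a \<Rightarrow> 'a" where
  "tower_trace E 0 x = E 0 x"
| "tower_trace E (Suc k) x = tower_trace E k (E (Suc k) x)"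

text \<open>
  The trace-preserving conditional expectation from \<open>rel_commutant B (A k)\<close> onto
  \<open>rel_commutant (A 0) (A k)\<close>; extensionality makes it unique as a HOL function.
\<close>

definition commutant_expectation ::
    "'a::cstar_algebra set \<Rightarrow> (nat \<Rightarrow> 'a set) \<Rightarrow> (nat \<Rightarrow> 'a \<Rightarrow> 'a) \<Rightarrow> nat \<Rightarrow> 'a \<Rightarrow> 'a" where
  "commutant_expectation B A E k =
     (THE F. F \<in> extensional (rel_commutant B (A k)) \<and>
             cond_expectation (rel_commutant B (A k)) (rel_commutant (A 0) (A k)) F \<and>
             (\<forall>x \<in> rel_commutant B (A k). tower_trace E k (F x) = tower_trace E k x))"

definition tower_tau :: "(nat \<Rightarrow> 'a::cstar_algebra set) \<Rightarrow> (nat \<Rightarrow> 'a \<Rightarrow> 'a) \<Rightarrow> real" where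
  "tower_tau A E = inverse (scalar_index (A 0) (E 0))"

definition descending_word :: "(nat \<Rightarrow> 'a::monoid_mult) \<Rightarrow> nat \<Rightarrow> 'a" where
  "descending_word e n = prod_list (map e (rev [1..<Suc n]))"

definition ascending_word :: "(nat \<Rightarrow> 'a::monoid_mult) \<Rightarrow> nat \<Rightarrow> 'a" where
  "ascending_word e n = prod_list (map e [1..<Suc n])"

definition fourier ::
    "'a::cstar_algebra set \<Rightarrow> (nat \<Rightarrow> 'a set) \<Rightarrow> (nat \<Rightarrow> 'a \<Rightarrow> 'a) \<Rightarrow> (nat \<Rightarrow> 'a) \<Rightarrow> nat \<Rightarrow> 'a \<Rightarrow> 'a" where
  "fourier B A E e k x =
     (tower_tau A E powr (- (real k + 2) / 2)) *\<^sub>R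
       commutant_expectation B A E (k + 1) (x * descending_word e (k + 1))"

definition inverse_fourier ::
    "(nat \<Rightarrow> 'a::cstar_algebra set) \<Rightarrow> (nat \<Rightarrow> 'a \<Rightarrow> 'a) \<Rightarrow> (nat \<Rightarrow> 'a) \<Rightarrow> nat \<Rightarrow> 'a \<Rightarrow> 'a" where
  "inverse_fourier A E e k x =
     (tower_tau A E powr (- (real k + 2) / 2)) *\<^sub>R
       E (k + 1) (x * ascending_word e (k + 1))"

end

theory Submission
  imports Defs
begin

text \<open>
  Write \<open>l\<close> for a quasi-basis of \<open>E 0\<close>. The trace-preserving expectation onto the commutant of
  \<open>A 0\<close> is the average \<open>y \<mapsto> \<tau> *\<^sub>R (\<Sum>i. l i * y * (l i)\<^sup>\<star>)\<close>. Once this is known, both compositions are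
  short computations with the Jones projections. In \<open>inverse_fourier_fourier\<close> the word
  \<open>e (k+1) \<dots> e 1\<close>, the factor \<open>(l i)\<^sup>\<star>\<close> and the word \<open>e 1 \<dots> e (k+1)\<close> collapse to
  \<open>\<tau> ^ k *\<^sub>R (E 0 ((l i)\<^sup>\<star>) * e (k+1))\<close>, and summation over the quasi-basis removes the \<open>l i\<close>. In
  \<open>fourier_inverse_fourier\<close> the push-down identity \<open>E (k+1) (z * e (k+1)) * e (k+1) = \<tau> *\<^sub>R (z * e (k+1))\<close>
  together with the Temperley--Lieb relations leaves the average of \<open>x * e 1\<close>, and
  \<open>\<Sum>i. l i * e 1 * (l i)\<^sup>\<star> = 1\<close>.

  These computations need \<open>E (k+1) (x * e (k+1) * y) = \<tau> *\<^sub>R (x * y)\<close> with the same \<open>\<tau>\<close> at all levels,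
  although \<open>E (k+1)\<close> is only known to be minimal; and they need the average to preserve the trace. Both
  follow from one property of minimal conditional expectations \<open>E\<close> from \<open>A\<close> onto \<open>B\<close>, when both
  algebras have trivial centre: on the relative commutant of \<open>B\<close> the map \<open>y \<mapsto> \<Sum>i. l i * y * (l i)\<^sup>\<star>\<close>
  is the index times \<open>E\<close>. Such an \<open>E\<close> is called balanced below.

  \<^item> Minimal implies balanced (\<open>minimal_balanced\<close>): the index of the rescaled map
    \<open>x \<mapsto> E (u * x * u)\<close>, where \<open>u\<close> is the inverse square root of \<open>1 - s y\<close>, would otherwise drop
    below that of \<open>E\<close> for a small real number \<open>s\<close>.
  \<^item> There is at most one balanced conditional expectation (\<open>balanced_unique\<close>), since its density with
    respect to another one is a multiple of an isometry.
  \<^item> The dual of a balanced expectation is balanced and has the same index (\<open>dual_balanced\<close>,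
    \<open>scalar_index_dual\<close>). Hence the minimal expectation at the next level is the dual one.

  Triviality of the centre holds for simple algebras and is inherited by the basic construction,
  because a central operator on the Hilbert module is right multiplication by a central element of
  \<open>B\<close>; so it propagates through the tower.

  Comparing indices requires that the rescaled maps are contractive, and identifying averages and
  duals as conditional expectations requires that sums of elements \<open>z\<^sup>\<star> * z\<close> are again of this form.
  Both rest on the order theory of C*-algebras, which is developed from the binomial series of the
  square root, without spectra.
\<close>


section \<open>Elementary facts about C*-algebras\<close>

lemma commute_mult:
  fixes b x y :: "'a::semigroup_mult"
  assumes "b * x = x * b" "b * y = y * b"
  shows "b * (x * y) = x * y * b"
  using assms by (metis mult.assoc)

instance cstar_algebra \<subseteq> banach ..

lemma scaleC_of_real: "complex_of_real r *\<^sub>C (x::'a::cstar_algebra) = r *\<^sub>R x"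
  by (simp add: scaleR_scaleC)

lemma scaleC_one [simp]: "1 *\<^sub>C (x::'a::cstar_algebra) = x"
  using scaleC_of_real[of 1 x] by simp

lemma scaleC_zero_left [simp]: "0 *\<^sub>C (x::'a::cstar_algebra) = 0"
  using scaleC_of_real[of 0 x] by simp

lemma scaleC_zero_right [simp]: "c *\<^sub>C (0::'a::cstar_algebra) = 0"
  using scaleC_add_right[of c "0::'a" 0] by simp

lemma scaleC_minus_right: "c *\<^sub>C (- (x::'a::cstar_algebra)) = - (c *\<^sub>C x)"
  using scaleC_add_right[of c x "- x"] by (simp add: eq_neg_iff_add_eq_0 add.commute)

lemma scaleC_diff_right: "c *\<^sub>C (x - (y::'a::cstar_algebra)) = c *\<^sub>C x - c *\<^sub>C y"
  using scaleC_add_right[of c x "- y"] by (simp add: scaleC_minus_right)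

lemma scaleC_minus_left: "(- c) *\<^sub>C (x::'a::cstar_algebra) = - (c *\<^sub>C x)"
  using scaleC_add_left[of c "- c" x] by (simp add: eq_neg_iff_add_eq_0 add.commute)

lemma scaleC_minus1: "(- 1) *\<^sub>C (x::'a::cstar_algebra) = - x"
  using scaleC_minus_left[of 1 x] by simp

lemma scaleC_scaleR: "c *\<^sub>C (r *\<^sub>R (x::'a::cstar_algebra)) = r *\<^sub>R (c *\<^sub>C x)"
  by (simp add: scaleR_scaleC scaleC_scaleC mult.commute)

lemma of_real_scaleC: "(of_real r :: 'a::cstar_algebra) = complex_of_real r *\<^sub>C 1"
  unfolding scaleC_of_real by (rule of_real_def)

lemma scaleC_sum_right: "c *\<^sub>C (\<Sum>i\<in>I. f i :: 'a::cstar_algebra) = (\<Sum>i\<in>I. c *\<^sub>C f i)"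
  by (induction I rule: infinite_finite_induct) (simp_all add: scaleC_add_right)

lemma scaleC_1_cancel: "c *\<^sub>C (1::'a::cstar_algebra) = d *\<^sub>C 1 \<longleftrightarrow> c = d"
proof
  assume "c *\<^sub>C (1::'a) = d *\<^sub>C 1"
  then have "(c - d) *\<^sub>C (1::'a) = 0"
    using scaleC_add_left[of c "- d" "1::'a"] by (simp add: scaleC_minus_left)
  then show "c = d" using norm_scaleC[of "c - d" "1::'a"] by simp
qed simp

lemma adj_zero [simp]: "(0::'a::cstar_algebra)\<^sup>\<star> = 0"
  using adj_add[of "0::'a" 0] by simp

lemma adj_minus: "(- (x::'a::cstar_algebra))\<^sup>\<star> = - x\<^sup>\<star>"
  using adj_scaleC[of "- 1" x] by (simp add: scaleC_minus1)

lemma adj_diff: "(x - (y::'a::cstar_algebra))\<^sup>\<star> = x\<^sup>\<star> - y\<^sup>\<star>"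
  using adj_add[of x "- y"] by (simp add: adj_minus)

lemma adj_scaleR: "(r *\<^sub>R (x::'a::cstar_algebra))\<^sup>\<star> = r *\<^sub>R x\<^sup>\<star>"
  by (simp add: scaleR_scaleC adj_scaleC)

lemma adj_one [simp]: "(1::'a::cstar_algebra)\<^sup>\<star> = 1"
proof -
  have "(1::'a)\<^sup>\<star> = 1\<^sup>\<star> * (1\<^sup>\<star>)\<^sup>\<star>" by (simp add: adj_adj)
  also have "\<dots> = (1\<^sup>\<star> * 1)\<^sup>\<star>" by (simp only: adj_mult)
  also have "\<dots> = 1" by (simp add: adj_adj)
  finally show ?thesis .
qed

lemma adj_of_real [simp]: "(of_real r :: 'a::cstar_algebra)\<^sup>\<star> = of_real r"
  by (simp add: of_real_def adj_scaleR)

lemma adj_sum: "(\<Sum>i\<in>I. f i :: 'a::cstar_algebra)\<^sup>\<star> = (\<Sum>i\<in>I. (f i)\<^sup>\<star>)"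
  by (induction I rule: infinite_finite_induct) (simp_all add: adj_add)

lemma adj_power: "((x::'a::cstar_algebra) ^ n)\<^sup>\<star> = (x\<^sup>\<star>) ^ n"
  by (induction n) (simp_all add: adj_mult power_commutes)

lemma norm_adj [simp]: "norm ((x::'a::cstar_algebra)\<^sup>\<star>) = norm x"
proof -
  have le: "norm x \<le> norm (x\<^sup>\<star>)" for x :: 'a
  proof (cases "x = 0")
    case False
    have "(norm x)\<^sup>2 \<le> norm (x\<^sup>\<star>) * norm x"
      using norm_mult_ineq[of "x\<^sup>\<star>" x] by (simp add: norm_adj_mult)
    with False show ?thesis by (simp add: power2_eq_square)
  qed simp
  show ?thesis using le[of x] le[of "x\<^sup>\<star>"] by (simp add: adj_adj)
qed

lemma bounded_linear_adj: "bounded_linear (adj :: 'a::cstar_algebra \<Rightarrow> 'a)"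
  by (rule bounded_linear_intro[where K = 1]) (simp_all add: adj_add adj_scaleR)

lemma adj_mult_self_eq_0: "(x::'a::cstar_algebra)\<^sup>\<star> * x = 0 \<longleftrightarrow> x = 0"
  using norm_adj_mult[of x] by auto

lemma norm_selfadjoint_square:
  "(x::'a::cstar_algebra)\<^sup>\<star> = x \<Longrightarrow> norm (x * x) = (norm x)\<^sup>2"
  using norm_adj_mult[of x] by simp

lemma selfadjoint_square_eq_0: "(x::'a::cstar_algebra)\<^sup>\<star> = x \<Longrightarrow> x * x = 0 \<Longrightarrow> x = 0"
  using adj_mult_self_eq_0[of x] by simp

text \<open>
  The real and the imaginary part. Self-adjoint elements carry the order, so statements about linear
  maps and about scalars are reduced to them.
\<close>

lemma cartesian_decomposition:
  fixes x :: "'a::cstar_algebra"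
  defines "p \<equiv> (1/2) *\<^sub>R (x + x\<^sup>\<star>)" and "q \<equiv> (- \<i> / 2) *\<^sub>C (x - x\<^sup>\<star>)"
  shows "p\<^sup>\<star> = p" "q\<^sup>\<star> = q" "x = p + \<i> *\<^sub>C q"
proof -
  show "p\<^sup>\<star> = p" by (simp add: p_def adj_scaleR adj_add adj_adj add.commute)
  have "q\<^sup>\<star> = (\<i> / 2) *\<^sub>C (x\<^sup>\<star> - x)"
    by (simp add: q_def adj_scaleC adj_diff adj_adj)
  also have "\<dots> = (\<i> / 2) *\<^sub>C (- (x - x\<^sup>\<star>))" by simp
  also have "\<dots> = q"
    using scaleC_minus_left[of "\<i> / 2" "x - x\<^sup>\<star>"] by (simp only: q_def scaleC_minus_right minus_divide_left)
  finally show "q\<^sup>\<star> = q" .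
  have "\<i> *\<^sub>C q = (1/2) *\<^sub>R (x - x\<^sup>\<star>)"
    using scaleC_of_real[of "1/2" "x - x\<^sup>\<star>"] by (simp add: q_def scaleC_scaleC)
  then have "p + \<i> *\<^sub>C q = (1/2) *\<^sub>R ((x + x\<^sup>\<star>) + (x - x\<^sup>\<star>))"
    by (simp only: p_def scaleR_add_right)
  also have "\<dots> = x" by (simp flip: scaleR_2)
  finally show "x = p + \<i> *\<^sub>C q" by simp
qed

context
  fixes S :: "'a::cstar_algebra set"
  assumes S: "cstar_subalgebra S"
begin

lemma subalgebra_one: "1 \<in> S"
  and subalgebra_add: "x \<in> S \<Longrightarrow> y \<in> S \<Longrightarrow> x + y \<in> S"
  and subalgebra_mult: "x \<in> S \<Longrightarrow> y \<in> S \<Longrightarrow> x * y \<in> S"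
  and subalgebra_adj: "x \<in> S \<Longrightarrow> x\<^sup>\<star> \<in> S"
  and subalgebra_scaleC: "x \<in> S \<Longrightarrow> c *\<^sub>C x \<in> S"
  and subalgebra_closed: "closed S"
  using S by (auto simp: cstar_subalgebra_def)

lemma subalgebra_scaleR: "x \<in> S \<Longrightarrow> r *\<^sub>R x \<in> S"
  by (simp add: scaleR_scaleC subalgebra_scaleC)

lemma subalgebra_zero: "0 \<in> S"
  using subalgebra_scaleC[OF subalgebra_one, of 0] by simp

lemma subalgebra_minus: "x \<in> S \<Longrightarrow> - x \<in> S"
  using subalgebra_scaleC[of x "- 1"] by (simp add: scaleC_minus1)

lemma subalgebra_diff: "x \<in> S \<Longrightarrow> y \<in> S \<Longrightarrow> x - y \<in> S"
  using subalgebra_add[of x "- y"] subalgebra_minus[of y] by simp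

lemma subalgebra_of_real: "of_real r \<in> S"
  by (simp add: of_real_def subalgebra_scaleR subalgebra_one)

lemma subalgebra_sum: "(\<And>i. i \<in> I \<Longrightarrow> f i \<in> S) \<Longrightarrow> (\<Sum>i\<in>I. f i) \<in> S"
  by (induction I rule: infinite_finite_induct) (auto intro: subalgebra_add subalgebra_zero)

lemma subalgebra_power: "x \<in> S \<Longrightarrow> x ^ n \<in> S"
  by (induction n) (auto intro: subalgebra_mult subalgebra_one)

lemma subalgebra_suminf:
  assumes "summable f" "\<And>n. f n \<in> S"
  shows "suminf f \<in> S"
proof (rule closed_sequentially[OF subalgebra_closed])
  show "(\<lambda>n. sum f {..<n}) \<longlonglongrightarrow> suminf f" using assms(1) by (rule summable_LIMSEQ)
  show "sum f {..<n} \<in> S" for n using assms(2) by (auto intro: subalgebra_sum)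
qed

lemmas subalgebra_intros =
  subalgebra_one subalgebra_add subalgebra_mult subalgebra_adj subalgebra_scaleC
  subalgebra_scaleR subalgebra_zero subalgebra_minus subalgebra_diff subalgebra_of_real
  subalgebra_sum subalgebra_power

end

lemma rel_commutant_subalgebra:
  assumes A: "cstar_subalgebra A" and B: "\<And>b. b \<in> B \<Longrightarrow> b\<^sup>\<star> \<in> B"
  shows "cstar_subalgebra (rel_commutant B A)"
proof -
  have "closed {x. b * x = x * b}" for b :: 'a
    by (intro closed_Collect_eq continuous_intros)
  moreover have "rel_commutant B A = A \<inter> (\<Inter>b\<in>B. {x. b * x = x * b})"
    by (auto simp: rel_commutant_def)
  ultimately have "closed (rel_commutant B A)"
    using subalgebra_closed[OF A] by auto
  moreover have "x\<^sup>\<star> \<in> rel_commutant B A" if "x \<in> rel_commutant B A" for x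
  proof -
    have "b * x\<^sup>\<star> = x\<^sup>\<star> * b" if "b \<in> B" for b
    proof -
      have "b\<^sup>\<star> * x = x * b\<^sup>\<star>" using \<open>x \<in> rel_commutant B A\<close> B[OF that] by (simp add: rel_commutant_def)
      then have "(b\<^sup>\<star> * x)\<^sup>\<star> = (x * b\<^sup>\<star>)\<^sup>\<star>" by simp
      then show ?thesis by (simp add: adj_mult adj_adj)
    qed
    then show ?thesis using that subalgebra_adj[OF A] by (auto simp: rel_commutant_def)
  qed
  moreover have "x * y \<in> rel_commutant B A" if "x \<in> rel_commutant B A" "y \<in> rel_commutant B A" for x y
  proof -
    have "b * (x * y) = (x * y) * b" if "b \<in> B" for b
      by (rule commute_mult) (use \<open>x \<in> _\<close> \<open>y \<in> _\<close> that in \<open>auto simp: rel_commutant_def\<close>)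
    then show ?thesis using that subalgebra_mult[OF A] by (auto simp: rel_commutant_def)
  qed
  ultimately show ?thesis
    unfolding cstar_subalgebra_def
    using subalgebra_intros[OF A]
    by (auto simp: rel_commutant_def algebra_simps mult_scaleC_left mult_scaleC_right)
qed


section \<open>Square roots\<close>

text \<open>
  The coefficients of the binomial series of \<open>sqrt (1 - t)\<close>. That series converges absolutely even
  at \<open>t = 1\<close>: all coefficients but the first are negative, and the partial sums stay nonnegative.
\<close>

definition sqrt_coeff :: "nat \<Rightarrow> real" where
  "sqrt_coeff n = ((1/2) gchoose n) * (- 1) ^ n"

lemma sqrt_coeff_0 [simp]: "sqrt_coeff 0 = 1"
  by (simp add: sqrt_coeff_def)

lemma sqrt_coeff_Suc_nonpos: "sqrt_coeff (Suc n) \<le> 0"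
proof (induction n)
  case 0
  show ?case by (simp add: sqrt_coeff_def)
next
  case (Suc n)
  have "((1/2::real) gchoose Suc (Suc n)) = ((1/2) gchoose Suc n) * (1/2 - real (Suc n)) / real (Suc (Suc n))"
    using gbinomial_absorption'[of "Suc (Suc n)" "1/2::real"]
    by (simp add: gbinomial_Suc_rec field_simps gbinomial_mult_1)
  moreover have "(g * a / b) * (- 1) ^ Suc (Suc n) = (g * (- 1) ^ Suc n) * (- a / b)" for g a b :: real
    by simp
  ultimately have "sqrt_coeff (Suc (Suc n)) = sqrt_coeff (Suc n) * ((real (Suc n) - 1/2) / real (Suc (Suc n)))"
    unfolding sqrt_coeff_def by (simp only: minus_diff_eq)
  with Suc show ?case
    by (simp only:) (rule mult_nonpos_nonneg, auto)
qed

text \<open>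
  The partial sums have a closed form, which turns into a quotient of positive factors.
\<close>

lemma sum_sqrt_coeff_nonneg: "(\<Sum>k\<le>n. sqrt_coeff k) \<ge> 0"
proof -
  have "(-1) ^ m * ((-1/2::real) gchoose m) \<ge> 0" for m
  proof -
    have "(-1) ^ m * ((-1/2::real) gchoose m) = pochhammer (1/2) m / fact m"
      by (simp add: gbinomial_pochhammer flip: mult.assoc power_mult_distrib)
    then show ?thesis by (simp add: pochhammer_nonneg)
  qed
  then show ?thesis
    unfolding sqrt_coeff_def gbinomial_sum_lower_neg by simp
qed

lemma sum_abs_sqrt_coeff_le: "(\<Sum>k<n. \<bar>sqrt_coeff (Suc k)\<bar>) \<le> 1"
proof -
  have "(\<Sum>k\<le>n. sqrt_coeff k) = 1 - (\<Sum>k<n. \<bar>sqrt_coeff (Suc k)\<bar>)"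
    unfolding lessThan_Suc_atMost [symmetric] sum.lessThan_Suc_shift
    by (simp add: sqrt_coeff_Suc_nonpos abs_of_nonpos sum_negf)
  then show ?thesis using sum_sqrt_coeff_nonneg[of n] by simp
qed

lemma summable_abs_sqrt_coeff_Suc: "summable (\<lambda>n. \<bar>sqrt_coeff (Suc n)\<bar>)"
  by (rule bounded_imp_summable[where B = 1])
     (use sum_abs_sqrt_coeff_le[of "Suc _"] in \<open>auto simp: lessThan_Suc_atMost\<close>)

lemma suminf_abs_sqrt_coeff_Suc_le: "(\<Sum>n. \<bar>sqrt_coeff (Suc n)\<bar>) \<le> 1"
  by (rule suminf_le_const[OF summable_abs_sqrt_coeff_Suc]) (rule sum_abs_sqrt_coeff_le)

text \<open>
  Vandermonde's identity: the square of the binomial series of exponent \<open>1/2\<close> is that of exponent \<open>1\<close>.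
\<close>

lemma sqrt_coeff_convolution:
  "(\<Sum>k\<le>n. sqrt_coeff k * sqrt_coeff (n - k)) = (if n = 0 then 1 else if n = 1 then -1 else 0)"
proof -
  have "(\<Sum>k\<le>n. sqrt_coeff k * sqrt_coeff (n - k)) =
        (\<Sum>k\<le>n. ((1/2::real) gchoose k) * ((1/2) gchoose (n - k)) * (-1) ^ n)"
    by (rule sum.cong) (auto simp: sqrt_coeff_def mult_ac simp flip: power_add)
  also have "\<dots> = ((1::real) gchoose n) * (-1) ^ n"
    using gbinomial_Vandermonde[of "1/2::real" "1/2" n] by (simp add: atMost_atLeast0 flip: sum_distrib_right)
  also have "\<dots> = of_nat (1 choose n) * (-1) ^ n"
    using binomial_gbinomial[of 1 n, where 'a = real] by simp
  also have "\<dots> = (if n = 0 then 1 else if n = 1 then -1 else 0)"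
    by (cases n) (auto simp: binomial_eq_0)
  finally show ?thesis .
qed

text \<open>The square root of \<open>1 - h\<close>.\<close>

definition sqrt1m :: "'a::cstar_algebra \<Rightarrow> 'a" where
  "sqrt1m h = (\<Sum>n. sqrt_coeff n *\<^sub>R h ^ n)"

context
  fixes h :: "'a::cstar_algebra"
  assumes h: "norm h \<le> 1"
begin

lemma norm_sqrt_series_le: "norm (sqrt_coeff n *\<^sub>R h ^ n) \<le> \<bar>sqrt_coeff n\<bar>"
proof -
  have "norm (h ^ n) \<le> 1"
    using norm_power_ineq[of h n] power_le_one[OF norm_ge_zero h, of n] by linarith
  then show ?thesis by (simp add: mult_left_le)
qed

lemma summable_norm_sqrt_series: "summable (\<lambda>n. norm (sqrt_coeff n *\<^sub>R h ^ n))"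
proof -
  have "summable (\<lambda>n. \<bar>sqrt_coeff n\<bar>)"
    using summable_abs_sqrt_coeff_Suc by (subst summable_Suc_iff [symmetric])
  then show ?thesis
    by (rule summable_comparison_test') (use norm_sqrt_series_le in auto)
qed

lemma summable_sqrt_series: "summable (\<lambda>n. sqrt_coeff n *\<^sub>R h ^ n)"
  by (rule summable_norm_cancel[OF summable_norm_sqrt_series])

lemma sqrt1m_square: "sqrt1m h * sqrt1m h = 1 - h"
proof -
  have "sqrt1m h * sqrt1m h =
        (\<Sum>n. \<Sum>k\<le>n. (sqrt_coeff k *\<^sub>R h ^ k) * (sqrt_coeff (n - k) *\<^sub>R h ^ (n - k)))"
    unfolding sqrt1m_def by (intro Cauchy_product summable_norm_sqrt_series)
  also have "\<dots> = (\<Sum>n. (if n = 0 then 1 else if n = 1 then -1 else 0) *\<^sub>R h ^ n)"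
  proof (rule suminf_cong)
    fix n
    have "(\<Sum>k\<le>n. (sqrt_coeff k *\<^sub>R h ^ k) * (sqrt_coeff (n - k) *\<^sub>R h ^ (n - k))) =
          (\<Sum>k\<le>n. (sqrt_coeff k * sqrt_coeff (n - k)) *\<^sub>R h ^ n)"
      by (rule sum.cong) (auto simp flip: power_add)
    also have "\<dots> = (if n = 0 then 1 else if n = 1 then -1 else 0) *\<^sub>R h ^ n"
      by (simp only: sqrt_coeff_convolution flip: scaleR_left.sum)
    finally show "(\<Sum>k\<le>n. (sqrt_coeff k *\<^sub>R h ^ k) * (sqrt_coeff (n - k) *\<^sub>R h ^ (n - k))) = \<dots>" .
  qed
  also have "\<dots> = (\<Sum>n\<in>{0,1}. (if n = 0 then 1 else if n = 1 then -1 else 0) *\<^sub>R h ^ n)"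
    by (rule suminf_finite) auto
  also have "\<dots> = 1 - h" by simp
  finally show ?thesis .
qed

text \<open>
  This bound makes \<open>sqrt1m h\<close> positive; it holds because the coefficients after the first have total
  absolute value at most \<open>1\<close>.
\<close>

lemma norm_one_minus_sqrt1m: "norm (1 - sqrt1m h) \<le> 1"
proof -
  have *: "1 - sqrt1m h = - (\<Sum>n. sqrt_coeff (Suc n) *\<^sub>R h ^ Suc n)"
    using suminf_split_head[OF summable_sqrt_series] by (simp add: sqrt1m_def algebra_simps)
  have "norm (1 - sqrt1m h) \<le> (\<Sum>n. \<bar>sqrt_coeff (Suc n)\<bar>)"
    unfolding * norm_minus_cancel
    by (rule norm_suminf_le[OF norm_sqrt_series_le summable_abs_sqrt_coeff_Suc])
  then show ?thesis using suminf_abs_sqrt_coeff_Suc_le by linarith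
qed

lemma sqrt1m_in_subalgebra:
  assumes "cstar_subalgebra S" "h \<in> S"
  shows "sqrt1m h \<in> S"
  unfolding sqrt1m_def
  by (rule subalgebra_suminf[OF assms(1) summable_sqrt_series])
     (intro subalgebra_scaleR subalgebra_power assms)

lemma sqrt1m_selfadjoint: "h\<^sup>\<star> = h \<Longrightarrow> (sqrt1m h)\<^sup>\<star> = sqrt1m h"
  unfolding sqrt1m_def bounded_linear.suminf[OF bounded_linear_adj summable_sqrt_series]
  by (simp add: adj_scaleR adj_power)

end

text \<open>
  Powers of \<open>h\<close> and \<open>g\<close> are intertwined by \<open>w\<close>, hence so are power series in them. For \<open>g = h\<close> this
  says that the square root commutes with whatever commutes with \<open>h\<close>.
\<close>

lemma sqrt1m_intertwine:
  fixes w :: "'a::cstar_algebra"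
  assumes "norm h \<le> 1" "norm g \<le> 1" "w * h = g * w"
  shows "w * sqrt1m h = sqrt1m g * w"
proof -
  have pow: "w * h ^ n = g ^ n * w" for n
    by (induction n) (simp_all, metis assms(3) mult.assoc)
  have "w * sqrt1m h = (\<Sum>n. w * (sqrt_coeff n *\<^sub>R h ^ n))"
    unfolding sqrt1m_def by (rule suminf_mult[OF summable_sqrt_series[OF assms(1)], symmetric])
  also have "\<dots> = (\<Sum>n. (sqrt_coeff n *\<^sub>R g ^ n) * w)"
    by (simp add: pow)
  also have "\<dots> = sqrt1m g * w"
    unfolding sqrt1m_def by (rule suminf_mult2[OF summable_sqrt_series[OF assms(2)], symmetric])
  finally show ?thesis .
qed


section \<open>Positivity\<close>

text \<open>
  The order-theoretic description of positivity: the spectrum of a self-adjoint \<open>a\<close> is nonnegative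
  iff \<open>a\<close> lies within distance \<open>t\<close> of some scalar \<open>t\<close>. In this form it is immediate that sums of positive elements
  are positive, and the binomial series gives square roots.
\<close>

definition npos :: "'a::cstar_algebra \<Rightarrow> bool" where
  "npos a \<longleftrightarrow> a\<^sup>\<star> = a \<and> (\<exists>t. norm (of_real t - a) \<le> t)"

lemma npos_selfadjoint: "npos a \<Longrightarrow> a\<^sup>\<star> = a"
  by (simp add: npos_def)

lemma npos_add:
  assumes "npos a" "npos b"
  shows "npos (a + b)"
proof -
  obtain s t where "norm (of_real s - a) \<le> s" "norm (of_real t - b) \<le> t"
    using assms by (auto simp: npos_def)
  then have "norm (of_real (s + t) - (a + b)) \<le> s + t"
    using norm_triangle_ineq[of "of_real s - a" "of_real t - b"] by (simp add: algebra_simps)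
  moreover have "(a + b)\<^sup>\<star> = a + b" using assms by (simp add: npos_def adj_add)
  ultimately show ?thesis unfolding npos_def by blast
qed

lemma npos_scaleR:
  assumes "npos a" "r \<ge> 0"
  shows "npos (r *\<^sub>R a)"
proof -
  obtain t where t: "norm (of_real t - a) \<le> t"
    using assms by (auto simp: npos_def)
  have "of_real (r * t) - r *\<^sub>R a = r *\<^sub>R (of_real t - a)"
    by (simp add: of_real_def scaleR_diff_right)
  then have "norm (of_real (r * t) - r *\<^sub>R a) \<le> r * t"
    using t assms(2) by (simp add: mult_left_mono)
  moreover have "(r *\<^sub>R a)\<^sup>\<star> = r *\<^sub>R a" using assms by (simp add: npos_def adj_scaleR)
  ultimately show ?thesis unfolding npos_def by blast
qed

lemma npos_of_real: "r \<ge> 0 \<Longrightarrow> npos (of_real r)"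
  by (auto simp: npos_def intro!: exI[of _ r])


lemma npos_zero: "npos 0"
  using npos_of_real[of 0] by simp

lemma npos_sum: "(\<And>i. i \<in> I \<Longrightarrow> npos (f i)) \<Longrightarrow> npos (\<Sum>i\<in>I. f i)"
  by (induction I rule: infinite_finite_induct) (auto intro: npos_add npos_zero)

lemma npos_of_real_iff: "npos (of_real t :: 'a::cstar_algebra) \<longleftrightarrow> t \<ge> 0"
proof
  assume "npos (of_real t :: 'a)"
  then obtain s where "norm (of_real s - of_real t :: 'a) \<le> s" by (auto simp: npos_def)
  then have "\<bar>s - t\<bar> \<le> s" by (metis norm_of_real of_real_diff)
  then show "t \<ge> 0" by linarith
qed (rule npos_of_real)

text \<open>
  If \<open>p\<^sup>2 + q\<^sup>2 = t\<close> for commuting self-adjoint \<open>p\<close>, \<open>q\<close>, then \<open>u = p + \<i> q\<close> satisfies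
  \<open>u\<^sup>\<star> u = t\<close>, and \<open>p\<close> is the real part of \<open>u\<close>.
\<close>

lemma norm_le_of_commuting_squares:
  fixes p q :: "'a::cstar_algebra"
  assumes "p\<^sup>\<star> = p" "q\<^sup>\<star> = q" "p * q = q * p" "p * p + q * q = of_real t" "t \<ge> 0"
  shows "(norm p)\<^sup>2 \<le> t"
proof -
  define u where "u = p + \<i> *\<^sub>C q"
  have u_adj: "u\<^sup>\<star> = p - \<i> *\<^sub>C q"
    using assms by (simp add: u_def adj_add adj_scaleC scaleC_minus_left)
  have "u\<^sup>\<star> * u = p * p + q * q"
    using assms(3) unfolding u_adj unfolding u_def
    by (simp add: algebra_simps mult_scaleC_left mult_scaleC_right scaleC_scaleC scaleC_minus1
        scaleC_add_right scaleC_diff_right)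
  then have nu: "(norm u)\<^sup>2 = t"
    using norm_adj_mult[of u] assms(4,5) by simp
  have "p = (1/2) *\<^sub>R (u + u\<^sup>\<star>)"
    unfolding u_adj unfolding u_def by (simp flip: scaleR_2)
  then have "norm p = (1/2) * norm (u + u\<^sup>\<star>)"
    by (metis norm_scaleR abs_of_nonneg zero_le_divide_1_iff zero_le_numeral)
  then have "norm p \<le> norm u"
    using norm_triangle_ineq[of u "u\<^sup>\<star>"] by simp
  then show ?thesis using nu by (metis norm_ge_zero power_mono)
qed

text \<open>
  With \<open>w\<close> the square root of \<open>1 - k\<^sup>2\<close>, the element \<open>w + \<i> k\<close> is unitary, so \<open>w\<close> is a contraction.
\<close>

lemma norm_one_minus_square:
  fixes k :: "'a::cstar_algebra"
  assumes k: "k\<^sup>\<star> = k" "norm k \<le> 1"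
  shows "norm (1 - k * k) \<le> 1"
proof -
  define w where "w = sqrt1m (k * k)"
  have nk: "norm (k * k) \<le> 1" using k by (simp add: norm_selfadjoint_square power_le_one)
  have ww: "w * w = 1 - k * k" unfolding w_def by (rule sqrt1m_square[OF nk])
  have w: "w\<^sup>\<star> = w" unfolding w_def by (rule sqrt1m_selfadjoint[OF nk]) (simp add: adj_mult k)
  have "k * w = w * k"
    unfolding w_def by (rule sqrt1m_intertwine[OF nk nk]) (simp add: mult.assoc)
  then have "(norm w)\<^sup>2 \<le> 1"
    using ww w k by (intro norm_le_of_commuting_squares[of w k]) auto
  then show ?thesis using norm_selfadjoint_square[OF w] by (simp flip: ww)
qed

lemma npos_square:
  fixes k :: "'a::cstar_algebra"
  assumes k: "k\<^sup>\<star> = k"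
  shows "npos (k * k)"
proof (cases "k = 0")
  case False
  define h where "h = (1 / norm k) *\<^sub>R k"
  have "h\<^sup>\<star> = h" by (simp add: h_def adj_scaleR k)
  moreover have "norm (1 - h * h) \<le> 1"
    using False by (intro norm_one_minus_square) (auto simp: h_def adj_scaleR k)
  ultimately have "npos (h * h)" by (auto simp: npos_def adj_mult intro!: exI[of _ 1])
  then have "npos ((norm k)\<^sup>2 *\<^sub>R (h * h))" by (intro npos_scaleR) auto
  moreover have "(norm k)\<^sup>2 *\<^sub>R (h * h) = k * k" using False by (simp add: h_def power2_eq_square)
  ultimately show ?thesis by simp
qed (simp add: npos_zero)

text \<open>
  If \<open>a\<close> is within \<open>t\<close> of \<open>t\<close>, then \<open>a = t (1 - h)\<close> with \<open>norm h \<le> 1\<close>. The square root is a limit of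
  polynomials in \<open>a\<close>, so it lies in every closed subalgebra containing \<open>a\<close> and commutes with the
  commutant of \<open>a\<close>.
\<close>

lemma npos_sqrt:
  fixes a :: "'a::cstar_algebra"
  assumes a: "npos a" and S: "cstar_subalgebra S" "a \<in> S"
  obtains w where "npos w" "w * w = a" "w \<in> S" "\<And>x. x * a = a * x \<Longrightarrow> x * w = w * x"
proof -
  obtain t where t: "norm (of_real t - a) \<le> t" using a by (auto simp: npos_def)
  then have "t \<ge> 0" using norm_ge_zero order_trans by blast
  then consider "t = 0" | "t > 0" by linarith
  then show ?thesis
  proof cases
    case 1
    then have "a = 0" using t by simp
    then show ?thesis using that[of 0] S by (simp add: npos_zero)
  next
    case 2
    define h where "h = (1 / t) *\<^sub>R (of_real t - a)"
    have h: "norm h \<le> 1" using t 2 unfolding h_def norm_scaleR by simp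
    have h_eq: "h = 1 - (1 / t) *\<^sub>R a" using 2 by (simp add: h_def scaleR_diff_right of_real_def)
    have h_adj: "h\<^sup>\<star> = h" using a by (simp add: h_def adj_scaleR adj_diff npos_def)
    define w where "w = sqrt t *\<^sub>R sqrt1m h"
    have "npos (sqrt1m h)"
      using norm_one_minus_sqrt1m[OF h] sqrt1m_selfadjoint[OF h h_adj]
      by (auto simp: npos_def intro!: exI[of _ 1])
    then have "npos w" unfolding w_def using 2 by (intro npos_scaleR) auto
    moreover have "w * w = a"
      using 2 by (simp add: w_def sqrt1m_square[OF h]) (simp add: h_eq)
    moreover have "h \<in> S"
      unfolding h_def by (intro subalgebra_scaleR subalgebra_diff subalgebra_of_real S)
    then have "w \<in> S"
      unfolding w_def by (intro subalgebra_scaleR sqrt1m_in_subalgebra h S)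
    moreover have "x * w = w * x" if "x * a = a * x" for x
      unfolding w_def using sqrt1m_intertwine[OF h h, of x] that
      by (simp add: h_eq algebra_simps)
    ultimately show ?thesis by (rule that)
  qed
qed

lemma cstar_subalgebra_UNIV: "cstar_subalgebra UNIV"
  by (simp add: cstar_subalgebra_def)

text \<open>
  With \<open>d = r - x\<close>, the equation \<open>d (r + x) = 0\<close> says that the squares of \<open>r\<^sup>1\<^sup>/\<^sup>2 d\<close> and \<open>x\<^sup>1\<^sup>/\<^sup>2 d\<close>
  add up to zero, so both vanish and with them \<open>d\<^sup>2\<close>.
\<close>

lemma npos_sqrt_unique:
  assumes x: "npos x" and r: "npos r" and comm: "x * r = r * x" and sq: "x * x = r * r"
  shows "x = r"
proof -
  define d where "d = r - x"
  have d: "d\<^sup>\<star> = d" using x r by (simp add: d_def adj_diff npos_def)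
  obtain a where a: "npos a" "a * a = r" "\<And>y. y * r = r * y \<Longrightarrow> y * a = a * y"
    using npos_sqrt[OF r cstar_subalgebra_UNIV UNIV_I] by blast
  obtain b where b: "npos b" "b * b = x" "\<And>y. y * x = x * y \<Longrightarrow> y * b = b * y"
    using npos_sqrt[OF x cstar_subalgebra_UNIV UNIV_I] by blast
  have da: "d * a = a * d" by (rule a(3)) (simp add: d_def algebra_simps comm)
  have db: "d * b = b * d" by (rule b(3)) (simp add: d_def algebra_simps comm)
  have "x * a = a * x" using a(3) comm by blast
  then have ab: "a * b = b * a" using b(3) by simp
  have "d * (r + x) = 0" using comm sq by (simp add: d_def algebra_simps)
  then have "d * (r + x) * d = 0" by simp
  moreover have "a * d * (a * d) = d * r * d" by (metis a(2) da mult.assoc)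
  moreover have "b * d * (b * d) = d * x * d" by (metis b(2) db mult.assoc)
  ultimately have zero: "a * d * (a * d) + b * d * (b * d) = 0"
    by (simp add: algebra_simps)
  have comm': "a * d * (b * d) = b * d * (a * d)"
    by (metis ab da db mult.assoc)
  have sa: "(a * d)\<^sup>\<star> = a * d" "(b * d)\<^sup>\<star> = b * d"
    using a(1) b(1) by (simp_all add: adj_mult d da db npos_def)
  have "a * d = 0"
    using norm_le_of_commuting_squares[of "a * d" "b * d" 0] sa comm' zero by simp
  then have "r * d = 0" by (simp flip: a(2) add: mult.assoc)
  have "b * d = 0"
    using norm_le_of_commuting_squares[of "b * d" "a * d" 0] sa comm' zero by (simp add: add.commute)
  then have "x * d = 0" by (simp flip: b(2) add: mult.assoc)
  with \<open>r * d = 0\<close> have "d * d = 0" by (simp add: d_def algebra_simps)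
  then have "d = 0" by (rule selfadjoint_square_eq_0[OF d])
  then show ?thesis by (simp add: d_def)
qed

text \<open>
  An operator \<open>w\<close> with \<open>w\<^sup>\<star> w \<le> 0\<close> vanishes. Twice the sum of the squares of the real and the
  imaginary part of \<open>w\<close> is \<open>w\<^sup>\<star> w + w w\<^sup>\<star>\<close>, so \<open>w w\<^sup>\<star> \<ge> 0\<close>. Now \<open>w\<close> intertwines \<open>w\<^sup>\<star> w\<close> and
  \<open>w w\<^sup>\<star>\<close>, hence also their absolute values, which are \<open>- w\<^sup>\<star> w\<close> and \<open>w w\<^sup>\<star>\<close>.
\<close>

lemma npos_minus_adj_mult_imp_zero:
  fixes w :: "'a::cstar_algebra"
  assumes "npos (- (w\<^sup>\<star> * w))"
  shows "w = 0"
proof (rule ccontr)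
  assume "w \<noteq> 0"
  define b g where "b = - (w\<^sup>\<star> * w)" and "g = w * w\<^sup>\<star>"
  have b_pos: "npos b" using assms by (simp add: b_def)
  obtain p q where pq: "p\<^sup>\<star> = p" "q\<^sup>\<star> = q" "w = p + \<i> *\<^sub>C q"
    using cartesian_decomposition[of w] by blast
  have w_adj: "w\<^sup>\<star> = p - \<i> *\<^sub>C q"
    unfolding pq(3) by (simp add: adj_add adj_scaleC pq(1,2) scaleC_minus_left)
  have "g = 2 *\<^sub>R (p * p) + 2 *\<^sub>R (q * q) + b"
    unfolding b_def g_def w_adj unfolding pq(3)
    by (simp add: algebra_simps mult_scaleC_left mult_scaleC_right scaleC_scaleC scaleC_minus1
        scaleC_add_right scaleC_diff_right scaleR_2)
  then have g_pos: "npos g"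
    using b_pos by (auto intro!: npos_add npos_scaleR npos_square pq)
  define N where "N = (norm w)\<^sup>2"
  have N: "N > 0" using \<open>w \<noteq> 0\<close> by (simp add: N_def)
  define \<beta> \<gamma> where "\<beta> = (1 / N) *\<^sub>R b" and "\<gamma> = (1 / N) *\<^sub>R g"
  have pos: "npos \<beta>" "npos \<gamma>"
    unfolding \<beta>_def \<gamma>_def using N b_pos g_pos by (auto intro: npos_scaleR)
  have norms: "norm \<beta> \<le> 1" "norm \<gamma> \<le> 1"
    using N norm_adj_mult[of w] norm_adj_mult[of "w\<^sup>\<star>"]
    by (simp_all add: \<beta>_def \<gamma>_def b_def g_def N_def adj_adj)
  have abs: "sqrt1m (1 - x * x) = x" if "npos x" "norm x \<le> 1" for x :: 'a
  proof (rule npos_sqrt_unique)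
    have x: "x\<^sup>\<star> = x" using that(1) by (rule npos_selfadjoint)
    have n: "norm (1 - x * x) \<le> 1" by (rule norm_one_minus_square[OF x that(2)])
    show "npos (sqrt1m (1 - x * x))"
      using norm_one_minus_sqrt1m[OF n] sqrt1m_selfadjoint[OF n]
      by (auto simp: npos_def adj_diff adj_mult x intro!: exI[of _ 1])
    show "npos x" by fact
    show "sqrt1m (1 - x * x) * x = x * sqrt1m (1 - x * x)"
      by (rule sqrt1m_intertwine[OF n n, symmetric]) (simp add: algebra_simps)
    show "sqrt1m (1 - x * x) * sqrt1m (1 - x * x) = x * x"
      unfolding sqrt1m_square[OF n] by simp
  qed
  have wb: "w * b = - (g * w)" by (simp add: b_def g_def mult.assoc)
  have "w * (b * b) = w * b * b" by (simp only: mult.assoc)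
  also have "\<dots> = - (g * (w * b))" by (simp only: wb mult_minus_left mult.assoc)
  also have "\<dots> = (g * g) * w" by (simp add: wb mult.assoc)
  finally have "w * (1 - \<beta> * \<beta>) = (1 - \<gamma> * \<gamma>) * w"
    by (simp add: \<beta>_def \<gamma>_def algebra_simps)
  then have "w * sqrt1m (1 - \<beta> * \<beta>) = sqrt1m (1 - \<gamma> * \<gamma>) * w"
    by (intro sqrt1m_intertwine norm_one_minus_square npos_selfadjoint pos norms)
  then have "w * \<beta> = \<gamma> * w" by (simp add: abs pos norms)
  then have "w * b = g * w" using N by (simp add: \<beta>_def \<gamma>_def)
  from this wb have "g * w = - (g * w)" by (rule trans[OF sym])
  then have "2 *\<^sub>R (g * w) = 0" by (simp only: scaleR_2 eq_neg_iff_add_eq_0)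
  then have "g * w = 0" by simp
  then have "w\<^sup>\<star> * w * (w\<^sup>\<star> * w) = 0" by (simp add: g_def mult.assoc)
  then have "w\<^sup>\<star> * w = 0" by (rule selfadjoint_square_eq_0[rotated]) (simp add: adj_mult adj_adj)
  with \<open>w \<noteq> 0\<close> show False by (simp add: adj_mult_self_eq_0)
qed

text \<open>
  The negative part of \<open>a = z\<^sup>\<star> z\<close> is \<open>n / 2\<close> with \<open>n = \<bar>a\<bar> - a\<close>. Since \<open>n\<close> annihilates
  \<open>\<bar>a\<bar> + a\<close>, the product \<open>w = z n\<close> satisfies \<open>w\<^sup>\<star> w = n a n = - n \<bar>a\<bar> n \<le> 0\<close>, so \<open>w = 0\<close> and
  \<open>n = 0\<close>.
\<close>

lemma npos_adj_mult: "npos ((z::'a::cstar_algebra)\<^sup>\<star> * z)"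
proof -
  define a where "a = z\<^sup>\<star> * z"
  have a: "a\<^sup>\<star> = a" by (simp add: a_def adj_mult adj_adj)
  obtain m where m: "npos m" "m * m = a * a" "\<And>y. y * (a * a) = a * a * y \<Longrightarrow> y * m = m * y"
    using npos_sqrt[OF npos_square[OF a] cstar_subalgebra_UNIV UNIV_I] by blast
  have am: "a * m = m * a" by (rule m(3)) (simp add: mult.assoc)
  define n where "n = m - a"
  have n: "n\<^sup>\<star> = n" using m(1) by (simp add: n_def adj_diff a npos_def)
  have "n * m + n * a = 0" using m(2) am by (simp add: n_def algebra_simps)
  then have na: "n * a = - (n * m)" by (simp add: add_eq_0_iff)
  obtain s where s: "npos s" "s * s = m" "\<And>y. y * m = m * y \<Longrightarrow> y * s = s * y"
    using npos_sqrt[OF m(1) cstar_subalgebra_UNIV UNIV_I] by blast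
  have ns: "n * s = s * n" by (rule s(3)) (simp add: n_def algebra_simps am)
  have q: "(s * n)\<^sup>\<star> = s * n" using s(1) by (simp add: adj_mult n ns npos_def)
  have qq: "s * n * (s * n) = n * m * n" by (metis ns s(2) mult.assoc)
  have zn: "(z * n)\<^sup>\<star> * (z * n) = - (s * n * (s * n))"
  proof -
    have "(z * n)\<^sup>\<star> * (z * n) = n * a * n" by (simp add: adj_mult n a_def mult.assoc)
    also have "\<dots> = - (n * m * n)" by (simp add: na)
    finally show ?thesis by (simp add: qq)
  qed
  then have "z * n = 0"
    using npos_square[OF q] by (intro npos_minus_adj_mult_imp_zero) simp
  with zn have "s * n * (s * n) = 0" by simp
  then have "s * n = 0" by (rule selfadjoint_square_eq_0[OF q])
  then have "n * s = 0" by (simp add: ns)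
  then have "n * m = 0" by (metis s(2) mult.assoc mult_zero_left)
  moreover have "n * n = n * m - n * a" by (simp add: n_def right_diff_distrib)
  ultimately have "n * n = 0" using na by simp
  then have "n = 0" by (rule selfadjoint_square_eq_0[OF n])
  then have "m = a" by (simp add: n_def)
  then show ?thesis using m(1) by (simp only: a_def)
qed

text \<open>
  The two notions of positivity agree: elements \<open>z\<^sup>\<star> * z\<close> are positive by \<open>npos_adj_mult\<close>, and
  conversely positive elements have square roots. In particular \<open>positive_in S\<close> is closed under sums.
\<close>

lemma positive_in_iff:
  assumes "cstar_subalgebra S"
  shows "positive_in S x \<longleftrightarrow> x \<in> S \<and> npos x"
proof
  assume "positive_in S x"
  then obtain z where z: "z \<in> S" "x = z\<^sup>\<star> * z" by (auto simp: positive_in_def)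
  then show "x \<in> S \<and> npos x"
    using subalgebra_mult[OF assms subalgebra_adj[OF assms z(1)] z(1)] npos_adj_mult[of z] by simp
next
  assume x: "x \<in> S \<and> npos x"
  obtain w where "w \<in> S" "w * w = x" "npos w"
    by (rule npos_sqrt[OF conjunct2[OF x] assms conjunct1[OF x]])
  then show "positive_in S x"
    unfolding positive_in_def by (intro bexI[of _ w]) (auto simp: npos_def)
qed

text \<open>
  The norm is determined by the order: \<open>r\<^sup>\<star> * r \<le> t\<close> implies \<open>(norm r)\<^sup>2 \<le> t\<close>. The square roots of
  \<open>r\<^sup>\<star> * r\<close> and of its complement \<open>p\<close> commute, and their squares add up to \<open>t\<close>.
\<close>

lemma norm_le_of_npos_complement:
  fixes r :: "'a::cstar_algebra"
  assumes p: "npos p" and eq: "r\<^sup>\<star> * r + p = of_real t"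
  shows "(norm r)\<^sup>2 \<le> t"
proof -
  obtain x where x: "npos x" "x * x = r\<^sup>\<star> * r"
    using npos_sqrt[OF npos_adj_mult cstar_subalgebra_UNIV UNIV_I, of r] by blast
  obtain y where y: "npos y" "y * y = p" "\<And>z. z * p = p * z \<Longrightarrow> z * y = y * z"
    using npos_sqrt[OF p cstar_subalgebra_UNIV UNIV_I] by blast
  have "p = of_real t - x * x" using eq x(2) by (simp add: algebra_simps)
  then have "x * p = p * x" by (simp only: left_diff_distrib right_diff_distrib mult.assoc) (simp add: of_real_def)
  then have "x * y = y * x" by (rule y(3))
  moreover have "npos (of_real t :: 'a)"
    unfolding eq[symmetric] by (intro npos_add npos_adj_mult p)
  ultimately have "(norm x)\<^sup>2 \<le> t"
    using x(2) y(2) eq npos_selfadjoint[OF x(1)] npos_selfadjoint[OF y(1)]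
    by (intro norm_le_of_commuting_squares[of x y]) (simp_all add: npos_of_real_iff)
  moreover have "(norm r)\<^sup>2 = (norm x)\<^sup>2"
    using norm_adj_mult[of r] norm_selfadjoint_square[OF npos_selfadjoint[OF x(1)]] x(2) by simp
  ultimately show ?thesis by simp
qed

lemma sum_adj_mult_eq_0:
  fixes f :: "'i \<Rightarrow> 'a::cstar_algebra"
  assumes "finite I" "(\<Sum>i\<in>I. (f i)\<^sup>\<star> * f i) = 0" "i \<in> I"
  shows "f i = 0"
proof -
  have "(f i)\<^sup>\<star> * f i + (\<Sum>j\<in>I-{i}. (f j)\<^sup>\<star> * f j) = of_real 0"
    using sum.remove[OF assms(1,3), of "\<lambda>j. (f j)\<^sup>\<star> * f j"] assms(2) by simp
  then have "(norm (f i))\<^sup>2 \<le> 0"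
    by (rule norm_le_of_npos_complement[rotated]) (intro npos_sum npos_adj_mult)
  then show ?thesis by simp
qed

lemma npos_one_minus_adj_mult:
  fixes x :: "'a::cstar_algebra"
  assumes "norm x \<le> 1"
  shows "npos (1 - x\<^sup>\<star> * x)"
  unfolding npos_def
  by (intro conjI exI[of _ 1]) (use assms in \<open>simp_all add: adj_diff adj_mult adj_adj norm_adj_mult power_le_one\<close>)


section \<open>Simple algebras have trivial centre\<close>

text \<open>
  The annihilator of a central element is a closed ideal, so the centre of a simple algebra has no
  zero divisors.
\<close>

lemma simple_centre_integral:
  assumes S: "simple_cstar_subalgebra S"
    and f: "f \<in> rel_commutant S S" and g: "g \<in> S" and "f * g = 0"
  shows "f = 0 \<or> g = 0"
proof -
  have S': "cstar_subalgebra S" using S by (simp add: simple_cstar_subalgebra_def)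
  define J where "J = {a \<in> S. f * a = 0}"
  have "J = S \<inter> {a. f * a = 0}" by (auto simp: J_def)
  moreover have "closed {a. f * a = 0}" by (intro closed_Collect_eq continuous_intros)
  ultimately have "closed J" using subalgebra_closed[OF S'] by auto
  moreover have "f * (a * x) = 0" if "x \<in> J" "a \<in> S" for a x
  proof -
    have "a * f = f * a" using f that by (simp add: rel_commutant_def)
    then have "f * (a * x) = a * (f * x)" by (metis mult.assoc)
    then show ?thesis using that by (simp add: J_def)
  qed
  moreover have "f * (x * a) = 0" if "x \<in> J" for a x
    using that by (simp add: J_def flip: mult.assoc)
  ultimately have "closed_ideal S J"
    unfolding closed_ideal_def using subalgebra_intros[OF S']
    by (auto simp: J_def algebra_simps mult_scaleC_right)
  then have "J = {0} \<or> J = S" using S by (simp add: simple_cstar_subalgebra_def)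
  then show ?thesis
  proof
    assume "J = {0}"
    moreover have "g \<in> J" using g \<open>f * g = 0\<close> by (simp add: J_def)
    ultimately show ?thesis by simp
  next
    assume "J = S"
    then have "1 \<in> J" using subalgebra_one[OF S'] by simp
    then show ?thesis by (simp add: J_def)
  qed
qed

text \<open>
  For self-adjoint central \<open>k\<close> the product \<open>(\<bar>k\<bar> - k) (\<bar>k\<bar> + k)\<close> vanishes, so \<open>k\<close> or \<open>- k\<close> is
  positive. Applied to \<open>m - s\<close>, where \<open>m = \<bar>k\<bar>\<close> and \<open>s\<close> runs through the reals below \<open>norm m\<close>, this
  shows \<open>m = norm m\<close>.
\<close>

lemma simple_centre_selfadjoint_scalar:
  assumes S: "simple_cstar_subalgebra S"
    and k: "k \<in> rel_commutant S S" "k\<^sup>\<star> = k"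
  shows "\<exists>r. k = of_real r"
proof -
  define Z where "Z = rel_commutant S S"
  have S': "cstar_subalgebra S" using S by (simp add: simple_cstar_subalgebra_def)
  have Z: "cstar_subalgebra Z"
    unfolding Z_def by (intro rel_commutant_subalgebra S' subalgebra_adj)
  have ZS: "x \<in> S" if "x \<in> Z" for x using that by (simp add: Z_def rel_commutant_def)
  have abs: "\<exists>m\<in>Z. npos m \<and> (x = m \<or> x = - m)" if x: "x \<in> Z" "x\<^sup>\<star> = x" for x
  proof -
    obtain m where m: "npos m" "m * m = x * x" "m \<in> Z" "\<And>y. y * (x * x) = x * x * y \<Longrightarrow> y * m = m * y"
      using npos_sqrt[OF npos_square[OF x(2)] Z subalgebra_mult[OF Z x(1) x(1)]] by blast
    have "x * m = m * x" by (rule m(4)) (simp add: mult.assoc)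
    then have "(m - x) * (m + x) = 0" using m(2) by (simp add: algebra_simps)
    moreover have "m - x \<in> rel_commutant S S"
      using subalgebra_diff[OF Z m(3) x(1)] by (simp only: Z_def)
    moreover have "m + x \<in> S" by (rule ZS[OF subalgebra_add[OF Z m(3) x(1)]])
    ultimately consider "m - x = 0" | "m + x = 0" using simple_centre_integral[OF S] by blast
    then have "x = m \<or> x = - m" by cases (simp_all add: add_eq_0_iff)
    then show ?thesis using m(1,3) by (intro bexI[of _ m]) simp_all
  qed
  obtain m where m: "m \<in> Z" "npos m" "k = m \<or> k = - m"
    using abs[OF k[folded Z_def]] by blast
  have m_adj: "m\<^sup>\<star> = m" using m(2) by (rule npos_selfadjoint)
  have bound: "norm x \<le> t" if x: "npos x" and c: "npos (of_real t - x)" for x :: 'a and t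
  proof -
    obtain y where y: "npos y" "y * y = x" using npos_sqrt[OF x cstar_subalgebra_UNIV UNIV_I] by blast
    have "y\<^sup>\<star> * y + (of_real t - x) = of_real t" using y by (simp add: npos_def)
    then have "(norm y)\<^sup>2 \<le> t" by (rule norm_le_of_npos_complement[OF c])
    then show ?thesis using norm_selfadjoint_square[OF npos_selfadjoint[OF y(1)]] y(2) by simp
  qed
  define M where "M = norm m"
  \<comment> \<open>\<open>m = y\<^sup>2\<close>, and \<open>z = y / sqrt M\<close> is a contraction\<close>
  have M_pos: "npos (of_real M - m)"
  proof (cases "m = 0")
    case False
    obtain y where y: "npos y" "y * y = m" using npos_sqrt[OF m(2) cstar_subalgebra_UNIV UNIV_I] by blast
    have M: "(norm y)\<^sup>2 = M" using norm_selfadjoint_square[OF npos_selfadjoint[OF y(1)]] y(2) M_def by simp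
    have M0: "M > 0" using False by (simp add: M_def)
    define z where "z = (1 / sqrt M) *\<^sub>R y"
    have "norm z \<le> 1" using M M0 by (simp add: z_def real_le_rsqrt)
    then have "npos (1 - z\<^sup>\<star> * z)" by (rule npos_one_minus_adj_mult)
    then have "npos (M *\<^sub>R (1 - z\<^sup>\<star> * z))" using M0 by (intro npos_scaleR) auto
    moreover have "M *\<^sub>R (1 - z\<^sup>\<star> * z) = of_real M - m"
      using M0 y by (simp add: z_def adj_scaleR npos_def scaleR_diff_right of_real_def)
    ultimately show ?thesis by simp
  qed (simp add: M_def npos_zero)
  have "norm (of_real M - m) \<le> \<epsilon>" if \<epsilon>: "\<epsilon> > 0" for \<epsilon>
  proof -
    have "m - of_real (M - \<epsilon>) \<in> Z" "(m - of_real (M - \<epsilon>))\<^sup>\<star> = m - of_real (M - \<epsilon>)"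
      using subalgebra_diff[OF Z m(1) subalgebra_of_real[OF Z]] by (simp_all only: adj_diff m_adj adj_of_real)
    from abs[OF this] obtain m' where m': "npos m'" "m - of_real (M - \<epsilon>) = m' \<or> m - of_real (M - \<epsilon>) = - m'"
      by blast
    from m'(2) have "npos (m - of_real (M - \<epsilon>)) \<or> npos (of_real (M - \<epsilon>) - m)"
    proof
      assume "m - of_real (M - \<epsilon>) = - m'"
      then have "of_real (M - \<epsilon>) - m = m'" using minus_diff_eq[of m "of_real (M - \<epsilon>)"] by simp
      then show ?thesis using m'(1) by simp
    qed (use m'(1) in simp)
    then show ?thesis
    proof
      assume "npos (m - of_real (M - \<epsilon>))"
      then show ?thesis by (intro bound[OF M_pos]) (simp add: algebra_simps)
    next
      assume "npos (of_real (M - \<epsilon>) - m)"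
      then have "norm m \<le> M - \<epsilon>" by (rule bound[OF m(2)])
      with \<epsilon> show ?thesis by (simp add: M_def)
    qed
  qed
  then have "norm (of_real M - m) \<le> 0" by (rule field_le_epsilon) simp
  then have "m = of_real M" by simp
  then have "k = of_real M \<or> k = of_real (- M)" using m(3) by simp
  then show ?thesis by blast
qed

definition trivial_centre :: "'a::cstar_algebra set \<Rightarrow> bool" where
  "trivial_centre S \<longleftrightarrow> rel_commutant S S \<subseteq> range (\<lambda>c. c *\<^sub>C 1)"

lemma simple_trivial_centre:
  assumes S: "simple_cstar_subalgebra S"
  shows "trivial_centre S"
  unfolding trivial_centre_def
proof
  fix z assume z: "z \<in> rel_commutant S S"
  have S': "cstar_subalgebra S" using S by (simp add: simple_cstar_subalgebra_def)
  have Z: "cstar_subalgebra (rel_commutant S S)"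
    by (intro rel_commutant_subalgebra S' subalgebra_adj)
  define p q where "p = (1/2) *\<^sub>R (z + z\<^sup>\<star>)" and "q = (- \<i> / 2) *\<^sub>C (z - z\<^sup>\<star>)"
  have pq: "p\<^sup>\<star> = p" "q\<^sup>\<star> = q" "z = p + \<i> *\<^sub>C q"
    unfolding p_def q_def by (rule cartesian_decomposition)+
  have "p \<in> rel_commutant S S" "q \<in> rel_commutant S S"
    unfolding p_def q_def
    by (intro subalgebra_scaleR[OF Z] subalgebra_add[OF Z] subalgebra_scaleC[OF Z]
        subalgebra_diff[OF Z] subalgebra_adj[OF Z] z)+
  then obtain r s where "p = of_real r" "q = of_real s"
    using simple_centre_selfadjoint_scalar[OF S] pq(1,2) by blast
  then have "z = (of_real r + \<i> * of_real s) *\<^sub>C 1"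
    using pq(3) by (simp only: of_real_scaleC scaleC_add_left scaleC_scaleC)
  then show "z \<in> range (\<lambda>c. c *\<^sub>C 1)" by blast
qed


lemma trivial_centre_selfadjoint:
  assumes "trivial_centre S" "z \<in> rel_commutant S S" "z\<^sup>\<star> = z"
  obtains r where "z = of_real r"
proof -
  obtain c where c: "z = c *\<^sub>C 1" using assms by (auto simp: trivial_centre_def)
  then have "cnj c *\<^sub>C (1::'a) = c *\<^sub>C 1" using assms(3) by (simp add: adj_scaleC)
  then have "cnj c = c" by (simp only: scaleC_1_cancel)
  then have "c = of_real (Re c)" by (metis Reals_cnj_iff of_real_Re)
  then show ?thesis using c that by (metis of_real_scaleC)
qed


section \<open>Conditional expectations\<close>

text \<open>
  The algebraic part of the notion of a conditional expectation. Contractivity follows from it, by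
  the Kadison--Schwarz inequality.
\<close>

locale expectation =
  fixes A B :: "'a::cstar_algebra set" and E :: "'a \<Rightarrow> 'a"
  assumes A: "cstar_subalgebra A" and B: "cstar_subalgebra B" and BA: "B \<subseteq> A"
    and E_in: "x \<in> A \<Longrightarrow> E x \<in> B"
    and E_fix: "b \<in> B \<Longrightarrow> E b = b"
    and E_add: "x \<in> A \<Longrightarrow> y \<in> A \<Longrightarrow> E (x + y) = E x + E y"
    and E_scaleC: "x \<in> A \<Longrightarrow> E (c *\<^sub>C x) = c *\<^sub>C E x"
    and E_npos: "x \<in> A \<Longrightarrow> npos (E (x\<^sup>\<star> * x))"
    and E_left: "b \<in> B \<Longrightarrow> x \<in> A \<Longrightarrow> E (b * x) = b * E x"
    and E_right: "b \<in> B \<Longrightarrow> x \<in> A \<Longrightarrow> E (x * b) = E x * b"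
begin

lemma B_in_A: "b \<in> B \<Longrightarrow> b \<in> A"
  using BA by blast

lemmas A_intros = subalgebra_intros[OF A]
lemmas B_intros = subalgebra_intros[OF B]

lemma E_in_A: "x \<in> A \<Longrightarrow> E x \<in> A"
  using E_in B_in_A by blast

lemma E_one: "E 1 = 1"
  using E_fix subalgebra_one[OF B] by blast

lemma E_of_real: "E (of_real r) = of_real r"
  using E_fix subalgebra_of_real[OF B] by blast

lemma E_zero: "E 0 = 0"
  using E_fix subalgebra_zero[OF B] by blast

lemma E_scaleR: "x \<in> A \<Longrightarrow> E (r *\<^sub>R x) = r *\<^sub>R E x"
  by (simp add: scaleR_scaleC E_scaleC)

lemma E_minus: "x \<in> A \<Longrightarrow> E (- x) = - E x"
  using E_scaleC[of x "- 1"] by (simp add: scaleC_minus1)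

lemma E_diff: "x \<in> A \<Longrightarrow> y \<in> A \<Longrightarrow> E (x - y) = E x - E y"
  using E_add[of x "- y"] E_minus[of y] subalgebra_minus[OF A, of y] by simp

lemma E_sum: "finite I \<Longrightarrow> (\<And>i. i \<in> I \<Longrightarrow> f i \<in> A) \<Longrightarrow> E (\<Sum>i\<in>I. f i) = (\<Sum>i\<in>I. E (f i))"
proof (induction I rule: finite_induct)
  case (insert i I)
  then have "E (f i + sum f I) = E (f i) + E (sum f I)"
    by (intro E_add) (auto intro: subalgebra_sum[OF A])
  then show ?case using insert by simp
qed (simp add: E_zero)

lemma E_bimodule: "a \<in> B \<Longrightarrow> b \<in> B \<Longrightarrow> x \<in> A \<Longrightarrow> E (a * x * b) = a * E x * b"
  using E_right[of b "a * x"] E_left[of a x] subalgebra_mult[OF A] B_in_A by simp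

lemma E_adj_selfadjoint:
  assumes "x \<in> A" "x\<^sup>\<star> = x"
  shows "(E x)\<^sup>\<star> = E x"
proof -
  define a b where "a = 1 + x" and "b = 1 - x"
  have ab: "a \<in> A" "b \<in> A" "a\<^sup>\<star> = a" "b\<^sup>\<star> = b"
    using assms by (auto simp: a_def b_def adj_add adj_diff intro: A_intros)
  have "a\<^sup>\<star> * a - b\<^sup>\<star> * b = 2 *\<^sub>R x + 2 *\<^sub>R x"
    unfolding ab(3,4) unfolding a_def b_def by (simp add: algebra_simps scaleR_2)
  also have "\<dots> = 4 *\<^sub>R x" by (simp flip: scaleR_add_left)
  finally have "x = (1/4) *\<^sub>R (a\<^sup>\<star> * a - b\<^sup>\<star> * b)" by simp
  then have "E x = E ((1/4) *\<^sub>R (a\<^sup>\<star> * a - b\<^sup>\<star> * b))" by (rule arg_cong)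
  also have "\<dots> = (1/4) *\<^sub>R (E (a\<^sup>\<star> * a) - E (b\<^sup>\<star> * b))"
    using ab(1,2) by (simp add: E_scaleR E_diff A_intros)
  finally show ?thesis
    using E_npos[OF ab(1)] E_npos[OF ab(2)] by (simp add: adj_scaleR adj_diff npos_selfadjoint)
qed

lemma E_adj:
  assumes x: "x \<in> A"
  shows "E (x\<^sup>\<star>) = (E x)\<^sup>\<star>"
proof -
  define p q where "p = (1/2) *\<^sub>R (x + x\<^sup>\<star>)" and "q = (- \<i> / 2) *\<^sub>C (x - x\<^sup>\<star>)"
  have pq: "p\<^sup>\<star> = p" "q\<^sup>\<star> = q" "x = p + \<i> *\<^sub>C q"
    unfolding p_def q_def by (rule cartesian_decomposition)+
  have "p \<in> A" "q \<in> A" unfolding p_def q_def using x by (simp_all add: A_intros)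
  moreover have "x\<^sup>\<star> = p + (- \<i>) *\<^sub>C q"
    by (subst pq(3)) (simp add: adj_add adj_scaleC pq(1,2))
  ultimately have "E (x\<^sup>\<star>) = E p + (- \<i>) *\<^sub>C E q"
    by (simp add: E_add E_scaleC A_intros)
  moreover have "(E x)\<^sup>\<star> = E p + (- \<i>) *\<^sub>C E q"
    using \<open>p \<in> A\<close> \<open>q \<in> A\<close>
    by (subst pq(3)) (simp add: E_add E_scaleC A_intros adj_add adj_scaleC E_adj_selfadjoint pq(1,2))
  ultimately show ?thesis by simp
qed

lemma E_npos_of_npos: "x \<in> A \<Longrightarrow> npos x \<Longrightarrow> npos (E x)"
  using positive_in_iff[OF A, of x] E_npos by (auto simp: positive_in_def)

text \<open>
  With \<open>t = norm x\<close> the number \<open>t\<^sup>2\<close> is the sum of \<open>(E x)\<^sup>\<star> E x\<close> and of the images under \<open>E\<close> of the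
  positive elements \<open>(x - E x)\<^sup>\<star> (x - E x)\<close> and \<open>t\<^sup>2 - x\<^sup>\<star> x\<close>.
\<close>

lemma norm_E_le:
  assumes x: "x \<in> A"
  shows "norm (E x) \<le> norm x"
proof (cases "x = 0")
  case False
  define t where "t = norm x"
  have t: "t > 0" using False by (simp add: t_def)
  define z where "z = (1 / t) *\<^sub>R x"
  have "npos (1 - z\<^sup>\<star> * z)"
    by (rule npos_one_minus_adj_mult) (use t in \<open>simp add: z_def t_def\<close>)
  then have "npos (t\<^sup>2 *\<^sub>R (1 - z\<^sup>\<star> * z))" by (rule npos_scaleR) simp
  moreover have "t\<^sup>2 *\<^sub>R (1 - z\<^sup>\<star> * z) = of_real (t\<^sup>2) - x\<^sup>\<star> * x"
    using t by (simp add: z_def adj_scaleR scaleR_diff_right of_real_def power2_eq_square)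
  ultimately have "npos (E (of_real (t\<^sup>2) - x\<^sup>\<star> * x))"
    by (intro E_npos_of_npos) (auto intro!: A_intros x simp del: of_real_power)
  moreover have "E (of_real (t\<^sup>2) - x\<^sup>\<star> * x) = of_real (t\<^sup>2) - E (x\<^sup>\<star> * x)"
    using x by (simp add: E_diff E_of_real A_intros del: of_real_power)
  ultimately have 1: "npos (of_real (t\<^sup>2) - E (x\<^sup>\<star> * x))" by simp
  have "npos (E ((x - E x)\<^sup>\<star> * (x - E x)))"
    by (intro E_npos subalgebra_diff[OF A] x E_in_A)
  moreover have "E ((x - E x)\<^sup>\<star> * (x - E x)) = E (x\<^sup>\<star> * x) - (E x)\<^sup>\<star> * E x"
  proof -
    have "(x - E x)\<^sup>\<star> * (x - E x) = (x\<^sup>\<star> * x - x\<^sup>\<star> * E x) - ((E x)\<^sup>\<star> * x - (E x)\<^sup>\<star> * E x)"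
      by (simp add: adj_diff algebra_simps)
    moreover have "E (x\<^sup>\<star> * E x) = (E x)\<^sup>\<star> * E x"
      using x by (simp add: E_right E_in A_intros E_adj)
    moreover have "E ((E x)\<^sup>\<star> * x) = (E x)\<^sup>\<star> * E x" "E ((E x)\<^sup>\<star> * E x) = (E x)\<^sup>\<star> * E x"
      using x by (simp_all add: E_left E_fix E_in B_intros)
    ultimately show ?thesis
      using x by (simp add: E_diff A_intros E_in_A)
  qed
  ultimately have 2: "npos (E (x\<^sup>\<star> * x) - (E x)\<^sup>\<star> * E x)" by simp
  have "(E x)\<^sup>\<star> * E x + ((E (x\<^sup>\<star> * x) - (E x)\<^sup>\<star> * E x) + (of_real (t\<^sup>2) - E (x\<^sup>\<star> * x))) = of_real (t\<^sup>2)"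
    by simp
  then have "(norm (E x))\<^sup>2 \<le> t\<^sup>2"
    by (rule norm_le_of_npos_complement[rotated]) (intro npos_add 1 2)
  then show ?thesis by (simp add: t_def)
qed (simp add: E_zero)

lemma cond_expectation: "cond_expectation A B E"
proof -
  have "positive_in B (E x)" if "x \<in> A" "positive_in A x" for x
    using that E_npos_of_npos E_in positive_in_iff[OF A] positive_in_iff[OF B] by blast
  then show ?thesis
    unfolding cond_expectation_def
    using E_in E_fix E_add E_scaleC norm_E_le E_bimodule by blast
qed

lemma E_rel_commutant:
  assumes x: "x \<in> rel_commutant B A"
  shows "E x \<in> rel_commutant B B"
proof -
  have "b * E x = E x * b" if b: "b \<in> B" for b
  proof -
    have xA: "x \<in> A" and xb: "b * x = x * b" using b x by (auto simp: rel_commutant_def)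
    show ?thesis using E_left[OF b xA] E_right[OF b xA] xb by simp
  qed
  then show ?thesis using x E_in by (simp add: rel_commutant_def)
qed

end

lemma expectationI:
  assumes A: "cstar_subalgebra A" and B: "cstar_subalgebra B" "B \<subseteq> A"
    and E: "cond_expectation A B E"
  shows "expectation A B E"
proof
  show "npos (E (x\<^sup>\<star> * x))" if x: "x \<in> A" for x
  proof -
    have "positive_in A (x\<^sup>\<star> * x)" using x by (auto simp: positive_in_def)
    moreover have "x\<^sup>\<star> * x \<in> A" using x by (intro subalgebra_mult[OF A] subalgebra_adj[OF A])
    ultimately have "positive_in B (E (x\<^sup>\<star> * x))" using E by (simp add: cond_expectation_def)
    then show ?thesis using positive_in_iff[OF B(1)] by simp
  qed
  have "E (a * x * b) = a * E x * b" if "a \<in> B" "b \<in> B" "x \<in> A" for a b x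
    using E that by (simp add: cond_expectation_def)
  from this[of 1] this[of _ 1] show "E (x * b) = E x * b" "E (b * x) = b * E x" if "b \<in> B" "x \<in> A" for b x
    using that subalgebra_one[OF B(1)] by simp_all
qed (use assms in \<open>simp_all add: cond_expectation_def\<close>)


section \<open>Quasi-bases and the index\<close>

locale finite_index = expectation A B E
  for A B :: "'a::cstar_algebra set" and E :: "'a \<Rightarrow> 'a" +
  fixes n :: nat and l :: "nat \<Rightarrow> 'a"
  assumes quasi_basis: "quasi_basis A E n l"
begin

lemma l_in: "i < n \<Longrightarrow> l i \<in> A"
  using quasi_basis by (simp add: quasi_basis_def)

lemma l_adj_in: "i < n \<Longrightarrow> (l i)\<^sup>\<star> \<in> A"
  by (rule subalgebra_adj[OF A l_in])

lemma expand_left: "x \<in> A \<Longrightarrow> (\<Sum>i<n. l i * E ((l i)\<^sup>\<star> * x)) = x"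
  using quasi_basis by (simp add: quasi_basis_def)

lemma expand_right: "x \<in> A \<Longrightarrow> (\<Sum>i<n. E (x * l i) * (l i)\<^sup>\<star>) = x"
  using quasi_basis by (simp add: quasi_basis_def)

text \<open>
  The coefficients of \<open>z\<close> in the quasi-basis are values of \<open>x \<mapsto> E (x * z)\<close>.
\<close>

lemma nondegenerate:
  assumes "z \<in> A" "\<And>x. x \<in> A \<Longrightarrow> E (x * z) = 0"
  shows "z = 0"
proof -
  have "z = (\<Sum>i<n. l i * E ((l i)\<^sup>\<star> * z))" by (simp only: expand_left[OF assms(1)])
  also have "\<dots> = 0" by (simp add: assms l_adj_in)
  finally show ?thesis .
qed

text \<open>
  By the quasi-basis expansion \<open>E (x\<^sup>\<star> * x)\<close> is the sum of the positive elements \<open>c\<^sup>\<star> * c\<close>, where \<open>c\<close>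
  runs through the coefficients of \<open>x\<close>.
\<close>

lemma faithful:
  assumes x: "x \<in> A" and "E (x\<^sup>\<star> * x) = 0"
  shows "x = 0"
proof -
  have "(\<Sum>i<n. (E ((l i)\<^sup>\<star> * x))\<^sup>\<star> * E ((l i)\<^sup>\<star> * x)) = (\<Sum>i<n. E (x\<^sup>\<star> * l i * E ((l i)\<^sup>\<star> * x)))"
    by (rule sum.cong)
       (use x in \<open>simp_all add: E_right E_in A_intros l_in adj_mult adj_adj flip: E_adj\<close>)
  also have "\<dots> = E (x\<^sup>\<star> * (\<Sum>i<n. l i * E ((l i)\<^sup>\<star> * x)))"
    by (subst E_sum[symmetric])
       (use x in \<open>auto simp: sum_distrib_left mult.assoc intro!: A_intros l_in E_in_A\<close>)
  also have "\<dots> = 0" by (simp add: expand_left x assms(2))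
  finally have "E ((l i)\<^sup>\<star> * x) = 0" if "i < n" for i
    using that by (intro sum_adj_mult_eq_0[where f = "\<lambda>i. E ((l i)\<^sup>\<star> * x)" and I = "{..<n}"]) auto
  then have "(\<Sum>i<n. l i * E ((l i)\<^sup>\<star> * x)) = 0" by simp
  then show ?thesis by (simp add: expand_left x)
qed

definition index_map :: "'a \<Rightarrow> 'a" where
  "index_map y = (\<Sum>i<n. l i * y * (l i)\<^sup>\<star>)"

text \<open>
  The basis may be replaced by any pair of dual families: expand each \<open>b i\<close> in the quasi-basis, and move
  the coefficients, which lie in \<open>B\<close>, past \<open>y\<close>. This also covers bases of a second conditional
  expectation, once it is expressed through \<open>E\<close>.
\<close>

lemma index_map_dual_basis:
  assumes I: "finite I" and ab: "\<And>i. i \<in> I \<Longrightarrow> a i \<in> A" "\<And>i. i \<in> I \<Longrightarrow> b i \<in> A"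
    and dual: "\<And>x. x \<in> A \<Longrightarrow> x = (\<Sum>i\<in>I. a i * E (b i * x))"
    and y: "\<And>b. b \<in> B \<Longrightarrow> b * y = y * b"
  shows "(\<Sum>i\<in>I. a i * y * b i) = index_map y"
proof -
  have "(\<Sum>i\<in>I. a i * y * b i) = (\<Sum>i\<in>I. \<Sum>j<n. a i * y * (E (b i * l j) * (l j)\<^sup>\<star>))"
    by (rule sum.cong) (simp_all only: expand_right[OF ab(2)] flip: sum_distrib_left)
  also have "\<dots> = (\<Sum>j<n. \<Sum>i\<in>I. a i * y * (E (b i * l j) * (l j)\<^sup>\<star>))"
    by (rule sum.swap)
  also have "\<dots> = (\<Sum>j<n. \<Sum>i\<in>I. a i * E (b i * l j) * (y * (l j)\<^sup>\<star>))"
  proof (intro sum.cong refl)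
    fix i j assume "j \<in> {..<n}" "i \<in> I"
    then have "E (b i * l j) * y = y * E (b i * l j)"
      by (intro y E_in subalgebra_mult[OF A] ab l_in) auto
    then show "a i * y * (E (b i * l j) * (l j)\<^sup>\<star>) = a i * E (b i * l j) * (y * (l j)\<^sup>\<star>)"
      by (metis mult.assoc)
  qed
  also have "\<dots> = (\<Sum>j<n. l j * (y * (l j)\<^sup>\<star>))"
    by (rule sum.cong) (simp_all only: dual[OF l_in, symmetric] lessThan_iff flip: sum_distrib_right)
  finally show ?thesis by (simp add: index_map_def mult.assoc)
qed

text \<open>
  Multiplying the quasi-basis by \<open>a\<close> on the left changes it by a matrix over \<open>B\<close>, which can be moved
  to the other side, past \<open>y\<close>.
\<close>

lemma index_map_commutes:
  assumes y: "\<And>b. b \<in> B \<Longrightarrow> b * y = y * b" and a: "a \<in> A"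
  shows "a * index_map y = index_map y * a"
proof -
  have "a * index_map y = (\<Sum>i<n. (a * l i) * y * (l i)\<^sup>\<star>)"
    by (simp add: index_map_def sum_distrib_left mult.assoc)
  also have "\<dots> = (\<Sum>i<n. \<Sum>j<n. l j * E ((l j)\<^sup>\<star> * (a * l i)) * y * (l i)\<^sup>\<star>)"
    by (rule sum.cong) (simp_all add: expand_left A_intros a l_in flip: sum_distrib_right)
  also have "\<dots> = (\<Sum>j<n. \<Sum>i<n. l j * E ((l j)\<^sup>\<star> * (a * l i)) * y * (l i)\<^sup>\<star>)"
    by (rule sum.swap)
  also have "\<dots> = (\<Sum>j<n. \<Sum>i<n. l j * y * (E ((l j)\<^sup>\<star> * a * l i) * (l i)\<^sup>\<star>))"
  proof (intro sum.cong refl)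
    fix i j assume "j \<in> {..<n}" "i \<in> {..<n}"
    then have "E ((l j)\<^sup>\<star> * (a * l i)) * y = y * E ((l j)\<^sup>\<star> * (a * l i))"
      by (intro y E_in subalgebra_mult[OF A] l_in l_adj_in a) auto
    then show "l j * E ((l j)\<^sup>\<star> * (a * l i)) * y * (l i)\<^sup>\<star> = l j * y * (E ((l j)\<^sup>\<star> * a * l i) * (l i)\<^sup>\<star>)"
      by (metis mult.assoc)
  qed
  also have "\<dots> = (\<Sum>j<n. l j * y * ((l j)\<^sup>\<star> * a))"
    by (rule sum.cong) (simp_all add: expand_right A_intros a l_adj_in flip: sum_distrib_left)
  finally show ?thesis by (simp add: index_map_def sum_distrib_right mult.assoc)
qed

lemma index_map_add: "index_map (x + y) = index_map x + index_map y"
  by (simp add: index_map_def algebra_simps sum.distrib)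

lemma index_map_scaleC: "index_map (c *\<^sub>C x) = c *\<^sub>C index_map x"
  by (simp add: index_map_def scaleC_sum_right mult_scaleC_left mult_scaleC_right)

lemma index_map_scaleR: "index_map (r *\<^sub>R x) = r *\<^sub>R index_map x"
  by (simp add: scaleR_scaleC index_map_scaleC)

lemma index_map_diff: "index_map (x - y) = index_map x - index_map y"
  by (simp add: index_map_def algebra_simps sum_subtractf)

lemma index_map_adj: "(index_map y)\<^sup>\<star> = index_map (y\<^sup>\<star>)"
  by (simp add: index_map_def adj_sum adj_mult adj_adj mult.assoc)

lemma index_map_in: "cstar_subalgebra S \<Longrightarrow> A \<subseteq> S \<Longrightarrow> y \<in> S \<Longrightarrow> index_map y \<in> S"
  unfolding index_map_def
  by (intro subalgebra_sum subalgebra_mult) (use l_in l_adj_in in auto)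

lemma Ind_eq: "Ind A E = index_map 1"
  unfolding Ind_def
proof (rule the_equality)
  show "\<exists>n l. quasi_basis A E n l \<and> index_map 1 = (\<Sum>i<n. l i * (l i)\<^sup>\<star>)"
    using quasi_basis by (intro exI[of _ n] exI[of _ l]) (simp add: index_map_def)
  fix y assume "\<exists>m k. quasi_basis A E m k \<and> y = (\<Sum>i<m. k i * (k i)\<^sup>\<star>)"
  then obtain m k where k: "quasi_basis A E m k" and y: "y = (\<Sum>i<m. k i * (k i)\<^sup>\<star>)" by blast
  interpret K: finite_index A B E m k by unfold_locales (rule k)
  have "(\<Sum>i<m. k i * 1 * (k i)\<^sup>\<star>) = index_map 1"
    using K.expand_left by (intro index_map_dual_basis) (auto intro: K.l_in K.l_adj_in)
  then show "y = index_map 1" by (simp add: y)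
qed

lemma index_map_centre: "y \<in> rel_commutant B A \<Longrightarrow> index_map y \<in> rel_commutant A A"
  using index_map_commutes[of y] index_map_in[OF A] by (auto simp: rel_commutant_def)

lemma one_rel_commutant: "1 \<in> rel_commutant B A"
  using subalgebra_one[OF A] by (simp add: rel_commutant_def)

lemma rel_commutant_subalg: "cstar_subalgebra (rel_commutant B A)"
  by (rule rel_commutant_subalgebra[OF A subalgebra_adj[OF B]])

lemma scalar_index_eq: "Ind A E = of_real r \<Longrightarrow> scalar_index A E = r"
  unfolding scalar_index_def by (rule the_equality) auto

lemma Ind_scalar:
  assumes "trivial_centre A"
  shows "index_map 1 = of_real (scalar_index A E)" "scalar_index A E > 0"
proof -
  obtain r where r: "index_map 1 = of_real r"
    using trivial_centre_selfadjoint[OF assms index_map_centre[OF one_rel_commutant]]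
      index_map_adj[of 1] by auto
  then have s: "scalar_index A E = r" by (intro scalar_index_eq) (simp add: Ind_eq)
  then show "index_map 1 = of_real (scalar_index A E)" using r by simp
  have eq: "(\<Sum>i<n. ((l i)\<^sup>\<star>)\<^sup>\<star> * (l i)\<^sup>\<star>) = of_real r"
    using r by (simp add: index_map_def adj_adj)
  have "npos (of_real r :: 'a)" unfolding eq[symmetric] by (intro npos_sum npos_adj_mult)
  then have "r \<ge> 0" by (simp add: npos_of_real_iff)
  moreover have "r \<noteq> 0"
  proof
    assume "r = 0"
    then have "(l i)\<^sup>\<star> = 0" if "i < n" for i
      using eq that sum_adj_mult_eq_0[of "{..<n}" "\<lambda>i. (l i)\<^sup>\<star>" i] by simp
    then have "(\<Sum>i<n. E (1 * l i) * (l i)\<^sup>\<star>) = 0" by simp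
    then show False using expand_right[OF subalgebra_one[OF A]] by simp
  qed
  ultimately show "scalar_index A E > 0" by (simp add: s)
qed

end


section \<open>Minimal conditional expectations\<close>

text \<open>
  The Neumann series. The bound on \<open>q\<close> follows from \<open>q = 1 + h * q\<close>.
\<close>

lemma one_minus_inverse:
  fixes h :: "'a::cstar_algebra"
  assumes S: "cstar_subalgebra S" "h \<in> S" and h: "h\<^sup>\<star> = h" "norm h \<le> 1/2"
  obtains q where "q \<in> S" "q\<^sup>\<star> = q" "(1 - h) * q = 1" "q * (1 - h) = 1" "norm q \<le> 2"
proof
  define q where "q = (\<Sum>n. h ^ n)"
  have sm: "summable (\<lambda>n. h ^ n)"
  proof (rule summable_norm_cancel, rule summable_comparison_test')
    show "summable (\<lambda>n. (1/2::real) ^ n)" by (rule summable_geometric) simp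
    show "norm (norm (h ^ n)) \<le> (1/2) ^ n" for n
      using norm_power_ineq[of h n] power_mono[OF h(2) norm_ge_zero, of n] by (simp only: real_norm_def abs_norm_cancel)
  qed
  show "q \<in> S" unfolding q_def
    by (rule subalgebra_suminf[OF S(1) sm]) (rule subalgebra_power[OF S])
  show "q\<^sup>\<star> = q"
    unfolding q_def bounded_linear.suminf[OF bounded_linear_adj sm] by (simp add: adj_power h(1))
  have split: "q = 1 + (\<Sum>n. h ^ Suc n)"
    using suminf_split_head[OF sm] by (simp add: q_def)
  have "h * q = (\<Sum>n. h ^ Suc n)"
    unfolding q_def by (simp add: suminf_mult[OF sm])
  then have hq: "q = 1 + h * q" using split by simp
  have "q * h = (\<Sum>n. h ^ Suc n)"
    unfolding q_def by (simp add: suminf_mult2[OF sm] power_commutes)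
  then have qh: "q = 1 + q * h" using split by simp
  show "(1 - h) * q = 1" using arg_cong[OF hq, of "\<lambda>x. x - h * q"] by (simp add: left_diff_distrib)
  show "q * (1 - h) = 1" using arg_cong[OF qh, of "\<lambda>x. x - q * h"] by (simp add: right_diff_distrib)
  have "norm q = norm (1 + h * q)" by (rule arg_cong[OF hq])
  also have "\<dots> \<le> 1 + norm (h * q)" using norm_triangle_ineq[of 1 "h * q"] by simp
  also have "norm (h * q) \<le> (1/2) * norm q"
    using norm_mult_ineq[of h q] mult_right_mono[OF h(2), of "norm q"] by simp
  finally show "norm q \<le> 2" by linarith
qed

lemma linear_term_zero:
  fixes D K \<delta> :: real
  assumes \<delta>: "\<delta> > 0" and K: "K \<ge> 0" and pos: "\<And>s. \<bar>s\<bar> \<le> \<delta> \<Longrightarrow> 0 \<le> s * D + s\<^sup>2 * K"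
  shows "D = 0"
proof (rule ccontr)
  assume D: "D \<noteq> 0"
  \<comment> \<open>at \<open>s = - sgn D * r\<close> the linear term is negative and dominates the quadratic one\<close>
  define r where "r = min \<delta> (\<bar>D\<bar> / (2 * (K + 1)))"
  have r: "r > 0" "r \<le> \<delta>" using D \<delta> K by (auto simp: r_def)
  have "r * K \<le> \<bar>D\<bar> / (2 * (K + 1)) * K" using K by (intro mult_right_mono) (auto simp: r_def)
  also have "\<dots> \<le> \<bar>D\<bar> / 2" using K by (simp add: field_simps mult_left_mono)
  also have "\<dots> < \<bar>D\<bar>" using D by simp
  finally have less: "r * (r * K) < r * \<bar>D\<bar>" using r by simp
  have "0 \<le> (- sgn D * r) * D + (- sgn D * r)\<^sup>2 * K"
    using r D by (intro pos) (auto simp: abs_mult sgn_if)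
  also have "\<dots> = r * (r * K) - r * \<bar>D\<bar>"
    using D by (auto simp: sgn_if power2_eq_square)
  finally show False using less by simp
qed

context finite_index
begin

text \<open>
  For an invertible self-adjoint \<open>u\<close> in the relative commutant of \<open>B\<close>, rescaling \<open>x \<mapsto> E (u x u)\<close>
  gives another conditional expectation, with quasi-basis proportional to \<open>l i * u\<^sup>-\<^sup>1\<close>.
\<close>

lemma perturbed_expectation:
  assumes u: "u \<in> rel_commutant B A" "u\<^sup>\<star> = u" and v: "v \<in> rel_commutant B A" "v\<^sup>\<star> = v"
    and inv: "u * v = 1" "v * u = 1" and f: "E (u * u) = of_real f"
  shows "f > 0"
    and "finite_index A B (\<lambda>x. (1 / f) *\<^sub>R E (u * x * u)) n (\<lambda>i. sqrt f *\<^sub>R (l i * v))"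
proof -
  have uA: "u \<in> A" and vA: "v \<in> A"
    and ub: "\<And>b. b \<in> B \<Longrightarrow> b * u = u * b" and vb: "\<And>b. b \<in> B \<Longrightarrow> b * v = v * b"
    using u v by (auto simp: rel_commutant_def)
  have "npos (of_real f :: 'a)" unfolding f[symmetric] using E_npos[OF uA] u(2) by simp
  then have "f \<ge> 0" by (simp add: npos_of_real_iff)
  moreover have "f \<noteq> 0"
  proof
    assume "f = 0"
    then have "u = 0" using faithful[OF uA] f u(2) by simp
    then show False using inv by simp
  qed
  ultimately show f0: "f > 0" by simp
  let ?F = "\<lambda>x. (1 / f) *\<^sub>R E (u * x * u)"
  let ?l = "\<lambda>i. sqrt f *\<^sub>R (l i * v)"
  have uxu: "u * x * u \<in> A" if "x \<in> A" for x by (intro subalgebra_mult[OF A] that uA)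
  show "finite_index A B ?F n ?l"
  proof
    show "?F x \<in> B" if "x \<in> A" for x by (intro subalgebra_scaleR[OF B] E_in uxu that)
    show "?F b = b" if b: "b \<in> B" for b
    proof -
      have "u * b * u = b * u * u" by (simp only: ub[OF b])
      also have "\<dots> = b * (u * u)" by (rule mult.assoc)
      finally have "E (u * b * u) = b * E (u * u)" using E_left[OF b] subalgebra_mult[OF A uA uA] by simp
      then show ?thesis using f0 by (simp add: f of_real_def)
    qed
    show "?F (x + y) = ?F x + ?F y" if "x \<in> A" "y \<in> A" for x y
      using that by (simp add: distrib_left distrib_right E_add uxu scaleR_add_right)
    show "?F (c *\<^sub>C x) = c *\<^sub>C ?F x" if "x \<in> A" for x c
      using that by (simp add: mult_scaleC_left mult_scaleC_right E_scaleC uxu scaleC_scaleR)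
    show "npos (?F (x\<^sup>\<star> * x))" if x: "x \<in> A" for x
    proof (rule npos_scaleR)
      have "npos (E ((x * u)\<^sup>\<star> * (x * u)))" by (intro E_npos subalgebra_mult[OF A] x uA)
      then show "npos (E (u * (x\<^sup>\<star> * x) * u))" by (simp add: adj_mult u(2) mult.assoc)
    qed (use f0 in simp)
    show "?F (b * x) = b * ?F x" if b: "b \<in> B" and x: "x \<in> A" for b x
    proof -
      have "u * (b * x) * u = u * b * x * u" by (simp only: mult.assoc)
      also have "\<dots> = b * (u * x * u)" by (simp only: ub[OF b, symmetric]) (simp only: mult.assoc)
      finally show ?thesis using E_left[OF b uxu[OF x]] by simp
    qed
    show "?F (x * b) = ?F x * b" if b: "b \<in> B" and x: "x \<in> A" for b x
    proof -
      have "u * (x * b) * u = u * x * u * b" by (simp only: ub[OF b] mult.assoc)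
      then show ?thesis using E_right[OF b uxu[OF x]] by simp
    qed
    show "quasi_basis A ?F n ?l"
      unfolding quasi_basis_def
    proof (intro conjI ballI allI impI)
      show "?l i \<in> A" if "i < n" for i using that by (simp add: A_intros l_in vA)
      fix x assume x: "x \<in> A"
      have xu: "x * u \<in> A" "u * x \<in> A" using x uA by (simp_all add: A_intros)
      have "(\<Sum>i<n. ?l i * ?F ((?l i)\<^sup>\<star> * x)) = (\<Sum>i<n. l i * E ((l i)\<^sup>\<star> * (x * u)) * v)"
      proof (rule sum.cong[OF refl])
        fix i assume i: "i \<in> {..<n}"
        have e: "u * (v * (l i)\<^sup>\<star> * x) * u = (l i)\<^sup>\<star> * (x * u)"
          using inv(1) by (simp flip: mult.assoc)
        have "E ((l i)\<^sup>\<star> * (x * u)) \<in> B" using i by (intro E_in subalgebra_mult[OF A] xu l_adj_in) simp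
        note c = vb[OF this]
        have "(l i)\<^sup>\<star> * (x * u) \<in> A" using i by (intro subalgebra_mult[OF A] xu l_adj_in) simp
        then have "?l i * ?F ((?l i)\<^sup>\<star> * x) = l i * v * E ((l i)\<^sup>\<star> * (x * u))"
          using f0 e by (simp add: adj_scaleR adj_mult v(2) E_scaleR)
        then show "?l i * ?F ((?l i)\<^sup>\<star> * x) = l i * E ((l i)\<^sup>\<star> * (x * u)) * v"
          by (simp only: c mult.assoc)
      qed
      also have "\<dots> = x * u * v" by (simp only: expand_left[OF xu(1)] flip: sum_distrib_right)
      also have "\<dots> = x" by (simp only: mult.assoc inv mult_1_right)
      finally show "x = (\<Sum>i<n. ?l i * ?F ((?l i)\<^sup>\<star> * x))" by (rule sym)
      have "(\<Sum>i<n. ?F (x * ?l i) * (?l i)\<^sup>\<star>) = (\<Sum>i<n. v * (E (u * x * l i) * (l i)\<^sup>\<star>))"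
      proof (rule sum.cong[OF refl])
        fix i assume i: "i \<in> {..<n}"
        have e: "u * (x * (l i * v)) * u = u * x * l i"
          using inv(2) by (simp add: mult.assoc)
        have E: "E (u * x * l i) \<in> B" using i by (intro E_in subalgebra_mult[OF A] x uA l_in) simp
        have "u * x * l i \<in> A" using i by (intro subalgebra_mult[OF A] x uA l_in) simp
        then have "?F (x * ?l i) * (?l i)\<^sup>\<star> = E (u * x * l i) * (v * (l i)\<^sup>\<star>)"
          using f0 e by (simp add: adj_scaleR adj_mult v(2) E_scaleR)
        then show "?F (x * ?l i) * (?l i)\<^sup>\<star> = v * (E (u * x * l i) * (l i)\<^sup>\<star>)"
          by (simp only: vb[OF E] flip: mult.assoc)
      qed
      also have "\<dots> = v * (u * x)" by (simp only: expand_right[OF xu(2)] flip: sum_distrib_left)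
      also have "\<dots> = x" by (simp only: mult.assoc[symmetric] inv mult_1_left)
      finally show "x = (\<Sum>i<n. ?F (x * ?l i) * (?l i)\<^sup>\<star>)" by (rule sym)
    qed
  qed (rule A B BA)+
qed

text \<open>
  If the relative commutant is finite-dimensional this is Hiai's characterization of the minimal
  conditional expectation.
\<close>

definition balanced :: bool where
  "balanced \<longleftrightarrow> (\<forall>y \<in> rel_commutant B A. index_map y = scalar_index A E *\<^sub>R E y)"

text \<open>
  Take \<open>y\<close> self-adjoint in the relative commutant, with \<open>E y = \<phi>\<close> and \<open>index_map y = d\<close>, and let \<open>c\<close> be the
  index. For \<open>u = (1 - s y)\<^sup>-\<^sup>1\<^sup>/\<^sup>2\<close> the perturbed expectation has index
  \<open>E ((1 - s y)\<^sup>-\<^sup>1) * (c - s d) = c + s (c \<phi> - d) + O (s\<^sup>2)\<close>. Minimality says that this is at least \<open>c\<close> for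
  small \<open>s\<close> of either sign, so \<open>d = c \<phi>\<close>.
\<close>

lemma minimal_balanced:
  assumes min: "minimal_expectation A B E" and cA: "trivial_centre A" and cB: "trivial_centre B"
  shows balanced
proof -
  let ?C = "rel_commutant B A"
  let ?c = "scalar_index A E"
  note C = rel_commutant_subalg
  have CA: "x \<in> A" if "x \<in> ?C" for x using that by (simp add: rel_commutant_def)
  have sa: "index_map y = ?c *\<^sub>R E y" if y: "y \<in> ?C" "y\<^sup>\<star> = y" for y
  proof -
    have scalar: "\<exists>r. E x = of_real r" if "x \<in> ?C" "x\<^sup>\<star> = x" for x
      using trivial_centre_selfadjoint[OF cB E_rel_commutant[OF that(1)]] E_adj[OF CA[OF that(1)]] that(2)
      by metis
    obtain \<phi> where \<phi>: "E y = of_real \<phi>" using scalar y by blast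
    obtain d where d: "index_map y = of_real d"
      using trivial_centre_selfadjoint[OF cA index_map_centre[OF y(1)]] index_map_adj[of y] y(2) by metis
    \<comment> \<open>for \<open>\<bar>s\<bar> \<le> \<delta>\<close> the norm of \<open>s y\<close> is at most \<open>1/2\<close>, and \<open>M\<close> bounds \<open>E (y\<^sup>2 (1 - s y)\<^sup>-\<^sup>1)\<close>\<close>
    define \<delta> where "\<delta> = min 1 (1 / (2 * norm y + 1))"
    define M where "M = 2 * (norm y)\<^sup>2"
    define K where "K = M * ?c + \<bar>\<phi> * d\<bar> + M * \<bar>d\<bar>"
    have c: "?c > 0" by (rule Ind_scalar(2)[OF cA])
    have "0 \<le> s * (?c * \<phi> - d) + s\<^sup>2 * K" if s: "\<bar>s\<bar> \<le> \<delta>" for s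
    proof -
      define h where "h = s *\<^sub>R y"
      have "norm h \<le> 1 / (2 * norm y + 1) * norm y"
        unfolding h_def norm_scaleR using s by (intro mult_right_mono) (auto simp: \<delta>_def)
      also have "\<dots> \<le> 1/2" by (simp add: field_simps add_pos_nonneg)
      finally have nh: "norm h \<le> 1/2" .
      have h: "h\<^sup>\<star> = h" "h \<in> ?C" unfolding h_def using y by (auto simp: adj_scaleR subalgebra_scaleR[OF C])
      obtain q where q: "q \<in> ?C" "q\<^sup>\<star> = q" "(1 - h) * q = 1" "q * (1 - h) = 1" "norm q \<le> 2"
        by (rule one_minus_inverse[OF C h(2,1) nh])
      have nh1: "norm h \<le> 1" using nh by simp
      define v where "v = sqrt1m h"
      have v: "v \<in> ?C" "v\<^sup>\<star> = v" "v * v = 1 - h"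
        unfolding v_def by (rule sqrt1m_in_subalgebra[OF nh1 C h(2)], rule sqrt1m_selfadjoint[OF nh1 h(1)],
          rule sqrt1m_square[OF nh1])
      have vq: "v * q = q * v"
      proof -
        have vh: "v * (1 - h) = (1 - h) * v" unfolding v(3)[symmetric] by (simp only: mult.assoc)
        have "v * q = q * (1 - h) * (v * q)" by (simp only: q(4) mult_1_left)
        also have "\<dots> = q * ((1 - h) * v) * q" by (simp only: mult.assoc)
        also have "\<dots> = q * (v * (1 - h)) * q" by (simp only: vh)
        also have "\<dots> = q * v * ((1 - h) * q)" by (simp only: mult.assoc)
        also have "\<dots> = q * v" by (simp only: q(3) mult_1_right)
        finally show ?thesis .
      qed
      define u where "u = v * q"
      have u: "u \<in> ?C" "u\<^sup>\<star> = u"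
        unfolding u_def using v q by (auto simp: adj_mult vq subalgebra_mult[OF C])
      have uv: "u * v = 1" unfolding u_def vq by (simp only: mult.assoc v(3) q(4))
      have vu: "v * u = 1" unfolding u_def by (simp only: mult.assoc[symmetric] v(3) q(3))
      have uu: "u * u = q"
      proof -
        have "u * u = u * v * q" by (simp add: u_def mult.assoc)
        then show ?thesis by (simp add: uv)
      qed
      obtain f where f: "E (u * u) = of_real f" using scalar[OF q(1,2)] uu by auto
      note P = perturbed_expectation[OF u v(1,2) uv vu f]
      interpret F: finite_index A B "\<lambda>x. (1 / f) *\<^sub>R E (u * x * u)" n "\<lambda>i. sqrt f *\<^sub>R (l i * v)"
        by (rule P(2))
      have "F.index_map 1 = f *\<^sub>R index_map (1 - h)"
        unfolding F.index_map_def index_map_def scaleR_sum_right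
        using P(1) by (intro sum.cong refl) (simp add: adj_scaleR adj_mult v(2) mult.assoc flip: v(3))
      also have "index_map (1 - h) = of_real (?c - s * d)"
        by (simp add: index_map_diff Ind_scalar(1)[OF cA] h_def index_map_scaleR d of_real_def
            scaleR_diff_left)
      finally have "F.index_map 1 = of_real (f * (?c - s * d))" by (simp add: of_real_def)
      then have "scalar_index A (\<lambda>x. (1 / f) *\<^sub>R E (u * x * u)) = f * (?c - s * d)"
        by (intro F.scalar_index_eq) (simp only: F.Ind_eq)
      moreover have "finite_index_expectation A B (\<lambda>x. (1 / f) *\<^sub>R E (u * x * u))"
        using F.cond_expectation F.quasi_basis by (auto simp: finite_index_expectation_def)
      ultimately have le: "?c \<le> f * (?c - s * d)"
        using min by (auto simp: minimal_expectation_def)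
      \<comment> \<open>expand \<open>f = E q\<close> to second order in \<open>s\<close>\<close>
      define z where "z = y * y * q"
      have z: "z \<in> A" unfolding z_def by (intro subalgebra_mult[OF A] CA y q)
      have q1: "q = 1 + h * q" using q(3) by (simp add: left_diff_distrib algebra_simps)
      have "h * q = h * (1 + h * q)" by (rule arg_cong[OF q1])
      also have "\<dots> = s *\<^sub>R y + s\<^sup>2 *\<^sub>R z"
        by (simp add: h_def z_def distrib_left power2_eq_square mult.assoc)
      finally have "1 + h * q = 1 + (s *\<^sub>R y + s\<^sup>2 *\<^sub>R z)" by (rule arg_cong)
      then have "q = 1 + s *\<^sub>R y + s\<^sup>2 *\<^sub>R z" using q1 by (simp only: add.assoc)
      then have "E q = E (1 + s *\<^sub>R y + s\<^sup>2 *\<^sub>R z)" by (rule arg_cong)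
      also have "\<dots> = of_real (1 + s * \<phi>) + s\<^sup>2 *\<^sub>R E z"
        using z CA[OF y(1)] by (simp add: E_add E_scaleR E_one A_intros \<phi> of_real_def scaleR_add_left)
      also have "E q = of_real f" using f by (simp only: uu)
      finally have Ez: "s\<^sup>2 *\<^sub>R E z = of_real (f - (1 + s * \<phi>))"
        unfolding of_real_diff by (metis add_diff_cancel_left')
      have "norm z \<le> norm (y * y) * norm q" unfolding z_def by (rule norm_mult_ineq)
      also have "\<dots> \<le> (norm y)\<^sup>2 * 2"
        using q(5) norm_mult_ineq[of y y] by (intro mult_mono) (auto simp: power2_eq_square)
      finally have "norm (E z) \<le> M" using norm_E_le[OF z] by (simp add: M_def)
      then have "norm (s\<^sup>2 *\<^sub>R E z) \<le> s\<^sup>2 * M" by (simp add: mult_left_mono)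
      then have ferr: "\<bar>f - (1 + s * \<phi>)\<bar> \<le> s\<^sup>2 * M" by (simp only: Ez norm_of_real)
      define r where "r = f - (1 + s * \<phi>)"
      have "f * (?c - s * d) = ?c + s * (?c * \<phi> - d) + (r * ?c - s\<^sup>2 * (\<phi> * d) - r * s * d)"
        by (simp add: r_def algebra_simps power2_eq_square)
      with le have "0 \<le> s * (?c * \<phi> - d) + (r * ?c - s\<^sup>2 * (\<phi> * d) - r * s * d)" by simp
      also have "r * ?c - s\<^sup>2 * (\<phi> * d) - r * s * d \<le> s\<^sup>2 * K"
      proof -
        have r: "\<bar>r\<bar> \<le> s\<^sup>2 * M" using ferr by (simp add: r_def)
        have "r * ?c \<le> s\<^sup>2 * M * ?c" using r c by (intro mult_right_mono) auto
        moreover have "- (s\<^sup>2 * (\<phi> * d)) \<le> s\<^sup>2 * \<bar>\<phi> * d\<bar>"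
          using mult_left_mono[of "- (\<phi> * d)" "\<bar>\<phi> * d\<bar>" "s\<^sup>2"] by simp
        moreover have "- (r * s * d) \<le> s\<^sup>2 * M * \<bar>d\<bar>"
        proof -
          have "- (r * s * d) \<le> \<bar>r * s * d\<bar>" by simp
          also have "\<dots> = \<bar>r\<bar> * \<bar>s\<bar> * \<bar>d\<bar>" by (simp add: abs_mult)
          also have "\<dots> \<le> s\<^sup>2 * M * 1 * \<bar>d\<bar>"
            using r s by (intro mult_mono) (auto simp: \<delta>_def M_def)
          finally show ?thesis by simp
        qed
        ultimately show ?thesis by (simp add: K_def algebra_simps)
      qed
      finally show ?thesis by simp
    qed
    moreover have "\<delta> > 0" by (simp add: \<delta>_def add_nonneg_pos)
    moreover have "K \<ge> 0" using c by (simp add: K_def M_def)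
    ultimately have "?c * \<phi> - d = 0" by (intro linear_term_zero) auto
    then show ?thesis by (simp add: d \<phi> of_real_def)
  qed
  show ?thesis
    unfolding balanced_def
  proof
    fix y assume y: "y \<in> ?C"
    define p q where "p = (1/2) *\<^sub>R (y + y\<^sup>\<star>)" and "q = (- \<i> / 2) *\<^sub>C (y - y\<^sup>\<star>)"
    have pq: "p\<^sup>\<star> = p" "q\<^sup>\<star> = q" "y = p + \<i> *\<^sub>C q"
      unfolding p_def q_def by (rule cartesian_decomposition)+
    have pC: "p \<in> ?C" "q \<in> ?C"
      unfolding p_def q_def
      by (intro subalgebra_scaleR[OF C] subalgebra_add[OF C] subalgebra_scaleC[OF C]
        subalgebra_diff[OF C] subalgebra_adj[OF C] y)+
    have pA: "p \<in> A" "q \<in> A" using pC by (auto intro: CA)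
    have "index_map (p + \<i> *\<^sub>C q) = ?c *\<^sub>R (E p + \<i> *\<^sub>C E q)"
      by (simp only: index_map_add index_map_scaleC sa[OF pC(1) pq(1)] sa[OF pC(2) pq(2)]
          scaleC_scaleR scaleR_add_right)
    also have "E p + \<i> *\<^sub>C E q = E (p + \<i> *\<^sub>C q)"
      by (simp only: E_add[OF pA(1) subalgebra_scaleC[OF A pA(2)]] E_scaleC[OF pA(2)])
    finally show "index_map y = ?c *\<^sub>R E y" by (simp only: pq(3)[symmetric])
  qed
qed

end

text \<open>
  Every conditional expectation \<open>G\<close> onto \<open>B\<close> has the form \<open>G x = E (x k)\<close>, with \<open>k\<close> in the relative
  commutant and \<open>E k = 1\<close>. If both \<open>E\<close> and \<open>G\<close> are balanced then comparing their index maps gives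
  \<open>k\<^sup>\<star> k = c / c'\<close>, where \<open>c\<close> and \<open>c'\<close> are the indices.
\<close>

lemma balanced_density:
  assumes E: "finite_index A B E n l" and G: "finite_index A B G m j"
    and bal: "finite_index.balanced A B E n l" "finite_index.balanced A B G m j"
    and cA: "trivial_centre A"
  obtains k where "k \<in> rel_commutant B A" "\<forall>x\<in>A. G x = E (x * k)"
    "E ((k - 1)\<^sup>\<star> * (k - 1)) = of_real (scalar_index A E / scalar_index A G - 1)"
proof -
  interpret E: finite_index A B E n l by (rule E)
  interpret G: finite_index A B G m j by (rule G)
  define c c' where "c = scalar_index A E" and "c' = scalar_index A G"
  have c: "c > 0" "c' > 0" unfolding c_def c'_def by (rule E.Ind_scalar G.Ind_scalar; rule cA)+
  define k where "k = (\<Sum>i<n. l i * G ((l i)\<^sup>\<star>))"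
  have kA: "k \<in> A" unfolding k_def
    by (intro subalgebra_sum[OF E.A] subalgebra_mult[OF E.A] G.E_in_A) (auto intro: E.l_in E.l_adj_in)
  have Gk: "G x = E (x * k)" if x: "x \<in> A" for x
  proof -
    have "G x = G (\<Sum>i<n. E (x * l i) * (l i)\<^sup>\<star>)" by (simp only: E.expand_right[OF x])
    also have "\<dots> = (\<Sum>i<n. G (E (x * l i) * (l i)\<^sup>\<star>))"
      by (rule G.E_sum) (auto intro!: E.A_intros E.E_in_A E.l_in x)
    also have "\<dots> = (\<Sum>i<n. E (x * (l i * G ((l i)\<^sup>\<star>))))"
    proof (rule sum.cong[OF refl])
      fix i assume "i \<in> {..<n}"
      then have i: "l i \<in> A" "(l i)\<^sup>\<star> \<in> A" using E.l_in E.l_adj_in by auto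
      have "G (E (x * l i) * (l i)\<^sup>\<star>) = E (x * l i) * G ((l i)\<^sup>\<star>)"
        by (intro G.E_left E.E_in subalgebra_mult[OF E.A] x i)
      also have "\<dots> = E (x * l i * G ((l i)\<^sup>\<star>))"
        by (intro E.E_right[symmetric] G.E_in subalgebra_mult[OF E.A] x i)
      finally show "G (E (x * l i) * (l i)\<^sup>\<star>) = E (x * (l i * G ((l i)\<^sup>\<star>)))" by (simp only: mult.assoc)
    qed
    also have "\<dots> = E (x * k)"
      unfolding k_def sum_distrib_left
      by (rule E.E_sum[symmetric]) (auto intro!: E.A_intros G.E_in_A E.l_in x)
    finally show ?thesis .
  qed
  have k: "k \<in> rel_commutant B A"
  proof -
    have "b * k - k * b = 0" if b: "b \<in> B" for b
    proof (rule E.nondegenerate)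
      have bA: "b \<in> A" using b by (rule E.B_in_A)
      show "b * k - k * b \<in> A" using bA kA by (simp add: E.A_intros)
      fix x assume x: "x \<in> A"
      have "E (x * (b * k - k * b)) = E (x * b * k) - E (x * k * b)"
        using x bA kA by (simp add: right_diff_distrib E.E_diff E.A_intros mult.assoc)
      also have "E (x * b * k) = G x * b"
        using Gk[of "x * b"] G.E_right[OF b x] subalgebra_mult[OF E.A x bA] by simp
      also have "E (x * k * b) = G x * b"
        using E.E_right[OF b subalgebra_mult[OF E.A x kA]] Gk[OF x] by simp
      finally show "E (x * (b * k - k * b)) = 0" by simp
    qed
    then show ?thesis using kA by (simp add: rel_commutant_def)
  qed
  have kaC: "k\<^sup>\<star> \<in> rel_commutant B A" by (rule subalgebra_adj[OF E.rel_commutant_subalg k])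
  then have kaA: "k\<^sup>\<star> \<in> A" by (simp add: rel_commutant_def)
  have Gk': "G x = E (k\<^sup>\<star> * x)" if x: "x \<in> A" for x
  proof -
    have "G x = (G (x\<^sup>\<star>))\<^sup>\<star>" using G.E_adj[OF x] by (simp add: adj_adj)
    also have "\<dots> = (E (x\<^sup>\<star> * k))\<^sup>\<star>" using Gk[of "x\<^sup>\<star>"] x by (simp add: E.A_intros)
    also have "\<dots> = E ((x\<^sup>\<star> * k)\<^sup>\<star>)" using x kA by (simp add: E.E_adj E.A_intros)
    finally show ?thesis by (simp add: adj_mult adj_adj)
  qed
  \<comment> \<open>a quasi-basis \<open>j\<close> of \<open>G\<close> gives the dual basis \<open>j\<close>, \<open>k\<^sup>\<star> j\<^sup>\<star>\<close> for \<open>E\<close>\<close>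
  have index: "E.index_map y = G.index_map (y * k\<^sup>\<star>)" if y: "y \<in> rel_commutant B A" for y
  proof -
    have "(\<Sum>i<m. j i * y * (k\<^sup>\<star> * (j i)\<^sup>\<star>)) = E.index_map y"
    proof (rule E.index_map_dual_basis)
      fix x assume x: "x \<in> A"
      have "x = (\<Sum>i<m. j i * G ((j i)\<^sup>\<star> * x))" by (rule G.expand_left[OF x, symmetric])
      also have "\<dots> = (\<Sum>i<m. j i * E (k\<^sup>\<star> * (j i)\<^sup>\<star> * x))"
        by (rule sum.cong[OF refl])
           (use x in \<open>simp add: Gk' E.A_intros G.l_adj_in mult.assoc\<close>)
      finally show "x = (\<Sum>i<m. j i * E (k\<^sup>\<star> * (j i)\<^sup>\<star> * x))" .
    qed (use y in \<open>auto simp: rel_commutant_def intro!: E.A_intros G.l_in kA\<close>)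
    then show ?thesis by (simp add: G.index_map_def mult.assoc)
  qed
  have E_eq: "c *\<^sub>R E y = c' *\<^sub>R E (y * (k\<^sup>\<star> * k))" if y: "y \<in> rel_commutant B A" for y
  proof -
    have yk: "y * k\<^sup>\<star> \<in> rel_commutant B A" by (rule subalgebra_mult[OF E.rel_commutant_subalg y kaC])
    then have "y * k\<^sup>\<star> \<in> A" by (simp add: rel_commutant_def)
    have "c *\<^sub>R E y = E.index_map y" using bal(1) y by (simp add: E.balanced_def c_def)
    also have "\<dots> = c' *\<^sub>R G (y * k\<^sup>\<star>)" using index[OF y] bal(2) yk by (simp add: G.balanced_def c'_def)
    also have "\<dots> = c' *\<^sub>R E (y * (k\<^sup>\<star> * k))" using Gk[OF \<open>y * k\<^sup>\<star> \<in> A\<close>] by (simp add: mult.assoc)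
    finally show ?thesis .
  qed
  \<comment> \<open>\<open>E_eq\<close> says \<open>E (y * d) = 0\<close> for all \<open>y\<close> in the relative commutant, in particular for \<open>y = d\<close>\<close>
  define d where "d = of_real c - c' *\<^sub>R (k\<^sup>\<star> * k)"
  have dC: "d \<in> rel_commutant B A"
    unfolding d_def
    by (intro subalgebra_diff[OF E.rel_commutant_subalg] subalgebra_of_real[OF E.rel_commutant_subalg]
        subalgebra_scaleR[OF E.rel_commutant_subalg] subalgebra_mult[OF E.rel_commutant_subalg] k kaC)
  then have dA: "d \<in> A" by (simp add: rel_commutant_def)
  have d_adj: "d\<^sup>\<star> = d" by (simp add: d_def adj_diff adj_scaleR adj_mult adj_adj)
  have "E (d\<^sup>\<star> * d) = c *\<^sub>R E d - c' *\<^sub>R E (d * (k\<^sup>\<star> * k))"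
  proof -
    have "d * d = c *\<^sub>R d - c' *\<^sub>R (d * (k\<^sup>\<star> * k))"
      by (subst (2) d_def) (simp add: right_diff_distrib of_real_def)
    then show ?thesis
      using dA kA kaA by (simp add: d_adj E.E_diff E.E_scaleR E.A_intros)
  qed
  also have "\<dots> = 0" using E_eq[OF dC] by simp
  finally have "d = 0" by (rule E.faithful[OF dA])
  then have "c' *\<^sub>R (k\<^sup>\<star> * k) = of_real c" by (simp add: d_def)
  then have kk: "k\<^sup>\<star> * k = of_real (c / c')"
    using c by (simp add: of_real_def eq_vector_fraction_iff)
  have Ek: "E k = 1" using Gk[of 1] G.E_one subalgebra_one[OF E.A] by simp
  have "(k - 1)\<^sup>\<star> * (k - 1) = k\<^sup>\<star> * k - k\<^sup>\<star> - (k - 1)" by (simp add: adj_diff algebra_simps)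
  then have "E ((k - 1)\<^sup>\<star> * (k - 1)) = E (k\<^sup>\<star> * k) - E (k\<^sup>\<star>) - (E k - 1)"
    using kA kaA by (simp add: E.E_diff E.E_one E.A_intros)
  also have "\<dots> = of_real (c / c' - 1)"
    using kA by (simp add: E.E_adj Ek kk E.E_of_real del: of_real_divide)
  finally show ?thesis using that k Gk by (simp add: c_def c'_def)
qed

text \<open>
  The positive number of \<open>balanced_density\<close> shows that the index of \<open>E\<close> is at least that of \<open>G\<close>. By
  symmetry they agree, and then \<open>k = 1\<close> by faithfulness.
\<close>

lemma balanced_unique:
  assumes E: "finite_index A B E n l" and G: "finite_index A B G m j"
    and bal: "finite_index.balanced A B E n l" "finite_index.balanced A B G m j"
    and cA: "trivial_centre A" and x: "x \<in> A"
  shows "G x = E x"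
proof -
  interpret E: finite_index A B E n l by (rule E)
  interpret G: finite_index A B G m j by (rule G)
  obtain k where k: "k \<in> rel_commutant B A" "\<forall>x\<in>A. G x = E (x * k)"
    "E ((k - 1)\<^sup>\<star> * (k - 1)) = of_real (scalar_index A E / scalar_index A G - 1)"
    by (rule balanced_density[OF E G bal cA])
  obtain k' where k': "k' \<in> rel_commutant B A"
    "G ((k' - 1)\<^sup>\<star> * (k' - 1)) = of_real (scalar_index A G / scalar_index A E - 1)"
    by (rule balanced_density[OF G E bal(2,1) cA])
  have kA: "k - 1 \<in> A" "k' - 1 \<in> A"
    using k(1) k'(1) by (auto simp: rel_commutant_def intro!: E.A_intros)
  have "npos (of_real (scalar_index A E / scalar_index A G - 1) :: 'a)"
    unfolding k(3)[symmetric] by (rule E.E_npos[OF kA(1)])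
  moreover have "npos (of_real (scalar_index A G / scalar_index A E - 1) :: 'a)"
    unfolding k'(2)[symmetric] by (rule G.E_npos[OF kA(2)])
  ultimately have "scalar_index A E / scalar_index A G \<ge> 1" "scalar_index A G / scalar_index A E \<ge> 1"
    by (simp_all only: npos_of_real_iff diff_ge_0_iff_ge)
  then have "scalar_index A E = scalar_index A G"
    using E.Ind_scalar(2)[OF cA] G.Ind_scalar(2)[OF cA] by (simp add: field_simps)
  then have "E ((k - 1)\<^sup>\<star> * (k - 1)) = 0" using k(3) G.Ind_scalar(2)[OF cA] by simp
  then have "k = 1" using E.faithful[OF kA(1)] by simp
  then show ?thesis using k(2) x by simp
qed


section \<open>The basic construction\<close>

text \<open>
  \<open>act x a\<close> is the image of \<open>a \<in> A\<close> under the operator on the Hilbert module \<open>A\<close> that represents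
  \<open>x \<in> A1\<close>.
\<close>

locale jones = finite_index A B E n l
  for A B :: "'a::cstar_algebra set" and E :: "'a \<Rightarrow> 'a" and n :: nat and l :: "nat \<Rightarrow> 'a" +
  fixes A1 :: "'a set" and e :: 'a and act :: "'a \<Rightarrow> 'a \<Rightarrow> 'a"
  assumes A1: "cstar_subalgebra A1" and A_sub: "A \<subseteq> A1" and e_in: "e \<in> A1"
    and act_inj: "inj_on act A1"
    and act_operator: "x \<in> A1 \<Longrightarrow> act x \<in> module_operators A B E"
    and act_add_left: "x \<in> A1 \<Longrightarrow> y \<in> A1 \<Longrightarrow> a \<in> A \<Longrightarrow> act (x + y) a = act x a + act y a"
    and act_scaleC_left: "x \<in> A1 \<Longrightarrow> a \<in> A \<Longrightarrow> act (c *\<^sub>C x) a = c *\<^sub>C act x a"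
    and act_mult: "x \<in> A1 \<Longrightarrow> y \<in> A1 \<Longrightarrow> a \<in> A \<Longrightarrow> act (x * y) a = act x (act y a)"
    and act_adjoint: "x \<in> A1 \<Longrightarrow> a \<in> A \<Longrightarrow> b \<in> A \<Longrightarrow> E ((act x a)\<^sup>\<star> * b) = E (a\<^sup>\<star> * act (x\<^sup>\<star>) b)"
    and act_left_mult: "a \<in> A \<Longrightarrow> b \<in> A \<Longrightarrow> act a b = a * b"
    and act_e: "a \<in> A \<Longrightarrow> act e a = E a"
    and centre_A: "trivial_centre A" and centre_B: "trivial_centre B"
begin

lemmas A1_intros = subalgebra_intros[OF A1]

lemma A_in_A1: "x \<in> A \<Longrightarrow> x \<in> A1"
  using A_sub by blast

lemma act_in: "x \<in> A1 \<Longrightarrow> a \<in> A \<Longrightarrow> act x a \<in> A"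
  using act_operator[of x] by (auto simp: module_operators_def intro: PiE_mem)

lemma act_add_right: "x \<in> A1 \<Longrightarrow> a \<in> A \<Longrightarrow> b \<in> A \<Longrightarrow> act x (a + b) = act x a + act x b"
  using act_operator by (auto simp: module_operators_def)

lemma act_mult_B: "x \<in> A1 \<Longrightarrow> a \<in> A \<Longrightarrow> b \<in> B \<Longrightarrow> act x (a * b) = act x a * b"
  using act_operator by (auto simp: module_operators_def)

lemma act_zero_left: "a \<in> A \<Longrightarrow> act 0 a = 0"
  using act_scaleC_left[of 0 a 0] subalgebra_zero[OF A1] by simp

lemma act_sum_left:
  "finite I \<Longrightarrow> (\<And>i. i \<in> I \<Longrightarrow> f i \<in> A1) \<Longrightarrow> a \<in> A \<Longrightarrow> act (\<Sum>i\<in>I. f i) a = (\<Sum>i\<in>I. act (f i) a)"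
proof (induction I rule: finite_induct)
  case (insert i I)
  then have "act (f i + sum f I) a = act (f i) a + act (sum f I) a"
    by (intro act_add_left) (auto intro: subalgebra_sum[OF A1])
  then show ?case using insert by simp
qed (simp add: act_zero_left)

lemma act_zero_right: "x \<in> A1 \<Longrightarrow> act x 0 = 0"
  using act_add_right[of x 0 0] subalgebra_zero[OF A] by simp

lemma act_sum_right:
  "finite I \<Longrightarrow> x \<in> A1 \<Longrightarrow> (\<And>i. i \<in> I \<Longrightarrow> f i \<in> A) \<Longrightarrow> act x (\<Sum>i\<in>I. f i) = (\<Sum>i\<in>I. act x (f i))"
proof (induction I rule: finite_induct)
  case (insert i I)
  then have "act x (f i + sum f I) = act x (f i) + act x (sum f I)"
    by (intro act_add_right) (auto intro: subalgebra_sum[OF A])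
  then show ?case using insert by simp
qed (simp add: act_zero_right)

lemma act_eqI:
  assumes "x \<in> A1" "y \<in> A1" "\<And>a. a \<in> A \<Longrightarrow> act x a = act y a"
  shows "x = y"
proof -
  have "act x \<in> extensional A" "act y \<in> extensional A"
    using act_operator assms by (auto simp: module_operators_def PiE_def)
  then have "act x = act y" by (rule extensionalityI) (rule assms(3))
  then show ?thesis using act_inj assms by (auto dest: inj_onD)
qed

lemma e_idem: "e * e = e"
  by (rule act_eqI) (simp_all add: e_in A1_intros act_mult act_e E_in_A E_fix E_in)

lemma e_adj: "e\<^sup>\<star> = e"
proof (rule act_eqI)
  fix b assume b: "b \<in> A"
  have ea: "e\<^sup>\<star> \<in> A1" by (intro subalgebra_adj[OF A1] e_in)
  have "act (e\<^sup>\<star>) b - E b = 0"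
  proof (rule nondegenerate)
    show "act (e\<^sup>\<star>) b - E b \<in> A" by (intro subalgebra_diff[OF A] act_in ea E_in_A b)
    fix x assume x: "x \<in> A"
    then have xa: "x\<^sup>\<star> \<in> A" by (rule subalgebra_adj[OF A])
    have "E (x * act (e\<^sup>\<star>) b) = E ((act e (x\<^sup>\<star>))\<^sup>\<star> * b)"
      using act_adjoint[OF e_in xa b] by (simp add: adj_adj)
    also have "\<dots> = E (E x * b)" using x xa by (simp add: act_e E_adj adj_adj)
    also have "\<dots> = E x * E b" using x b by (simp add: E_left E_in)
    also have "\<dots> = E (x * E b)" using x b by (simp add: E_right E_in)
    finally show "E (x * (act (e\<^sup>\<star>) b - E b)) = 0"
      using x b ea by (simp add: right_diff_distrib E_diff A_intros act_in E_in_A)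
  qed
  then show "act (e\<^sup>\<star>) b = act e b" using b by (simp add: act_e)
qed (simp_all add: e_in A1_intros)

lemma e_compress:
  assumes x: "x \<in> A"
  shows "e * x * e = E x * e"
proof (rule act_eqI)
  fix a assume a: "a \<in> A"
  have "act (e * x * e) a = E (x * E a)"
    using x a by (simp add: act_mult A1_intros A_in_A1 e_in act_e act_left_mult E_in_A A_intros)
  also have "\<dots> = E x * E a" using x a by (simp add: E_right E_in)
  also have "\<dots> = act (E x * e) a"
    using x a by (simp add: act_mult A1_intros A_in_A1 e_in act_e act_left_mult E_in_A)
  finally show "act (e * x * e) a = act (E x * e) a" .
qed (use x in \<open>simp_all add: A1_intros A_in_A1 e_in E_in_A\<close>)

lemma e_commute_B:
  assumes b: "b \<in> B"
  shows "b * e = e * b"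
proof (rule act_eqI)
  show "act (b * e) a = act (e * b) a" if "a \<in> A" for a
    using b that B_in_A[OF b]
    by (simp add: act_mult A_in_A1 e_in act_e act_left_mult E_in_A A_intros E_left)
qed (use B_in_A[OF b] in \<open>simp_all add: A1_intros A_in_A1 e_in\<close>)

text \<open>
  The Jones projection maps into \<open>B\<close>, and \<open>x\<close> is \<open>B\<close>-linear.
\<close>

lemma push_down: "x \<in> A1 \<Longrightarrow> x * e = act x 1 * e"
proof (rule act_eqI)
  fix a assume x: "x \<in> A1" and a: "a \<in> A"
  have "act (x * e) a = act x (1 * E a)" using x a by (simp add: act_mult e_in act_e)
  also have "\<dots> = act x 1 * E a" by (rule act_mult_B[OF x subalgebra_one[OF A] E_in[OF a]])
  also have "\<dots> = act (act x 1 * e) a"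
    using x a by (simp add: act_mult e_in act_e act_left_mult E_in_A A_in_A1 act_in A_intros)
  finally show "act (x * e) a = act (act x 1 * e) a" .
qed (simp_all add: A1_intros A_in_A1 act_in e_in subalgebra_one[OF A])

text \<open>
  Hence \<open>A1\<close> is spanned by the elements \<open>x * e * y\<close> with \<open>x\<close>, \<open>y\<close> in \<open>A\<close>.
\<close>

lemma expand_operator:
  assumes x: "x \<in> A1"
  shows "(\<Sum>i<n. act x (l i) * e * (l i)\<^sup>\<star>) = x"
proof (rule act_eqI[OF _ x])
  have summand: "act x (l i) * e * (l i)\<^sup>\<star> \<in> A1" if "i < n" for i
    using x that by (simp add: A1_intros A_in_A1 act_in l_in l_adj_in e_in)
  then show "(\<Sum>i<n. act x (l i) * e * (l i)\<^sup>\<star>) \<in> A1" by (intro subalgebra_sum[OF A1]) auto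
  fix a assume a: "a \<in> A"
  have "act (\<Sum>i<n. act x (l i) * e * (l i)\<^sup>\<star>) a = (\<Sum>i<n. act (act x (l i) * e * (l i)\<^sup>\<star>) a)"
    using summand a by (intro act_sum_left) auto
  also have "\<dots> = (\<Sum>i<n. act x (l i * E ((l i)\<^sup>\<star> * a)))"
  proof (rule sum.cong[OF refl])
    fix i assume "i \<in> {..<n}"
    then have i: "l i \<in> A" "(l i)\<^sup>\<star> \<in> A" by (auto simp: l_in l_adj_in)
    have la: "(l i)\<^sup>\<star> * a \<in> A" by (intro subalgebra_mult[OF A] i a)
    have "act (act x (l i) * e * (l i)\<^sup>\<star>) a = act x (l i) * E ((l i)\<^sup>\<star> * a)"
      using x i a la by (simp add: act_mult A1_intros A_in_A1 act_in e_in act_left_mult act_e E_in_A)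
    also have "\<dots> = act x (l i * E ((l i)\<^sup>\<star> * a))"
      by (rule act_mult_B[OF x i(1) E_in[OF la], symmetric])
    finally show "act (act x (l i) * e * (l i)\<^sup>\<star>) a = act x (l i * E ((l i)\<^sup>\<star> * a))" .
  qed
  also have "\<dots> = act x (\<Sum>i<n. l i * E ((l i)\<^sup>\<star> * a))"
    using x a by (intro act_sum_right[symmetric]) (auto intro!: A_intros l_in E_in_A)
  also have "\<dots> = act x a" by (simp only: expand_left[OF a])
  finally show "act (\<Sum>i<n. act x (l i) * e * (l i)\<^sup>\<star>) a = act x a" .
qed

lemma act_one: "a \<in> A \<Longrightarrow> act 1 a = a"
  using act_left_mult[OF subalgebra_one[OF A]] by simp

lemma sum_l_e_l: "(\<Sum>i<n. l i * e * (l i)\<^sup>\<star>) = 1"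
proof -
  have "(\<Sum>i<n. l i * e * (l i)\<^sup>\<star>) = (\<Sum>i<n. act 1 (l i) * e * (l i)\<^sup>\<star>)"
    by (rule sum.cong) (simp_all add: act_one l_in)
  also have "\<dots> = 1" by (rule expand_operator[OF subalgebra_one[OF A1]])
  finally show ?thesis .
qed

text \<open>
  An operator that commutes with all left multiplications is right multiplication by an element of
  the relative commutant of \<open>B\<close>.
\<close>

lemma commutant_act:
  assumes x: "x \<in> rel_commutant A A1"
  shows "act x 1 \<in> rel_commutant B A" "\<And>a. a \<in> A \<Longrightarrow> act x a = a * act x 1"
proof -
  have xA1: "x \<in> A1" and comm: "\<And>a. a \<in> A \<Longrightarrow> a * x = x * a" using x by (auto simp: rel_commutant_def)
  have one: "1 \<in> A" by (rule subalgebra_one[OF A])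
  show right: "act x a = a * act x 1" if a: "a \<in> A" for a
  proof -
    have "act x a = act x (act a 1)" using a one by (simp add: act_left_mult)
    also have "\<dots> = act (a * x) 1" using act_mult[OF xA1 A_in_A1[OF a] one] comm[OF a] by simp
    also have "\<dots> = a * act x 1"
      using a xA1 one by (simp add: act_mult A_in_A1 act_left_mult act_in)
    finally show ?thesis .
  qed
  have "b * act x 1 = act x 1 * b" if b: "b \<in> B" for b
    using act_mult_B[OF xA1 one b] right[OF B_in_A[OF b]] by simp
  then show "act x 1 \<in> rel_commutant B A" using act_in[OF xA1 one] by (simp add: rel_commutant_def)
qed

lemma E_commutant_scalar:
  assumes "t \<in> rel_commutant B A"
  obtains c where "E t = c *\<^sub>C 1"
  using E_rel_commutant[OF assms] centre_B by (auto simp: trivial_centre_def)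

text \<open>
  A central \<open>x\<close> is right multiplication by \<open>t = act x 1\<close>. It commutes with \<open>e\<close>, which gives \<open>E t = t\<close>, so
  \<open>t\<close> lies in the centre of \<open>B\<close>.
\<close>

lemma trivial_centre_A1: "trivial_centre A1"
  unfolding trivial_centre_def
proof
  fix x assume x: "x \<in> rel_commutant A1 A1"
  then have xA1: "x \<in> A1" and ex: "e * x = x * e" using e_in by (auto simp: rel_commutant_def)
  have one: "1 \<in> A" by (rule subalgebra_one[OF A])
  have "x \<in> rel_commutant A A1" using x A_sub by (auto simp: rel_commutant_def)
  note t = commutant_act[OF this]
  have "E (act x 1) = act (e * x) 1"
    using one xA1 by (simp add: act_mult e_in act_in act_e)
  also have "\<dots> = act x 1"
    unfolding ex using one xA1 by (simp add: act_mult e_in act_e E_one)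
  finally have "E (act x 1) = act x 1" .
  then obtain c where c: "act x 1 = c *\<^sub>C 1" using E_commutant_scalar[OF t(1)] by metis
  have "x = c *\<^sub>C 1"
  proof (rule act_eqI[OF xA1])
    show "act x a = act (c *\<^sub>C 1) a" if a: "a \<in> A" for a
      using t(2)[OF a] a one
      by (simp add: c mult_scaleC_right act_scaleC_left subalgebra_one[OF A1] act_one)
  qed (simp add: A1_intros)
  then show "x \<in> range (\<lambda>c. c *\<^sub>C 1)" by blast
qed

definition \<tau> :: real where
  "\<tau> = inverse (scalar_index A E)"

lemma \<tau>_pos: "\<tau> > 0"
  using Ind_scalar(2)[OF centre_A] by (simp add: \<tau>_def)

text \<open>
  The dual conditional expectation. By \<open>expand_operator\<close> it is the only linear map with
  \<open>x e y \<mapsto> \<tau> x y\<close>.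
\<close>

definition dual :: "'a \<Rightarrow> 'a" where
  "dual x = \<tau> *\<^sub>R (\<Sum>i<n. act x (l i) * (l i)\<^sup>\<star>)"

lemma dual_e:
  assumes "x \<in> A" "y \<in> A"
  shows "dual (x * e * y) = \<tau> *\<^sub>R (x * y)"
proof -
  have "(\<Sum>i<n. act (x * e * y) (l i) * (l i)\<^sup>\<star>) = (\<Sum>i<n. x * (E (y * l i) * (l i)\<^sup>\<star>))"
    by (rule sum.cong)
       (use assms in \<open>simp_all add: act_mult A1_intros A_in_A1 e_in act_left_mult act_e l_in A_intros E_in_A mult.assoc\<close>)
  also have "\<dots> = x * y" by (simp only: expand_right[OF assms(2)] flip: sum_distrib_left)
  finally show ?thesis by (simp add: dual_def)
qed

lemma dual_push_down:
  assumes x: "x \<in> A1"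
  shows "dual (x * e) * e = \<tau> *\<^sub>R (x * e)"
proof -
  have one: "1 \<in> A" by (rule subalgebra_one[OF A])
  have "dual (x * e) = \<tau> *\<^sub>R act x 1"
    using dual_e[OF act_in[OF x one] one] push_down[OF x] by simp
  then show ?thesis using push_down[OF x] by simp
qed

text \<open>
  This form makes positivity on \<open>x\<^sup>\<star> * x\<close> visible and gives linearity over \<open>A\<close> from the right.
\<close>

lemma dual_mult:
  assumes x: "x \<in> A1" and y: "y \<in> A1"
  shows "dual (x * y) = \<tau> *\<^sub>R (\<Sum>j<n. act x (l j) * (act (y\<^sup>\<star>) (l j))\<^sup>\<star>)"
proof -
  have ya: "y\<^sup>\<star> \<in> A1" by (rule subalgebra_adj[OF A1 y])
  define w where "w j = (act (y\<^sup>\<star>) (l j))\<^sup>\<star>" for j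
  have w: "w j \<in> A" if "j < n" for j
    unfolding w_def by (intro subalgebra_adj[OF A] act_in ya l_in that)
  have "act (x * y) (l i) = (\<Sum>j<n. act x (l j) * E (w j * l i))" if i: "i < n" for i
  proof -
    have yl: "act y (l i) \<in> A" by (intro act_in y l_in i)
    have "act (x * y) (l i) = act x (\<Sum>j<n. l j * E ((l j)\<^sup>\<star> * act y (l i)))"
      using act_mult[OF x y l_in[OF i]] by (simp only: expand_left[OF yl])
    also have "\<dots> = (\<Sum>j<n. act x (l j * E ((l j)\<^sup>\<star> * act y (l i))))"
      using yl by (intro act_sum_right x) (auto intro!: A_intros l_in E_in_A)
    also have "\<dots> = (\<Sum>j<n. act x (l j) * E (w j * l i))"
    proof (rule sum.cong[OF refl])
      fix j assume "j \<in> {..<n}"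
      then have j: "j < n" by simp
      have "E ((l j)\<^sup>\<star> * act y (l i)) = E (w j * l i)"
        using act_adjoint[OF ya l_in[OF j] l_in[OF i]] by (simp add: w_def adj_adj)
      moreover have "E (w j * l i) \<in> B" by (intro E_in subalgebra_mult[OF A] w l_in i j)
      ultimately show "act x (l j * E ((l j)\<^sup>\<star> * act y (l i))) = act x (l j) * E (w j * l i)"
        using act_mult_B[OF x l_in[OF j]] by simp
    qed
    finally show ?thesis .
  qed
  then have "(\<Sum>i<n. act (x * y) (l i) * (l i)\<^sup>\<star>) = (\<Sum>i<n. \<Sum>j<n. act x (l j) * (E (w j * l i) * (l i)\<^sup>\<star>))"
    by (intro sum.cong refl) (simp add: sum_distrib_right mult.assoc)
  also have "\<dots> = (\<Sum>j<n. \<Sum>i<n. act x (l j) * (E (w j * l i) * (l i)\<^sup>\<star>))" by (rule sum.swap)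
  also have "\<dots> = (\<Sum>j<n. act x (l j) * w j)"
    by (rule sum.cong) (simp_all add: expand_right w flip: sum_distrib_left)
  finally show ?thesis by (simp add: dual_def w_def)
qed

lemma index_map_one: "index_map 1 = of_real (scalar_index A E)"
  by (rule Ind_scalar(1)[OF centre_A])

lemma dual_fix: "a \<in> A \<Longrightarrow> dual a = a"
proof -
  assume a: "a \<in> A"
  have "(\<Sum>i<n. act a (l i) * (l i)\<^sup>\<star>) = (\<Sum>i<n. a * (l i * 1 * (l i)\<^sup>\<star>))"
    by (rule sum.cong) (simp_all add: act_left_mult a l_in mult.assoc)
  also have "\<dots> = a * index_map 1" by (simp add: index_map_def sum_distrib_left)
  finally show ?thesis
    using Ind_scalar(2)[OF centre_A] by (simp add: dual_def \<tau>_def index_map_one of_real_def)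
qed

sublocale D: expectation A1 A dual
proof
  show "dual x \<in> A" if "x \<in> A1" for x
    unfolding dual_def using that by (auto intro!: A_intros act_in l_in)
  show "dual (x + y) = dual x + dual y" if "x \<in> A1" "y \<in> A1" for x y
    using that by (simp add: dual_def act_add_left l_in distrib_right sum.distrib scaleR_add_right)
  show "dual (c *\<^sub>C x) = c *\<^sub>C dual x" if "x \<in> A1" for c x
    using that by (simp add: dual_def act_scaleC_left l_in mult_scaleC_left scaleC_scaleR flip: scaleC_sum_right)
  show "npos (dual (x\<^sup>\<star> * x))" if x: "x \<in> A1" for x
  proof -
    have "npos (\<tau> *\<^sub>R (\<Sum>j<n. ((act (x\<^sup>\<star>) (l j))\<^sup>\<star>)\<^sup>\<star> * (act (x\<^sup>\<star>) (l j))\<^sup>\<star>))"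
      using \<tau>_pos by (intro npos_scaleR npos_sum npos_adj_mult) auto
    then show ?thesis by (simp add: dual_mult x A1_intros adj_adj)
  qed
  show "dual (b * x) = b * dual x" if "b \<in> A" "x \<in> A1" for b x
    using that by (simp add: dual_def act_mult A_in_A1 l_in act_in act_left_mult mult.assoc sum_distrib_left)
  show "dual (x * b) = dual x * b" if b: "b \<in> A" and x: "x \<in> A1" for b x
  proof -
    have "(\<Sum>j<n. act x (l j) * (act (b\<^sup>\<star>) (l j))\<^sup>\<star>) = (\<Sum>j<n. act x (l j) * (l j)\<^sup>\<star> * b)"
      by (rule sum.cong)
         (use b in \<open>simp_all add: act_left_mult A_intros l_in adj_mult adj_adj mult.assoc\<close>)
    then show ?thesis
      unfolding dual_mult[OF x A_in_A1[OF b]] by (simp add: dual_def sum_distrib_right)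
  qed
qed (use A1 A A_sub dual_fix in auto)

lemma dual_pull_up:
  assumes x: "x \<in> A1"
  shows "e * dual (e * x) = \<tau> *\<^sub>R (e * x)"
proof -
  have xa: "x\<^sup>\<star> \<in> A1" by (rule subalgebra_adj[OF A1 x])
  have "e * dual (e * x) = (dual (x\<^sup>\<star> * e) * e)\<^sup>\<star>"
    using D.E_adj[OF subalgebra_mult[OF A1 xa e_in]] by (simp add: adj_mult adj_adj e_adj)
  also have "\<dots> = (\<tau> *\<^sub>R (x\<^sup>\<star> * e))\<^sup>\<star>" by (simp only: dual_push_down[OF xa])
  also have "\<dots> = \<tau> *\<^sub>R (e * x)" by (simp add: adj_scaleR adj_mult adj_adj e_adj)
  finally show ?thesis .
qed

text \<open>The square root compensates the factor \<open>\<tau>\<close> in \<open>dual_push_down\<close> and \<open>dual_pull_up\<close>.\<close>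

definition dual_basis :: "nat \<Rightarrow> 'a" where
  "dual_basis i = sqrt (scalar_index A E) *\<^sub>R (l i * e)"

sublocale D: finite_index A1 A dual n dual_basis
proof
  define c where "c = scalar_index A E"
  have c: "c > 0" "c * \<tau> = 1" using Ind_scalar(2)[OF centre_A] by (auto simp: c_def \<tau>_def)
  have le: "l i * e \<in> A1" if "i < n" for i using that by (simp add: A1_intros A_in_A1 l_in e_in)
  show "quasi_basis A1 dual n dual_basis"
    unfolding quasi_basis_def
  proof (intro conjI ballI allI impI)
    show "dual_basis i \<in> A1" if "i < n" for i
      unfolding dual_basis_def by (intro subalgebra_scaleR[OF A1] le that)
    fix x assume x: "x \<in> A1"
    have "(\<Sum>i<n. dual_basis i * dual ((dual_basis i)\<^sup>\<star> * x)) = (\<Sum>i<n. l i * e * (l i)\<^sup>\<star> * x)"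
    proof (rule sum.cong[OF refl])
      fix i assume "i \<in> {..<n}"
      then have "(l i)\<^sup>\<star> * x \<in> A1" using x by (simp add: A1_intros A_in_A1 l_adj_in)
      note lx = this subalgebra_mult[OF A1 e_in this]
      have "dual_basis i * dual ((dual_basis i)\<^sup>\<star> * x) = c *\<^sub>R (l i * (e * dual (e * ((l i)\<^sup>\<star> * x))))"
        using c(1) lx by (simp add: dual_basis_def c_def adj_scaleR adj_mult e_adj D.E_scaleR mult.assoc)
      also have "\<dots> = l i * e * (l i)\<^sup>\<star> * x"
        using c(2) by (simp add: dual_pull_up[OF lx(1)] mult.assoc)
      finally show "dual_basis i * dual ((dual_basis i)\<^sup>\<star> * x) = l i * e * (l i)\<^sup>\<star> * x" .
    qed
    also have "\<dots> = x" by (simp add: sum_l_e_l flip: sum_distrib_right)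
    finally show "x = (\<Sum>i<n. dual_basis i * dual ((dual_basis i)\<^sup>\<star> * x))" by (rule sym)
    have "(\<Sum>i<n. dual (x * dual_basis i) * (dual_basis i)\<^sup>\<star>) = (\<Sum>i<n. x * (l i * e * (l i)\<^sup>\<star>))"
    proof (rule sum.cong[OF refl])
      fix i assume "i \<in> {..<n}"
      then have "x * l i \<in> A1" using x by (simp add: A1_intros A_in_A1 l_in)
      note xl = this subalgebra_mult[OF A1 this e_in]
      have "dual (x * dual_basis i) * (dual_basis i)\<^sup>\<star> = c *\<^sub>R (dual (x * l i * e) * e * (l i)\<^sup>\<star>)"
        using c(1) xl by (simp add: dual_basis_def c_def adj_scaleR adj_mult e_adj D.E_scaleR mult.assoc)
      also have "\<dots> = x * (l i * e * (l i)\<^sup>\<star>)"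
        unfolding dual_push_down[OF xl(1)] using c(2) by (simp add: mult.assoc)
      finally show "dual (x * dual_basis i) * (dual_basis i)\<^sup>\<star> = x * (l i * e * (l i)\<^sup>\<star>)" .
    qed
    also have "\<dots> = x" by (simp add: sum_l_e_l flip: sum_distrib_left)
    finally show "x = (\<Sum>i<n. dual (x * dual_basis i) * (dual_basis i)\<^sup>\<star>)" by (rule sym)
  qed
qed

lemma dual_index_map: "D.index_map y = scalar_index A E *\<^sub>R (\<Sum>i<n. l i * (e * y * e) * (l i)\<^sup>\<star>)"
  unfolding D.index_map_def scaleR_sum_right
  using Ind_scalar(2)[OF centre_A]
  by (intro sum.cong refl) (simp add: dual_basis_def adj_scaleR adj_mult e_adj mult.assoc)

lemma scalar_index_dual: "scalar_index A1 dual = scalar_index A E"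
proof (rule D.scalar_index_eq)
  show "Ind A1 dual = of_real (scalar_index A E)"
    unfolding D.Ind_eq dual_index_map by (simp add: e_idem sum_l_e_l of_real_def)
qed

text \<open>
  On a commuting operator \<open>x\<close>, which is right multiplication by some \<open>t\<close>, the index map of the dual
  expectation is essentially \<open>E t\<close> and the dual expectation itself is essentially \<open>index_map t\<close>: the
  two sides of the balance condition are exchanged.
\<close>

lemma dual_balanced:
  assumes bal: balanced
  shows "D.balanced"
  unfolding D.balanced_def
proof
  fix x assume x: "x \<in> rel_commutant A A1"
  then have xA1: "x \<in> A1" by (simp add: rel_commutant_def)
  note t = commutant_act[OF x]
  let ?t = "act x 1"
  have tA: "?t \<in> A" using t(1) by (simp add: rel_commutant_def)
  obtain c where c: "E ?t = c *\<^sub>C 1" by (rule E_commutant_scalar[OF t(1)])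
  have "e * x * e = e * (x * e)" by (rule mult.assoc)
  also have "\<dots> = e * ?t * e" unfolding push_down[OF xA1] by (rule mult.assoc[symmetric])
  also have "\<dots> = c *\<^sub>C e" unfolding e_compress[OF tA] c by (simp add: mult_scaleC_left)
  finally have "D.index_map x = scalar_index A E *\<^sub>R (c *\<^sub>C 1)"
    unfolding dual_index_map
    by (simp add: mult_scaleC_left mult_scaleC_right sum_l_e_l flip: scaleC_sum_right)
  moreover have "dual x = E ?t"
  proof -
    have "dual x = \<tau> *\<^sub>R (\<Sum>i<n. l i * ?t * (l i)\<^sup>\<star>)"
      unfolding dual_def by (intro arg_cong[where f = "scaleR \<tau>"] sum.cong refl) (simp add: t(2)[symmetric] l_in)
    also have "\<dots> = \<tau> *\<^sub>R (scalar_index A E *\<^sub>R E ?t)"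
      using bal t(1) by (simp add: balanced_def flip: index_map_def)
    also have "\<dots> = E ?t" using Ind_scalar(2)[OF centre_A] by (simp add: \<tau>_def)
    finally show ?thesis .
  qed
  ultimately show "D.index_map x = scalar_index A1 dual *\<^sub>R dual x"
    by (simp add: scalar_index_dual c)
qed

text \<open>
  Minimal conditional expectations are balanced, so is the dual one, and balanced ones are unique.
\<close>

lemma minimal_eq_dual:
  assumes bal: balanced and F: "minimal_expectation A1 A F" and x: "x \<in> A1"
  shows "F x = dual x"
proof -
  obtain m j where m: "quasi_basis A1 F m j" and "cond_expectation A1 A F"
    using F by (auto simp: minimal_expectation_def finite_index_expectation_def)
  then interpret F: expectation A1 A F by (intro expectationI A1 A A_sub)
  interpret F: finite_index A1 A F m j by unfold_locales (rule m)
  have "F.balanced" by (rule F.minimal_balanced[OF F trivial_centre_A1 centre_A])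
  then show ?thesis
    by (intro balanced_unique[OF D.finite_index_axioms F.finite_index_axioms dual_balanced[OF bal]]
        trivial_centre_A1 x)
qed

lemma minimal_index:
  assumes bal: balanced and F: "minimal_expectation A1 A F"
  shows "scalar_index A1 F = scalar_index A E"
proof -
  note eq = minimal_eq_dual[OF bal F]
  have "quasi_basis A1 F n dual_basis"
    unfolding quasi_basis_def
  proof (intro conjI ballI allI impI)
    fix x assume x: "x \<in> A1"
    have "(\<Sum>i<n. dual_basis i * F ((dual_basis i)\<^sup>\<star> * x)) = (\<Sum>i<n. dual_basis i * dual ((dual_basis i)\<^sup>\<star> * x))"
      by (rule sum.cong) (simp_all add: eq D.l_adj_in A1_intros x)
    then show "x = (\<Sum>i<n. dual_basis i * F ((dual_basis i)\<^sup>\<star> * x))" by (simp only: D.expand_left[OF x])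
    have "(\<Sum>i<n. F (x * dual_basis i) * (dual_basis i)\<^sup>\<star>) = (\<Sum>i<n. dual (x * dual_basis i) * (dual_basis i)\<^sup>\<star>)"
      by (rule sum.cong) (simp_all add: eq D.l_in A1_intros x)
    then show "x = (\<Sum>i<n. F (x * dual_basis i) * (dual_basis i)\<^sup>\<star>)" by (simp only: D.expand_right[OF x])
  qed (rule D.l_in)
  moreover have "cond_expectation A1 A F"
    using F by (auto simp: minimal_expectation_def finite_index_expectation_def)
  ultimately interpret F: finite_index A1 A F n dual_basis
    by (auto simp: finite_index_def finite_index_axioms_def intro!: expectationI A1 A A_sub)
  have "Ind A1 F = Ind A1 dual" unfolding F.Ind_eq D.Ind_eq F.index_map_def D.index_map_def ..
  then show ?thesis using scalar_index_dual by (simp add: scalar_index_def)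
qed

end

lemma jones_of_basic_construction:
  assumes "finite_index A B E n l" and bc: "basic_construction A B E A1 e"
    and "trivial_centre A" "trivial_centre B"
  obtains act where "jones A B E n l A1 e act"
proof -
  interpret finite_index A B E n l by fact
  obtain act where bij: "bij_betw act A1 (operator_basic_construction A B E)"
    and add: "\<forall>x\<in>A1. \<forall>y\<in>A1. act (x + y) = (\<lambda>a\<in>A. act x a + act y a)"
    and scale: "\<forall>x\<in>A1. \<forall>c. act (c *\<^sub>C x) = (\<lambda>a\<in>A. c *\<^sub>C act x a)"
    and mult: "\<forall>x\<in>A1. \<forall>y\<in>A1. act (x * y) = compose A (act x) (act y)"
    and adj: "\<forall>x\<in>A1. module_adjoint A E (act x) (act (x\<^sup>\<star>))"
    and left: "\<forall>a\<in>A. act a = left_mult A a" and e: "act e = restrict E A"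
    using bc unfolding basic_construction_def by blast
  have "jones A B E n l A1 e act"
  proof
    show "cstar_subalgebra A1" "A \<subseteq> A1" "e \<in> A1" using bc by (auto simp: basic_construction_def)
    show "inj_on act A1" using bij by (rule bij_betw_imp_inj_on)
    show "act x \<in> module_operators A B E" if "x \<in> A1" for x
      using bij_betw_apply[OF bij that] by (simp add: operator_basic_construction_def)
  qed (use add scale mult adj left e assms in
      \<open>simp_all add: compose_def left_mult_def module_adjoint_def\<close>)
  then show ?thesis by (rule that)
qed


section \<open>The tower\<close>

locale tower =
  fixes B :: "'a::cstar_algebra set" and A :: "nat \<Rightarrow> 'a set"
    and E :: "nat \<Rightarrow> 'a \<Rightarrow> 'a" and e :: "nat \<Rightarrow> 'a"
  assumes simple_B: "simple_cstar_subalgebra B"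
    and simple_A: "simple_cstar_subalgebra (A 0)"
    and inclusion: "B \<subseteq> A 0"
    and tower: "basic_construction_tower B A E e"
begin

lemma minimal: "minimal_expectation (A k) (below B A k) (E k)"
  and basic: "basic_construction (A k) (below B A k) (E k) (A (Suc k)) (e (Suc k))"
  using tower by (auto simp: basic_construction_tower_def)

lemma below_0 [simp]: "below B A 0 = B" and below_Suc [simp]: "below B A (Suc k) = A k"
  by (simp_all add: below_def)

lemma level_construct:
  assumes "cstar_subalgebra (A k)" "cstar_subalgebra (below B A k)" "below B A k \<subseteq> A k"
    and centres: "trivial_centre (A k)" "trivial_centre (below B A k)"
  obtains n l act where "jones (A k) (below B A k) (E k) n l (A (Suc k)) (e (Suc k)) act"
    "finite_index.balanced (A k) (below B A k) (E k) n l"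
proof -
  obtain n l where q: "quasi_basis (A k) (E k) n l" and "cond_expectation (A k) (below B A k) (E k)"
    using minimal[of k] by (auto simp: minimal_expectation_def finite_index_expectation_def)
  then have "expectation (A k) (below B A k) (E k)" by (intro expectationI assms)
  then interpret finite_index "A k" "below B A k" "E k" n l
    using q by (intro finite_index.intro finite_index_axioms.intro)
  obtain act where "jones (A k) (below B A k) (E k) n l (A (Suc k)) (e (Suc k)) act"
    by (rule jones_of_basic_construction[OF finite_index_axioms basic centres])
  then show ?thesis using that minimal_balanced[OF minimal centres] by blast
qed

text \<open>
  Triviality of the centres, the balance condition and the value of the index all pass from one
  inclusion of the tower to the next.
\<close>

lemma level:
  "\<exists>n l act. jones (A k) (below B A k) (E k) n l (A (Suc k)) (e (Suc k)) act \<and>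
     finite_index.balanced (A k) (below B A k) (E k) n l \<and>
     scalar_index (A k) (E k) = scalar_index (A 0) (E 0)"
proof (induction k)
  case 0
  obtain n l act where "jones (A 0) (below B A 0) (E 0) n l (A (Suc 0)) (e (Suc 0)) act"
    "finite_index.balanced (A 0) (below B A 0) (E 0) n l"
    by (rule level_construct[of 0])
       (use simple_A simple_B inclusion simple_trivial_centre in \<open>simp_all add: simple_cstar_subalgebra_def\<close>)
  then show ?case by blast
next
  case (Suc k)
  then obtain n l act where J: "jones (A k) (below B A k) (E k) n l (A (Suc k)) (e (Suc k)) act"
    and bal: "finite_index.balanced (A k) (below B A k) (E k) n l"
    and ind: "scalar_index (A k) (E k) = scalar_index (A 0) (E 0)" by blast
  interpret J: jones "A k" "below B A k" "E k" n l "A (Suc k)" "e (Suc k)" act by (rule J)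
  have "scalar_index (A (Suc k)) (E (Suc k)) = scalar_index (A 0) (E 0)"
    using J.minimal_index[OF bal] minimal[of "Suc k"] ind by simp
  moreover obtain n' l' act' where
    "jones (A (Suc k)) (below B A (Suc k)) (E (Suc k)) n' l' (A (Suc (Suc k))) (e (Suc (Suc k))) act'"
    "finite_index.balanced (A (Suc k)) (below B A (Suc k)) (E (Suc k)) n' l'"
    by (rule level_construct[of "Suc k"])
       (use J.A1 J.A J.A_sub J.trivial_centre_A1 J.centre_A in simp_all)
  ultimately show ?case by blast
qed

definition \<tau> :: real where
  "\<tau> = tower_tau A E"

lemma level_obtain:
  obtains n l act where "jones (A k) (below B A k) (E k) n l (A (Suc k)) (e (Suc k)) act"
    "jones.\<tau> (A k) (E k) = \<tau>"
    "\<forall>x\<in>A (Suc k). E (Suc k) x = jones.dual (A k) (E k) n l act x"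
proof -
  obtain n l act where J: "jones (A k) (below B A k) (E k) n l (A (Suc k)) (e (Suc k)) act"
    and bal: "finite_index.balanced (A k) (below B A k) (E k) n l"
    and ind: "scalar_index (A k) (E k) = scalar_index (A 0) (E 0)" using level by blast
  interpret J: jones "A k" "below B A k" "E k" n l "A (Suc k)" "e (Suc k)" act by (rule J)
  show ?thesis
    by (rule that[OF J])
       (use J.minimal_eq_dual[OF bal, of "E (Suc k)"] minimal[of "Suc k"] in
        \<open>simp_all add: J.\<tau>_def \<tau>_def tower_tau_def ind\<close>)
qed

lemma A_subalgebra: "cstar_subalgebra (A k)"
proof -
  obtain n l act where "jones (A k) (below B A k) (E k) n l (A (Suc k)) (e (Suc k)) act"
    by (rule level_obtain)
  then interpret J: jones "A k" "below B A k" "E k" n l "A (Suc k)" "e (Suc k)" act .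
  show ?thesis by (rule J.A)
qed

lemma expectation: "expectation (A k) (below B A k) (E k)"
proof -
  obtain n l act where "jones (A k) (below B A k) (E k) n l (A (Suc k)) (e (Suc k)) act"
    by (rule level_obtain)
  then interpret J: jones "A k" "below B A k" "E k" n l "A (Suc k)" "e (Suc k)" act .
  show ?thesis by (rule J.expectation_axioms)
qed

lemma E_faithful: "x \<in> A k \<Longrightarrow> E k (x\<^sup>\<star> * x) = 0 \<Longrightarrow> x = 0"
proof -
  obtain n l act where "jones (A k) (below B A k) (E k) n l (A (Suc k)) (e (Suc k)) act"
    by (rule level_obtain)
  then interpret J: jones "A k" "below B A k" "E k" n l "A (Suc k)" "e (Suc k)" act .
  show "x \<in> A k \<Longrightarrow> E k (x\<^sup>\<star> * x) = 0 \<Longrightarrow> x = 0" by (rule J.faithful)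
qed

lemma A_Suc_mono: "A k \<subseteq> A (Suc k)"
  using basic[of k] by (simp add: basic_construction_def)

lemma A_0_sub: "x \<in> A 0 \<Longrightarrow> x \<in> A k"
  by (induction k) (use A_Suc_mono in auto)

lemma B_sub: "b \<in> B \<Longrightarrow> b \<in> A k"
  using inclusion A_0_sub by blast

lemma B_below: "b \<in> B \<Longrightarrow> b \<in> below B A k"
  by (cases k) (auto intro: B_sub)

lemma e_in: "e (Suc k) \<in> A (Suc k)"
  using basic[of k] by (simp add: basic_construction_def)

lemma \<tau>_pos: "\<tau> > 0"
proof -
  obtain n l act where "jones (A 0) (below B A 0) (E 0) n l (A (Suc 0)) (e (Suc 0)) act"
    "jones.\<tau> (A 0) (E 0) = \<tau>"
    by (rule level_obtain)
  then interpret J: jones "A 0" "below B A 0" "E 0" n l "A (Suc 0)" "e (Suc 0)" act by simp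
  show ?thesis using J.\<tau>_pos \<open>J.\<tau> = \<tau>\<close> by simp
qed

lemma e_idem: "e (Suc k) * e (Suc k) = e (Suc k)"
  and e_compress: "x \<in> A k \<Longrightarrow> e (Suc k) * x * e (Suc k) = E k x * e (Suc k)"
  and e_commute: "b \<in> below B A k \<Longrightarrow> b * e (Suc k) = e (Suc k) * b"
  and E_e: "x \<in> A k \<Longrightarrow> y \<in> A k \<Longrightarrow> E (Suc k) (x * e (Suc k) * y) = \<tau> *\<^sub>R (x * y)"
  and push_down: "z \<in> A (Suc k) \<Longrightarrow> E (Suc k) (z * e (Suc k)) * e (Suc k) = \<tau> *\<^sub>R (z * e (Suc k))"
  and pull_up: "z \<in> A (Suc k) \<Longrightarrow> e (Suc k) * E (Suc k) (e (Suc k) * z) = \<tau> *\<^sub>R (e (Suc k) * z)"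
proof -
  obtain n l act where J: "jones (A k) (below B A k) (E k) n l (A (Suc k)) (e (Suc k)) act"
    "jones.\<tau> (A k) (E k) = \<tau>"
    "\<forall>x\<in>A (Suc k). E (Suc k) x = jones.dual (A k) (E k) n l act x"
    by (rule level_obtain)
  interpret J: jones "A k" "below B A k" "E k" n l "A (Suc k)" "e (Suc k)" act by (rule J)
  show "e (Suc k) * e (Suc k) = e (Suc k)" by (rule J.e_idem)
  show "x \<in> A k \<Longrightarrow> e (Suc k) * x * e (Suc k) = E k x * e (Suc k)" by (rule J.e_compress)
  show "b \<in> below B A k \<Longrightarrow> b * e (Suc k) = e (Suc k) * b" by (rule J.e_commute_B)
  show "x \<in> A k \<Longrightarrow> y \<in> A k \<Longrightarrow> E (Suc k) (x * e (Suc k) * y) = \<tau> *\<^sub>R (x * y)"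
    by (simp add: J.A1_intros J.A_in_A1 J.e_in J(3) J.dual_e J(2))
  show "z \<in> A (Suc k) \<Longrightarrow> E (Suc k) (z * e (Suc k)) * e (Suc k) = \<tau> *\<^sub>R (z * e (Suc k))"
    by (simp add: J.A1_intros J.e_in J(3) J.dual_push_down J(2))
  show "z \<in> A (Suc k) \<Longrightarrow> e (Suc k) * E (Suc k) (e (Suc k) * z) = \<tau> *\<^sub>R (e (Suc k) * z)"
    by (simp add: J.A1_intros J.e_in J(3) J.dual_pull_up J(2))
qed

lemma E_Jones: "E (Suc k) (e (Suc k)) = of_real \<tau>"
  using E_e[of 1 k 1] subalgebra_one[OF A_subalgebra] by (simp add: of_real_def)

lemma Temperley_Lieb_down: "e (Suc (Suc k)) * e (Suc k) * e (Suc (Suc k)) = \<tau> *\<^sub>R e (Suc (Suc k))"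
  using e_compress[OF e_in, of k] by (simp add: E_Jones of_real_def)

text \<open>As an operator on \<open>A (Suc k)\<close> the left-hand side maps \<open>x\<close> to \<open>e (Suc k) * E (Suc k) (e (Suc k) * x)\<close>.\<close>

lemma Temperley_Lieb_up: "e (Suc k) * e (Suc (Suc k)) * e (Suc k) = \<tau> *\<^sub>R e (Suc k)"
proof -
  obtain n l act where
    "jones (A (Suc k)) (below B A (Suc k)) (E (Suc k)) n l (A (Suc (Suc k))) (e (Suc (Suc k))) act"
    by (rule level_obtain)
  then interpret J: jones "A (Suc k)" "below B A (Suc k)" "E (Suc k)" n l
    "A (Suc (Suc k))" "e (Suc (Suc k))" act .
  note ek = e_in[of k]
  show ?thesis
  proof (rule J.act_eqI)
    fix x assume x: "x \<in> A (Suc k)"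
    have ex: "e (Suc k) * x \<in> A (Suc k)" by (rule J.A_intros(3)[OF ek x])
    have "act (e (Suc k) * e (Suc (Suc k)) * e (Suc k)) x = e (Suc k) * E (Suc k) (e (Suc k) * x)"
      using x ek ex J.E_in_A[OF ex]
      by (simp add: J.act_mult J.A1_intros J.A_in_A1 J.e_in J.act_left_mult J.act_e)
    also have "\<dots> = \<tau> *\<^sub>R (e (Suc k) * x)" by (rule pull_up[OF x])
    also have "\<dots> = act (\<tau> *\<^sub>R e (Suc k)) x"
      using J.act_left_mult[OF J.A_intros(6)[OF ek] x] by simp
    finally show "act (e (Suc k) * e (Suc (Suc k)) * e (Suc k)) x = act (\<tau> *\<^sub>R e (Suc k)) x" .
  qed (simp_all add: J.A1_intros J.A_in_A1 ek J.e_in)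
qed

end


section \<open>Words in the Jones projections\<close>

lemma ascending_word_0 [simp]: "ascending_word e 0 = 1"
  and ascending_word_Suc: "ascending_word e (Suc n) = ascending_word e n * e (Suc n)"
  by (simp_all add: ascending_word_def)

lemma descending_word_0 [simp]: "descending_word e 0 = 1"
  and descending_word_Suc: "descending_word e (Suc n) = e (Suc n) * descending_word e n"
  by (simp_all add: descending_word_def)

context tower
begin

lemma word_in: "ascending_word e k \<in> A k" "descending_word e k \<in> A k"
proof (induction k)
  case 0
  show "ascending_word e 0 \<in> A 0" "descending_word e 0 \<in> A 0"
    using subalgebra_one[OF A_subalgebra] by simp_all
next
  case (Suc k)
  show "ascending_word e (Suc k) \<in> A (Suc k)" "descending_word e (Suc k) \<in> A (Suc k)"
    using Suc A_Suc_mono e_in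
    by (auto simp: ascending_word_Suc descending_word_Suc intro!: subalgebra_mult[OF A_subalgebra])
qed

lemma word_commute_B:
  assumes b: "b \<in> B"
  shows "b * ascending_word e k = ascending_word e k * b" "b * descending_word e k = descending_word e k * b"
proof (induction k)
  case (Suc k)
  have be: "b * e (Suc k) = e (Suc k) * b" by (rule e_commute[OF B_below[OF b]])
  have "b * ascending_word e (Suc k) = b * ascending_word e k * e (Suc k)"
    by (simp only: ascending_word_Suc mult.assoc)
  also have "\<dots> = ascending_word e k * (b * e (Suc k))" by (simp only: Suc mult.assoc)
  also have "\<dots> = ascending_word e (Suc k) * b" by (simp only: be ascending_word_Suc mult.assoc)
  finally show "b * ascending_word e (Suc k) = ascending_word e (Suc k) * b" .
  have "b * descending_word e (Suc k) = b * e (Suc k) * descending_word e k"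
    by (simp only: descending_word_Suc mult.assoc)
  also have "\<dots> = e (Suc k) * (b * descending_word e k)" by (simp only: be mult.assoc)
  also have "\<dots> = descending_word e (Suc k) * b" by (simp only: Suc descending_word_Suc mult.assoc)
  finally show "b * descending_word e (Suc k) = descending_word e (Suc k) * b" .
qed simp_all

text \<open>
  The innermost \<open>e 1 * a * e 1\<close> is \<open>E 0 a * e 1\<close>; the coefficient \<open>E 0 a\<close> lies in \<open>B\<close> and commutes with all
  Jones projections, which then collapse by the Temperley--Lieb relation.
\<close>

lemma descending_ascending:
  assumes a: "a \<in> A 0"
  shows "descending_word e (Suc k) * a * ascending_word e (Suc k) = \<tau> ^ k *\<^sub>R (E 0 a * e (Suc k))"
proof (induction k)
  case 0
  show ?case using e_compress[OF a] by (simp add: ascending_word_Suc descending_word_Suc)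
next
  case (Suc k)
  interpret E0: expectation "A 0" B "E 0" using expectation[of 0] by simp
  have comm: "E 0 a * e (Suc (Suc k)) = e (Suc (Suc k)) * E 0 a"
    by (rule e_commute[OF B_below[OF E0.E_in[OF a]]])
  have "descending_word e (Suc (Suc k)) * a * ascending_word e (Suc (Suc k)) =
        e (Suc (Suc k)) * (descending_word e (Suc k) * a * ascending_word e (Suc k)) * e (Suc (Suc k))"
    by (simp only: descending_word_Suc[of e "Suc k"] ascending_word_Suc[of e "Suc k"] mult.assoc)
  also have "\<dots> = \<tau> ^ k *\<^sub>R (e (Suc (Suc k)) * E 0 a * e (Suc k) * e (Suc (Suc k)))"
    unfolding Suc by (simp only: mult_scaleR_left mult_scaleR_right mult.assoc)
  also have "\<dots> = \<tau> ^ k *\<^sub>R (E 0 a * (e (Suc (Suc k)) * e (Suc k) * e (Suc (Suc k))))"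
    by (simp only: comm[symmetric] mult.assoc)
  also have "\<dots> = \<tau> ^ Suc k *\<^sub>R (E 0 a * e (Suc (Suc k)))"
    by (simp add: Temperley_Lieb_down)
  finally show ?case .
qed

lemma ascending_descending:
  "ascending_word e (Suc k) * descending_word e (Suc k) = \<tau> ^ k *\<^sub>R e 1"
proof (induction k)
  case 0
  show ?case using e_idem[of 0] by (simp add: ascending_word_Suc descending_word_Suc)
next
  case (Suc k)
  have "ascending_word e (Suc (Suc k)) * descending_word e (Suc (Suc k)) =
    ascending_word e k * (e (Suc k) * (e (Suc (Suc k)) * e (Suc (Suc k))) * e (Suc k)) * descending_word e k"
    by (simp only: ascending_word_Suc descending_word_Suc mult.assoc)
  also have "\<dots> = \<tau> *\<^sub>R (ascending_word e k * (e (Suc k) * e (Suc k)) * descending_word e k)"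
    by (simp add: e_idem Temperley_Lieb_up)
  also have "\<dots> = \<tau> *\<^sub>R (ascending_word e (Suc k) * descending_word e (Suc k))"
    by (simp only: ascending_word_Suc descending_word_Suc mult.assoc)
  finally show ?case by (simp add: Suc)
qed

end


section \<open>The trace-preserving expectation\<close>

context tower
begin

lemma tower_trace_diff:
  "x \<in> A k \<Longrightarrow> y \<in> A k \<Longrightarrow> tower_trace E k (x - y) = tower_trace E k x - tower_trace E k y"
proof (induction k arbitrary: x y)
  case 0
  interpret E0: expectation "A 0" B "E 0" using expectation[of 0] by simp
  show ?case using 0 by (simp add: E0.E_diff)
next
  case (Suc k)
  interpret Ek: expectation "A (Suc k)" "A k" "E (Suc k)" using expectation[of "Suc k"] by simp
  show ?case using Suc by (simp add: Ek.E_diff Ek.E_in)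
qed

lemma tower_trace_faithful:
  "x \<in> A k \<Longrightarrow> tower_trace E k (x\<^sup>\<star> * x) = 0 \<Longrightarrow> x = 0"
proof (induction k arbitrary: x)
  case 0
  then show ?case using E_faithful[of x 0] by simp
next
  case (Suc k)
  interpret Ek: expectation "A (Suc k)" "A k" "E (Suc k)" using expectation[of "Suc k"] by simp
  have "x\<^sup>\<star> * x \<in> A (Suc k)" using Suc by (simp add: Ek.A_intros)
  then have "positive_in (A k) (E (Suc k) (x\<^sup>\<star> * x))"
    using Suc by (simp add: positive_in_iff[OF A_subalgebra] Ek.E_in Ek.E_npos)
  then obtain w where w: "w \<in> A k" "E (Suc k) (x\<^sup>\<star> * x) = w\<^sup>\<star> * w" by (auto simp: positive_in_def)
  then have "w = 0" using Suc by simp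
  then show ?case using E_faithful[OF Suc.prems(1)] w(2) by simp
qed

lemma relative_commutants:
  "cstar_subalgebra (rel_commutant B (A k))" "cstar_subalgebra (rel_commutant (A 0) (A k))"
  "rel_commutant (A 0) (A k) \<subseteq> rel_commutant B (A k)"
proof -
  have B: "cstar_subalgebra B" using simple_B by (simp add: simple_cstar_subalgebra_def)
  show "cstar_subalgebra (rel_commutant B (A k))"
    by (rule rel_commutant_subalgebra[OF A_subalgebra subalgebra_adj[OF B]])
  show "cstar_subalgebra (rel_commutant (A 0) (A k))"
    by (rule rel_commutant_subalgebra[OF A_subalgebra subalgebra_adj[OF A_subalgebra]])
  show "rel_commutant (A 0) (A k) \<subseteq> rel_commutant B (A k)"
    using inclusion by (auto simp: rel_commutant_def)
qed

lemma E_rel_commutant: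
  assumes x: "x \<in> rel_commutant B (A (Suc k))"
  shows "E (Suc k) x \<in> rel_commutant B (A k)"
proof -
  interpret Ek: expectation "A (Suc k)" "A k" "E (Suc k)" using expectation[of "Suc k"] by simp
  have xA: "x \<in> A (Suc k)" using x by (simp add: rel_commutant_def)
  have "b * E (Suc k) x = E (Suc k) x * b" if b: "b \<in> B" for b
  proof -
    have "b * x = x * b" using x b by (simp add: rel_commutant_def)
    then show ?thesis using Ek.E_left[OF B_sub[OF b] xA] Ek.E_right[OF B_sub[OF b] xA] by simp
  qed
  then show ?thesis using Ek.E_in[OF xA] by (simp add: rel_commutant_def)
qed

end

text \<open>
  A quasi-basis of the first inclusion is fixed; averages over it act on all algebras of the tower.
\<close>

locale tower_basis = tower B A E e
  for B :: "'a::cstar_algebra set" and A E e +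
  fixes n :: nat and l :: "nat \<Rightarrow> 'a" and act :: "'a \<Rightarrow> 'a \<Rightarrow> 'a"
  assumes base: "jones (A 0) B (E 0) n l (A 1) (e 1) act"
    and base_balanced: "finite_index.balanced (A 0) B (E 0) n l"
begin

sublocale base: jones "A 0" B "E 0" n l "A 1" "e 1" act
  by (rule base)

lemma base_\<tau>: "base.\<tau> = \<tau>"
  by (simp add: base.\<tau>_def \<tau>_def tower_tau_def)

definition average :: "'a \<Rightarrow> 'a" where
  "average x = \<tau> *\<^sub>R base.index_map x"

lemma average_scaleR: "average (r *\<^sub>R x) = r *\<^sub>R average x"
  by (simp add: average_def base.index_map_scaleR)

lemma average_in_commutant:
  assumes x: "x \<in> rel_commutant B (A k)"
  shows "average x \<in> rel_commutant (A 0) (A k)"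
proof -
  have "base.index_map x \<in> A k"
    using x A_0_sub by (intro base.index_map_in A_subalgebra) (auto simp: rel_commutant_def)
  then have "average x \<in> A k" unfolding average_def by (rule subalgebra_scaleR[OF A_subalgebra])
  moreover have "a * average x = average x * a" if "a \<in> A 0" for a
    using base.index_map_commutes[of x a] that x by (simp add: average_def rel_commutant_def)
  ultimately show ?thesis by (simp add: rel_commutant_def)
qed

lemma average_mult:
  assumes "\<And>a. a \<in> A 0 \<Longrightarrow> a * z = z * a"
  shows "average (z * x) = z * average x"
proof -
  have "base.index_map (z * x) = z * base.index_map x"
    unfolding base.index_map_def sum_distrib_left
  proof (rule sum.cong[OF refl])
    fix i assume "i \<in> {..<n}"
    then have c: "l i * z = z * l i" by (intro assms base.l_in) simp
    have "l i * (z * x) * (l i)\<^sup>\<star> = l i * z * x * (l i)\<^sup>\<star>" by (simp only: mult.assoc)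
    then show "l i * (z * x) * (l i)\<^sup>\<star> = z * (l i * x * (l i)\<^sup>\<star>)" by (simp only: c mult.assoc)
  qed
  then show ?thesis by (simp add: average_def)
qed

lemma average_mult_right:
  assumes "\<And>a. a \<in> A 0 \<Longrightarrow> a * z = z * a"
  shows "average (x * z) = average x * z"
proof -
  have "base.index_map (x * z) = base.index_map x * z"
    unfolding base.index_map_def sum_distrib_right
  proof (rule sum.cong[OF refl])
    fix i assume "i \<in> {..<n}"
    then have c: "(l i)\<^sup>\<star> * z = z * (l i)\<^sup>\<star>" by (intro assms base.l_adj_in) simp
    show "l i * (x * z) * (l i)\<^sup>\<star> = l i * x * (l i)\<^sup>\<star> * z" by (simp only: c mult.assoc)
  qed
  then show ?thesis by (simp add: average_def)
qed

lemma average_one: "average 1 = 1"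
  using base.Ind_scalar(2)[OF base.centre_A]
  by (simp add: average_def base.index_map_one of_real_def base.\<tau>_def flip: base_\<tau>)

text \<open>
  Elements that commute with \<open>A 0\<close> can be taken out of the average, and the average of \<open>x\<^sup>\<star> * x\<close> is a sum
  of elements \<open>w\<^sup>\<star> * w\<close>.
\<close>

lemma average_expectation: "expectation (rel_commutant B (A k)) (rel_commutant (A 0) (A k)) (restrict average (rel_commutant B (A k)))"
proof -
  let ?C = "rel_commutant B (A k)" and ?D = "rel_commutant (A 0) (A k)"
  note C = relative_commutants(1)[of k]
  have DC: "x \<in> ?C" if "x \<in> ?D" for x using that relative_commutants(3) by blast
  have comm: "a * x = x * a" if "x \<in> ?D" "a \<in> A 0" for x a using that by (simp add: rel_commutant_def)
  show ?thesis
  proof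
    show "restrict average ?C x \<in> ?D" if "x \<in> ?C" for x using average_in_commutant that by simp
    show "restrict average ?C b = b" if "b \<in> ?D" for b
      using average_mult[OF comm[OF that], of 1] DC[OF that] by (simp add: average_one)
    show "restrict average ?C (x + y) = restrict average ?C x + restrict average ?C y" if "x \<in> ?C" "y \<in> ?C" for x y
      using that subalgebra_add[OF C] by (simp add: average_def base.index_map_add scaleR_add_right)
    show "restrict average ?C (c *\<^sub>C x) = c *\<^sub>C restrict average ?C x" if "x \<in> ?C" for x c
      using that subalgebra_scaleC[OF C] by (simp add: average_def base.index_map_scaleC scaleC_scaleR)
    show "npos (restrict average ?C (x\<^sup>\<star> * x))" if x: "x \<in> ?C" for x
    proof -
      have "base.index_map (x\<^sup>\<star> * x) = (\<Sum>i<n. (x * (l i)\<^sup>\<star>)\<^sup>\<star> * (x * (l i)\<^sup>\<star>))"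
        by (simp add: base.index_map_def adj_mult adj_adj mult.assoc)
      then have "npos (average (x\<^sup>\<star> * x))"
        unfolding average_def using \<tau>_pos by (intro npos_scaleR) (auto intro: npos_sum npos_adj_mult)
      then show ?thesis using x by (simp add: subalgebra_mult[OF C] subalgebra_adj[OF C])
    qed
    show "restrict average ?C (b * x) = b * restrict average ?C x" if "b \<in> ?D" "x \<in> ?C" for b x
      using that average_mult[OF comm[OF that(1)]] DC subalgebra_mult[OF C] by simp
    show "restrict average ?C (x * b) = restrict average ?C x * b" if "b \<in> ?D" "x \<in> ?C" for b x
      using that average_mult_right[OF comm[OF that(1)]] DC subalgebra_mult[OF C] by simp
  qed (rule relative_commutants)+
qed

text \<open>
  The maps \<open>E 1\<close>, \<open>E 2\<close>, \<open>\<dots>\<close> are \<open>A 0\<close>-bimodule maps and commute with the average. This reduces the claim to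
  the relative commutant of \<open>B\<close> in \<open>A 0\<close>, where the average is \<open>E 0\<close> by the balance condition.
\<close>

lemma tower_trace_average: "x \<in> rel_commutant B (A k) \<Longrightarrow> tower_trace E k (average x) = tower_trace E k x"
proof (induction k arbitrary: x)
  case 0
  have "average x = E 0 x"
    using base_balanced 0 base.Ind_scalar(2)[OF base.centre_A]
    by (simp add: base.balanced_def average_def base_\<tau>[symmetric] base.\<tau>_def)
  moreover have "x \<in> A 0" using 0 by (simp add: rel_commutant_def)
  ultimately show ?case by (simp add: base.E_fix base.E_in)
next
  case (Suc k)
  interpret Ek: expectation "A (Suc k)" "A k" "E (Suc k)" using expectation[of "Suc k"] by simp
  have x: "x \<in> A (Suc k)" using Suc by (simp add: rel_commutant_def)
  have l: "l i \<in> A k" "(l i)\<^sup>\<star> \<in> A k" if "i < n" for i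
    using that by (auto intro!: A_0_sub base.l_in base.l_adj_in)
  have lxl: "l i * x * (l i)\<^sup>\<star> \<in> A (Suc k)" if "i < n" for i
    using that x by (simp add: Ek.A_intros Ek.B_in_A l)
  have "E (Suc k) (base.index_map x) = base.index_map (E (Suc k) x)"
    unfolding base.index_map_def
    by (subst Ek.E_sum) (auto simp: lxl l x Ek.E_bimodule)
  moreover have "base.index_map x \<in> A (Suc k)"
    unfolding base.index_map_def by (intro subalgebra_sum[OF A_subalgebra]) (simp add: lxl)
  ultimately have "E (Suc k) (average x) = average (E (Suc k) x)"
    by (simp add: average_def Ek.E_scaleR)
  then show ?case using Suc.IH[OF E_rel_commutant[OF Suc.prems]] by simp
qed

text \<open>
  For another trace-preserving expectation \<open>F\<close> put \<open>d = F x - average x\<close>. Taking \<open>d\<^sup>\<star>\<close> inside both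
  expectations shows that the trace vanishes on \<open>d\<^sup>\<star> * d\<close>, and the trace is faithful.
\<close>

lemma commutant_expectation_eq:
  "commutant_expectation B A E k = restrict average (rel_commutant B (A k))"
  unfolding commutant_expectation_def
proof (rule the_equality)
  let ?C = "rel_commutant B (A k)" and ?D = "rel_commutant (A 0) (A k)"
  let ?P = "restrict average ?C"
  interpret Q: expectation ?C ?D ?P by (rule average_expectation)
  show "?P \<in> extensional ?C \<and> cond_expectation ?C ?D ?P \<and>
    (\<forall>x\<in>?C. tower_trace E k (?P x) = tower_trace E k x)"
    using Q.cond_expectation tower_trace_average by simp
  fix F assume F: "F \<in> extensional ?C \<and> cond_expectation ?C ?D F \<and>
    (\<forall>x\<in>?C. tower_trace E k (F x) = tower_trace E k x)"
  interpret F: expectation ?C ?D F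
    using F by (intro expectationI relative_commutants) simp
  show "F = ?P"
  proof (rule extensionalityI)
    show "F \<in> extensional ?C" "?P \<in> extensional ?C" using F by auto
    fix x assume x: "x \<in> ?C"
    define d where "d = F x - ?P x"
    have d: "d \<in> ?D" unfolding d_def by (intro subalgebra_diff[OF F.B] F.E_in Q.E_in x)
    then have da: "d\<^sup>\<star> \<in> ?D" by (rule subalgebra_adj[OF F.B])
    have dx: "d\<^sup>\<star> * x \<in> ?C" by (intro subalgebra_mult[OF F.A] F.B_in_A da x)
    have DA: "y \<in> A k" if "y \<in> ?D" for y using that by (simp add: rel_commutant_def)
    have "F (d\<^sup>\<star> * x) - ?P (d\<^sup>\<star> * x) = d\<^sup>\<star> * d"
      unfolding F.E_left[OF da x] Q.E_left[OF da x] by (simp only: d_def right_diff_distrib)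
    then have "tower_trace E k (d\<^sup>\<star> * d) = tower_trace E k (F (d\<^sup>\<star> * x)) - tower_trace E k (?P (d\<^sup>\<star> * x))"
      using tower_trace_diff[OF DA[OF F.E_in[OF dx]] DA[OF Q.E_in[OF dx]]] by (simp only:)
    also have "\<dots> = 0" using F dx tower_trace_average[OF dx] by simp
    finally have "d = 0" by (rule tower_trace_faithful[OF DA[OF d]])
    then show "F x = ?P x" by (simp add: d_def)
  qed
qed


section \<open>The Fourier transform and its inverse\<close>

abbreviation factor :: "nat \<Rightarrow> real" where
  "factor k \<equiv> \<tau> powr (- (real k + 2) / 2)"

lemma factor_square: "factor k * factor k * \<tau> ^ (k + 2) = 1"
proof -
  have "factor k * factor k = \<tau> powr (- real (k + 2))"
    unfolding powr_add[symmetric] by (rule arg_cong[where f = "\<lambda>r. \<tau> powr r"]) simp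
  moreover have "\<tau> ^ (k + 2) = \<tau> powr real (k + 2)"
    by (rule powr_realpow[OF \<tau>_pos, symmetric])
  moreover have "\<tau> powr (- real (k + 2)) * \<tau> powr real (k + 2) = 1"
    unfolding powr_add[symmetric] using \<tau>_pos by simp
  ultimately show ?thesis by (simp only:)
qed

lemma word_product_in:
  assumes "x \<in> rel_commutant B (A k)"
  shows "x * descending_word e (Suc k) \<in> rel_commutant B (A (Suc k))"
proof -
  have x: "x \<in> A k" "\<And>b. b \<in> B \<Longrightarrow> b * x = x * b" using assms by (auto simp: rel_commutant_def)
  have "b * (x * descending_word e (Suc k)) = x * descending_word e (Suc k) * b" if b: "b \<in> B" for b
    by (intro commute_mult x(2) word_commute_B b)
  moreover have "x * descending_word e (Suc k) \<in> A (Suc k)"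
    using x(1) A_Suc_mono by (intro subalgebra_mult[OF A_subalgebra] word_in) auto
  ultimately show ?thesis by (simp add: rel_commutant_def)
qed

lemma fourier_eq:
  assumes "x \<in> rel_commutant B (A k)"
  shows "fourier B A E e k x = factor k *\<^sub>R average (x * descending_word e (Suc k))"
  using word_product_in[OF assms]
  unfolding fourier_def commutant_expectation_eq \<tau>_def[symmetric] by simp

lemma fourier_in:
  assumes "x \<in> rel_commutant B (A k)"
  shows "fourier B A E e k x \<in> rel_commutant (A 0) (A (Suc k))"
  unfolding fourier_eq[OF assms]
  by (intro subalgebra_scaleR[OF relative_commutants(2)] average_in_commutant word_product_in assms)

lemma inverse_fourier_eq:
  "inverse_fourier A E e k x = factor k *\<^sub>R E (Suc k) (x * ascending_word e (Suc k))"
  by (simp add: inverse_fourier_def flip: \<tau>_def)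

lemma inverse_fourier_in:
  assumes "x \<in> rel_commutant (A 0) (A (Suc k))"
  shows "inverse_fourier A E e k x \<in> rel_commutant B (A k)"
proof -
  have x: "x \<in> A (Suc k)" using assms by (simp add: rel_commutant_def)
  have comm: "b * x = x * b" if "b \<in> B" for b
    using assms subsetD[OF inclusion that] by (simp add: rel_commutant_def)
  have "b * (x * ascending_word e (Suc k)) = x * ascending_word e (Suc k) * b" if b: "b \<in> B" for b
    by (intro commute_mult comm word_commute_B b)
  then have "x * ascending_word e (Suc k) \<in> rel_commutant B (A (Suc k))"
    using subalgebra_mult[OF A_subalgebra x word_in(1)] by (simp add: rel_commutant_def)
  then show ?thesis
    unfolding inverse_fourier_eq by (intro subalgebra_scaleR[OF relative_commutants(1)] E_rel_commutant)
qed

text \<open>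
  Each summand \<open>l i * x * e (k+1) \<dots> e 1 * (l i)\<^sup>\<star> * e 1 \<dots> e (k+1)\<close> equals
  \<open>\<tau> ^ k *\<^sub>R (l i * E 0 ((l i)\<^sup>\<star>) * x * e (k+1))\<close>, and the sum of the \<open>l i * E 0 ((l i)\<^sup>\<star>)\<close> is the expansion
  of \<open>1\<close>. The remaining powers of \<open>\<tau>\<close> come from the average and from \<open>E (k+1) (e (k+1)) = \<tau>\<close>.
\<close>

lemma inverse_fourier_fourier:
  assumes x: "x \<in> rel_commutant B (A k)"
  shows "inverse_fourier A E e k (fourier B A E e k x) = x"
proof -
  let ?d = "descending_word e (Suc k)" and ?a = "ascending_word e (Suc k)"
  interpret Ek: expectation "A (Suc k)" "A k" "E (Suc k)" using expectation[of "Suc k"] by simp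
  have xA: "x \<in> A k" and xB: "\<And>b. b \<in> B \<Longrightarrow> b * x = x * b" using x by (auto simp: rel_commutant_def)
  have l: "l i \<in> A k" "E 0 ((l i)\<^sup>\<star>) \<in> B" "(l i)\<^sup>\<star> \<in> A 0" if "i < n" for i
    using that by (auto intro!: A_0_sub base.l_in base.l_adj_in base.E_in)
  have PA: "average (x * ?d) \<in> A (Suc k)"
    using average_in_commutant[OF word_product_in[OF x]] by (simp add: rel_commutant_def)
  have "average (x * ?d) * ?a = \<tau> *\<^sub>R (\<Sum>i<n. l i * x * (?d * (l i)\<^sup>\<star> * ?a))"
    by (simp add: average_def base.index_map_def sum_distrib_right mult.assoc)
  also have "\<dots> = \<tau> *\<^sub>R (\<Sum>i<n. \<tau> ^ k *\<^sub>R (l i * E 0 ((l i)\<^sup>\<star>) * x * e (Suc k)))"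
  proof (intro arg_cong[where f = "scaleR \<tau>"] sum.cong refl)
    fix i assume "i \<in> {..<n}"
    then have i: "i < n" by simp
    have "l i * x * (?d * (l i)\<^sup>\<star> * ?a) = \<tau> ^ k *\<^sub>R (l i * (x * E 0 ((l i)\<^sup>\<star>)) * e (Suc k))"
      unfolding descending_ascending[OF l(3)[OF i]] by (simp only: mult_scaleR_right mult.assoc)
    then show "l i * x * (?d * (l i)\<^sup>\<star> * ?a) = \<tau> ^ k *\<^sub>R (l i * E 0 ((l i)\<^sup>\<star>) * x * e (Suc k))"
      by (simp only: xB[OF l(2)[OF i], symmetric] mult.assoc)
  qed
  also have "\<dots> = \<tau> ^ Suc k *\<^sub>R ((\<Sum>i<n. l i * E 0 ((l i)\<^sup>\<star> * 1)) * x * e (Suc k))"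
    by (simp add: sum_distrib_right flip: scaleR_sum_right)
  also have "\<dots> = \<tau> ^ Suc k *\<^sub>R (x * e (Suc k))"
    by (simp only: base.expand_left[OF subalgebra_one[OF A_subalgebra]] mult_1_left)
  finally have Pa: "average (x * ?d) * ?a = \<tau> ^ Suc k *\<^sub>R (x * e (Suc k))" .
  have "E (Suc k) (average (x * ?d) * ?a) = \<tau> ^ Suc k *\<^sub>R (x * of_real \<tau>)"
    unfolding Pa using xA e_in[of k]
    by (simp add: Ek.E_scaleR Ek.A_intros Ek.B_in_A Ek.E_left E_Jones)
  then have "E (Suc k) (average (x * ?d) * ?a) = \<tau> ^ (k + 2) *\<^sub>R x" by (simp add: of_real_def)
  moreover have "average (x * ?d) * ?a \<in> A (Suc k)" by (intro subalgebra_mult[OF A_subalgebra] PA word_in)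
  ultimately have "inverse_fourier A E e k (fourier B A E e k x) = (factor k * factor k * \<tau> ^ (k + 2)) *\<^sub>R x"
    by (simp add: inverse_fourier_eq fourier_eq[OF x] Ek.E_scaleR del: power_Suc)
  then show ?thesis by (simp only: factor_square scaleR_one)
qed

text \<open>
  Pushing down removes \<open>E (k+1)\<close>, the two words in Jones projections collapse to \<open>e 1\<close>, and \<open>x\<close>, which
  commutes with \<open>A 0\<close>, comes out of the average.
\<close>

lemma fourier_inverse_fourier:
  assumes x: "x \<in> rel_commutant (A 0) (A (Suc k))"
  shows "fourier B A E e k (inverse_fourier A E e k x) = x"
proof -
  let ?d = "descending_word e (Suc k)" and ?a = "ascending_word e (Suc k)"
  interpret Ek: expectation "A (Suc k)" "A k" "E (Suc k)" using expectation[of "Suc k"] by simp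
  have xA: "x \<in> A (Suc k)" and comm: "\<And>a. a \<in> A 0 \<Longrightarrow> a * x = x * a"
    using x by (auto simp: rel_commutant_def)
  let ?z = "x * ascending_word e k"
  have z: "?z \<in> A (Suc k)" using A_Suc_mono word_in(1)[of k] by (intro subalgebra_mult[OF A_subalgebra] xA) auto
  have "E (Suc k) (x * ?a) * ?d = E (Suc k) (?z * e (Suc k)) * e (Suc k) * descending_word e k"
    by (simp only: ascending_word_Suc descending_word_Suc mult.assoc)
  also have "\<dots> = \<tau> *\<^sub>R (?z * (e (Suc k) * e (Suc k)) * descending_word e k)"
    by (simp only: push_down[OF z] e_idem mult_scaleR_left)
  also have "\<dots> = \<tau> *\<^sub>R (x * (?a * ?d))"
    by (simp only: ascending_word_Suc descending_word_Suc mult.assoc)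
  also have "\<dots> = \<tau> ^ Suc k *\<^sub>R (x * e 1)" by (simp add: ascending_descending)
  finally have *: "E (Suc k) (x * ?a) * ?d = \<tau> ^ Suc k *\<^sub>R (x * e 1)" .
  have "average (e 1) = of_real \<tau>"
    using base.sum_l_e_l by (simp add: average_def base.index_map_def of_real_def)
  then have "average (x * e 1) = \<tau> *\<^sub>R x"
    using average_mult[OF comm, of "e 1"] by (simp add: of_real_def)
  then have "average (E (Suc k) (x * ?a) * ?d) = \<tau> ^ (k + 2) *\<^sub>R x"
    unfolding * average_scaleR by simp
  then have "average ((factor k *\<^sub>R E (Suc k) (x * ?a)) * ?d) = factor k *\<^sub>R \<tau> ^ (k + 2) *\<^sub>R x"
    unfolding mult_scaleR_left average_scaleR by (simp only:)
  then have "fourier B A E e k (inverse_fourier A E e k x) = (factor k * factor k * \<tau> ^ (k + 2)) *\<^sub>R x"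
    using fourier_eq[OF inverse_fourier_in[OF x]] by (simp add: inverse_fourier_eq del: power_Suc)
  then show ?thesis by (simp only: factor_square scaleR_one)
qed

text \<open>
  The Fourier transform maps the scalars onto a complex line, and that line contains \<open>1\<close>.
\<close>

lemma irreducible_next:
  assumes irr: "irreducible_inclusion B (A 0)"
  shows "irreducible_inclusion (A 0) (A 1)"
proof -
  let ?D = "rel_commutant (A 0) (A 1)"
  have C: "rel_commutant B (A 0) = range (\<lambda>c. c *\<^sub>C 1)" using irr by (simp add: irreducible_inclusion_def)
  have scalar_in: "c *\<^sub>C 1 \<in> ?D" for c
    by (intro subalgebra_scaleC subalgebra_one relative_commutants)
  define f where "f = fourier B A E e 0 1"
  have f: "fourier B A E e 0 (c *\<^sub>C 1) = c *\<^sub>C f" for c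
  proof -
    have "c *\<^sub>C 1 \<in> rel_commutant B (A 0)" "1 \<in> rel_commutant B (A 0)"
      by (intro subalgebra_scaleC subalgebra_one relative_commutants)+
    then show ?thesis
      by (simp add: f_def fourier_eq average_def mult_scaleC_left base.index_map_scaleC scaleC_scaleR)
  qed
  have multiple: "\<exists>c. x = c *\<^sub>C f" if x: "x \<in> ?D" for x
  proof -
    have "inverse_fourier A E e 0 x \<in> rel_commutant B (A 0)" using inverse_fourier_in[of x 0] x by simp
    then obtain c where "inverse_fourier A E e 0 x = c *\<^sub>C 1" using C by blast
    then have "x = c *\<^sub>C f" using fourier_inverse_fourier[of x 0] x f[of c] by simp
    then show ?thesis ..
  qed
  obtain s where s: "1 = s *\<^sub>C f" using multiple[OF scalar_in[of 1]] by auto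
  then have "s \<noteq> 0" by auto
  have "?D \<subseteq> range (\<lambda>c. c *\<^sub>C 1)"
  proof
    fix x assume "x \<in> ?D"
    then obtain c where "x = c *\<^sub>C f" using multiple by blast
    also have "\<dots> = (c / s) *\<^sub>C (s *\<^sub>C f)" using \<open>s \<noteq> 0\<close> by (simp add: scaleC_scaleC)
    finally have "x = (c / s) *\<^sub>C 1" by (simp only: s[symmetric])
    then show "x \<in> range (\<lambda>c. c *\<^sub>C 1)" by blast
  qed
  then show ?thesis using scalar_in by (auto simp: irreducible_inclusion_def)
qed

end


theorem proposition3p2:
  fixes B :: "'a::cstar_algebra set"
    and A :: "nat \<Rightarrow> 'a set"
    and E :: "nat \<Rightarrow> 'a \<Rightarrow> 'a"
    and e :: "nat \<Rightarrow> 'a"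
  assumes simple_B: "simple_cstar_subalgebra B"
    and simple_A: "simple_cstar_subalgebra (A 0)"
    and inclusion: "B \<subseteq> A 0"
    and finite_index: "\<exists>G. finite_index_expectation (A 0) B G"
    and tower: "basic_construction_tower B A E e"
  shows "(\<forall>k.
            fourier B A E e k \<in> rel_commutant B (A k) \<rightarrow> rel_commutant (A 0) (A (k + 1)) \<and>
            inverse_fourier A E e k \<in> rel_commutant (A 0) (A (k + 1)) \<rightarrow> rel_commutant B (A k) \<and>
            (\<forall>x \<in> rel_commutant (A 0) (A (k + 1)).
               fourier B A E e k (inverse_fourier A E e k x) = x) \<and>
            (\<forall>x \<in> rel_commutant B (A k).
               inverse_fourier A E e k (fourier B A E e k x) = x)) \<and>
         (irreducible_inclusion B (A 0) \<longrightarrow> irreducible_inclusion (A 0) (A 1))"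
proof -
  interpret T: tower B A E e by unfold_locales (rule simple_B simple_A inclusion tower)+
  obtain n l act where "jones (A 0) (below B A 0) (E 0) n l (A (Suc 0)) (e (Suc 0)) act"
    "finite_index.balanced (A 0) (below B A 0) (E 0) n l"
    using T.level[of 0] by blast
  then interpret T: tower_basis B A E e n l act
    by (intro tower_basis.intro tower_basis_axioms.intro T.tower_axioms) simp_all
  show ?thesis
    using T.fourier_in T.inverse_fourier_in T.fourier_inverse_fourier T.inverse_fourier_fourier
      T.irreducible_next by auto
qed


end
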